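(* Let $K/C$ be a separable field extension, let $\tau$ be a henselian topology on $K$, let $c$ be a well-ordered $p$-basis of $C$, let $X\subseteq K^m$ be a set that is definable in $K$ by an existential formula of the language of rings with parameters from $C$, and let $a\in X$. Then there exist $n\in\mathbb{N}$, a tuple $b\in K^n$ and a $\tau$-neighbourhood $U\subseteq K^\ell$ of $\lambda_{K/b/c}a$ (where $\ell=|\lambda_{K/b/c}a|$) such that $X$ contains the image of $$\mathrm{locus}(\lambda_{K/b/c}a/C)(K)\cap U$$ under the coordinate projection $\sigma_{K/b/c}:\mathbb{A}_C^\ell\to\mathbb{A}_C^m$.
   Context: $p$ is the characteristic exponent of $K$ (the characteristic if positive, else $1$); $\mathbb{F}$ is the prime field; $F^{(p)}=\{x^p:x\in F\}$; $F^{(p)}C(A)$ is the subfield of $F$ generated by $F^{(p)}\cup C\cup A$. An extension $F/C$ is separable if $F$ is linearly disjoint from $C^{1/p}$ over $C$. A subset $A\subseteq F$ is $p$-independent in $F$ over $C$ if $x\notin F^{(p)}C(A\setminus\{x\})$ for all $x\in A$; it is a $p$-basis of $F$ over $C$ if moreover $F=F^{(p)}C(A)$; without "over $C$" we mean $C=\mathbb{F}$. Lambda functions: for a well-ordered set $b$ that is $p$-independent in $F$, and $x\in F^{(p)}(b)$, there is a unique finitely supported family $(\lambda^b_I(x))_I$ in $F$, indexed by finitely supported $I:b\to\{0,\dots,p-1\}$, with $x=\sum_I b^I\lambda^b_I(x)^p$, $b^I=\prod_{y\in b}y^{I(y)}$. For $A\subseteq F^{(p)}(b)$, $\lambda^b(A)=\{\lambda_I^b(x):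 x\in A, I\}$. Splitting pairs: let $F/C$ be separable and $c$ a well-ordered $p$-basis of $C$. For well-ordered subsets $a,b$ of $F$ with $a$ $p$-independent in $F$ over $C$, put $\mathrm{L}_{F/c}(a,b)=(a',b')$, where $a'$ is $a$ followed by the maximal subset of $b$ that is $p$-independent in $F$ over $C(a)$, chosen greedily along the well-order of $b$; and $b'$ is $b$ followed by $\lambda^{ca'}(b)$, where $ca'$ is the concatenation of $c$ and $a'$ (and $\lambda^{ca'}(b)$ is ordered lexicographically by element of $b$ and then multi-index). Define $\mathrm{L}^0_{F/c}(a)=(\emptyset,a)$ and $\mathrm{L}^{n+1}_{F/c}(a)=\mathrm{L}_{F/c}(\mathrm{L}^n_{F/c}(a))$; write $C(\mathrm{L}^n_{F/c}(a))$ for the field generated over $C$ by both components. For finite tuples $a,b$ from $F$, let $n$ be minimal such that $C(\mathrm{L}^n_{F/c}(a),b)/C(\mathrm{L}^n_{F/c}(a))$ is separable (for every ordering of $a$); such $n$ exists. Then $\lambda_{F/b/c}a$ is the union of the two components of $\mathrm{L}^n_{F/c}(a)$, a finite set, regarded as a finite tuple; it contains the entries of $a$. With $\ell=|\lambda_{F/b/c}a|$ and $m$ the length of $a$, $\sigma_{F/b/c}:\mathbb{A}^\ell_C\to\mathbb{A}^m_C$ is the coordinate projection mapping $\lambda_{F/b/c}a$ to $a$. Locus: for a tuple $e\in K^\ell$, $\mathrm{locus}(e/C)\subseteq\mathbb{A}_C^\ell$ is the smallest Zariski closed set defined over $C$ having $e$ as a $K$-rational point, i.e. the zero set of $\{f\in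 C[x]: f(e)=0\}$; $(K)$ denotes $K$-rational points. Henselian topology: a V-topology on $K$ (a field topology induced by a nontrivial absolute value or a nontrivial valuation) that is locally equivalent, in the sense of Prestel and Ziegler, to the topology induced by a nontrivial henselian valuation on some field. Equivalently, a V-topology satisfying the Implicit Function Theorem for polynomials: for every $f\in K[X_0,\dots,X_{m-1},Y]$ and $(e,d)\in K^{m}\times K$ with $f(e,d)=0$ and $\frac{\partial f}{\partial Y}(e,d)\neq0$ there are $\tau$-open $U\ni e$, $V\ni d$ such that $\{f=0\}\cap(U\times V)$ is the graph of a continuous function $U\to V$. Powers $K^\ell$ carry the product topology. *)

theory Defs
  imports
    "HOL-Analysis.Analysis"
    "HOL-Library.Poly_Mapping"
    "HOL-Algebra.Algebraic_Closure_Type"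
    "HOL-Algebra.Generated_Fields"
    "HOL-Algebra.Embedded_Algebras"
begin

text \<open>
  All fields are subfields of an ambient type \<open>'a\<close> of class \<^class>\<open>field\<close>; the field \<open>K\<close> itself
  is \<open>UNIV\<close>. They are treated with the carrier-based algebra library through
  \<open>ring_of_type_algebra\<close>, the type viewed as a ring record.
\<close>

abbreviation gen_field :: "'a::field set \<Rightarrow> 'a set" where
  "gen_field \<equiv> generate_field ring_of_type_algebra"

abbreviation prime_field :: "'a::field set" where
  "prime_field \<equiv> gen_field {}"

definition char_exp :: "'a::field itself \<Rightarrow> nat" where
  "char_exp _ = (if CHAR('a) = 0 then 1 else CHAR('a))"

definition pth_powers :: "'a::field set \<Rightarrow> 'a set" where
  "pth_powers F = (\<lambda>x. x ^ char_exp TYPE('a)) ` F"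


section \<open>Separable extensions\<close>

definition linearly_disjoint :: "'b ring \<Rightarrow> 'b set \<Rightarrow> 'b set \<Rightarrow> 'b set \<Rightarrow> bool" where
  "linearly_disjoint R E L C \<longleftrightarrow>
     (\<forall>us. set us \<subseteq> E \<and> ring.independent R C us \<longrightarrow> ring.independent R L us)"

text \<open>\<open>C\<^sup>1\<^sup>/\<^sup>p\<close>, formed in the algebraic closure of the ambient field.\<close>

definition pth_roots :: "'a::field set \<Rightarrow> 'a alg_closure set" where
  "pth_roots C = {x. x ^ char_exp TYPE('a) \<in> to_ac ` C}"

definition separable_ext :: "'a::field set \<Rightarrow> 'a set \<Rightarrow> bool" where
  "separable_ext F C \<longleftrightarrow>
     subfield F ring_of_type_algebra \<and> subfield C ring_of_type_algebra \<and> C \<subseteq> F \<and>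
     linearly_disjoint ring_of_type_algebra (to_ac ` F) (pth_roots C) (to_ac ` C)"


section \<open>p-independence\<close>

definition p_independent :: "'a::field set \<Rightarrow> 'a set \<Rightarrow> 'a set \<Rightarrow> bool" where
  "p_independent F C A \<longleftrightarrow>
     A \<subseteq> F \<and> (\<forall>x\<in>A. x \<notin> gen_field (pth_powers F \<union> C \<union> (A - {x})))"

definition p_basis :: "'a::field set \<Rightarrow> 'a set \<Rightarrow> 'a set \<Rightarrow> bool" where
  "p_basis F C A \<longleftrightarrow> p_independent F C A \<and> F = gen_field (pth_powers F \<union> C \<union> A)"


section \<open>Lambda functions\<close>

text \<open>
  A well-ordered set is a reflexive well-order \<open>r\<close>; its set of elements is \<^term>\<open>Field r\<close>.
  Finitely supported multi-indices are elements of \<open>'a \<Rightarrow>\<^sub>0 nat\<close>, and finitely supported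
  families indexed by them are elements of \<open>('a \<Rightarrow>\<^sub>0 nat) \<Rightarrow>\<^sub>0 'a\<close>.
\<close>

definition multi_indices :: "'a::field set \<Rightarrow> ('a \<Rightarrow>\<^sub>0 nat) set" where
  "multi_indices B =
     {I. Poly_Mapping.keys I \<subseteq> B \<and> (\<forall>y. Poly_Mapping.lookup I y < char_exp TYPE('a))}"

definition lambda_family :: "'a::field set \<Rightarrow> 'a set \<Rightarrow> 'a \<Rightarrow> ('a \<Rightarrow>\<^sub>0 nat) \<Rightarrow>\<^sub>0 'a" where
  "lambda_family F B x =
     (THE g. Poly_Mapping.keys g \<subseteq> multi_indices B \<and>
             (\<forall>I. Poly_Mapping.lookup g I \<in> F) \<and>
             x = (\<Sum>I\<in>Poly_Mapping.keys g.
                    (\<Prod>y\<in>Poly_Mapping.keys I. y ^ Poly_Mapping.lookup I y) *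
                    Poly_Mapping.lookup g I ^ char_exp TYPE('a)))"

definition lambda_fun :: "'a::field set \<Rightarrow> 'a set \<Rightarrow> ('a \<Rightarrow>\<^sub>0 nat) \<Rightarrow> 'a \<Rightarrow> 'a" where
  "lambda_fun F B I x = Poly_Mapping.lookup (lambda_family F B x) I"

text \<open>
  Multi-indices are compared at the largest place where they differ. This is ordinal exponentiation
  and a well-order, whereas comparing at the smallest such place is not one if \<open>r\<close> is infinite.
\<close>

definition multi_index_le :: "'a rel \<Rightarrow> ('a \<Rightarrow>\<^sub>0 nat) \<Rightarrow> ('a \<Rightarrow>\<^sub>0 nat) \<Rightarrow> bool" where
  "multi_index_le r I J \<longleftrightarrow>
     I = J \<or>
     (\<exists>y\<in>Field r. Poly_Mapping.lookup I y < Poly_Mapping.lookup J y \<and>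
        (\<forall>z. (y, z) \<in> r \<and> z \<noteq> y \<longrightarrow> Poly_Mapping.lookup I z = Poly_Mapping.lookup J z))"

definition lex_le :: "'a rel \<Rightarrow> 'a rel \<Rightarrow> 'a \<times> ('a \<Rightarrow>\<^sub>0 nat) \<Rightarrow> 'a \<times> ('a \<Rightarrow>\<^sub>0 nat) \<Rightarrow> bool" where
  "lex_le r s = (\<lambda>(x, I) (y, J).
     (x \<noteq> y \<and> (x, y) \<in> s) \<or> (x = y \<and> multi_index_le r I J))"

text \<open>
  The set of all \<open>\<lambda>\<^sub>I(x)\<close> with respect to \<open>r\<close>, for \<open>x\<close> in \<open>s\<close>. One element may be of this form for
  several pairs \<open>(x, I)\<close>; elements are ordered by their first occurrence.
\<close>

definition lambda_order :: "'a::field set \<Rightarrow> 'a rel \<Rightarrow> 'a rel \<Rightarrow> 'a rel" where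
  "lambda_order F r s =
     (let occ = (\<lambda>z. {(x, I). x \<in> Field s \<and> I \<in> multi_indices (Field r) \<and>
                              lambda_fun F (Field r) I x = z})
      in {(z, w). occ w \<noteq> {} \<and> (\<exists>u\<in>occ z. \<forall>v\<in>occ w. lex_le r s u v)})"


section \<open>Splitting pairs\<close>

text \<open>Concatenation; an element of both orders keeps its place in the first one.\<close>

definition order_append :: "'a rel \<Rightarrow> 'a rel \<Rightarrow> 'a rel" where
  "order_append r s =
     r \<union> Field r \<times> (Field s - Field r) \<union> Restr s (Field s - Field r)"

text \<open>
  The greedy choice: going along \<open>b\<close>, an element is taken iff together with the elements taken
  before it, it is p-independent in \<open>F\<close> over \<open>D\<close>.
\<close>

definition greedy_subset :: "'a::field set \<Rightarrow> 'a set \<Rightarrow> 'a rel \<Rightarrow> 'a set" where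
  "greedy_subset F D b =
     (THE S. S \<subseteq> Field b \<and>
        (\<forall>x\<in>Field b. x \<in> S \<longleftrightarrow>
           p_independent F D (insert x {y\<in>S. y \<noteq> x \<and> (y, x) \<in> b})))"

definition split_step ::
  "'a::field set \<Rightarrow> 'a set \<Rightarrow> 'a rel \<Rightarrow> 'a rel \<times> 'a rel \<Rightarrow> 'a rel \<times> 'a rel" where
  "split_step F C c = (\<lambda>(a, b).
     let a' = order_append a (Restr b (greedy_subset F (gen_field (C \<union> Field a)) b))
     in (a', order_append b (lambda_order F (order_append c a') b)))"

definition split_iter ::
  "'a::field set \<Rightarrow> 'a set \<Rightarrow> 'a rel \<Rightarrow> nat \<Rightarrow> 'a rel \<Rightarrow> 'a rel \<times> 'a rel" where
  "split_iter F C c n a = (split_step F C c ^^ n) ({}, a)"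

definition split_set ::
  "'a::field set \<Rightarrow> 'a set \<Rightarrow> 'a rel \<Rightarrow> nat \<Rightarrow> 'a rel \<Rightarrow> 'a set" where
  "split_set F C c n a = Field (fst (split_iter F C c n a)) \<union> Field (snd (split_iter F C c n a))"

definition sep_index ::
  "'a::field set \<Rightarrow> 'a set \<Rightarrow> 'a rel \<Rightarrow> 'a set \<Rightarrow> 'a set \<Rightarrow> nat" where
  "sep_index F C c B A =
     (LEAST n. \<forall>r. Well_order r \<and> Field r = A \<longrightarrow>
        separable_ext (gen_field (C \<union> split_set F C c n r \<union> B))
                      (gen_field (C \<union> split_set F C c n r)))"


section \<open>Tuples\<close>

text \<open>\<open>K\<^sup>l\<close> consists of the extensional functions on \<open>{..<l}\<close>.\<close>

abbreviation tuples :: "nat \<Rightarrow> (nat \<Rightarrow> 'a) set" where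
  "tuples l \<equiv> {..<l} \<rightarrow>\<^sub>E UNIV"

definition entries :: "nat \<Rightarrow> (nat \<Rightarrow> 'a) \<Rightarrow> 'a set" where
  "entries m a = a ` {..<m}"

text \<open>The entries of a tuple, ordered by first occurrence.\<close>

definition tuple_order :: "nat \<Rightarrow> (nat \<Rightarrow> 'a) \<Rightarrow> 'a rel" where
  "tuple_order m a =
     {(x, y). x \<in> entries m a \<and> y \<in> entries m a \<and>
              (LEAST i. i < m \<and> a i = x) \<le> (LEAST i. i < m \<and> a i = y)}"

text \<open>A finite well-ordered set as a tuple.\<close>

definition enum_tuple :: "'a rel \<Rightarrow> nat \<Rightarrow> 'a" where
  "enum_tuple r =
     (THE e. e \<in> tuples (card (Field r)) \<and> bij_betw e {..<card (Field r)} (Field r) \<and>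
             (\<forall>i j. i \<le> j \<and> j < card (Field r) \<longrightarrow> (e i, e j) \<in> r))"

text \<open>
  \<open>\<lambda>\<^bsub>F/b/c\<^esub> a\<close> for an \<open>m\<close>-tuple \<open>a\<close> and an \<open>n\<close>-tuple \<open>b\<close>, first as a well-ordered finite set, then
  as a tuple of length \<open>lambda_length\<close>.
\<close>

definition lambda_sep_order ::
  "'a::field set \<Rightarrow> 'a set \<Rightarrow> 'a rel \<Rightarrow> nat \<Rightarrow> (nat \<Rightarrow> 'a) \<Rightarrow> nat \<Rightarrow> (nat \<Rightarrow> 'a) \<Rightarrow> 'a rel" where
  "lambda_sep_order F C c n b m a =
     (let L = split_iter F C c (sep_index F C c (entries n b) (entries m a)) (tuple_order m a)
      in order_append (fst L) (snd L))"

definition lambda_length ::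
  "'a::field set \<Rightarrow> 'a set \<Rightarrow> 'a rel \<Rightarrow> nat \<Rightarrow> (nat \<Rightarrow> 'a) \<Rightarrow> nat \<Rightarrow> (nat \<Rightarrow> 'a) \<Rightarrow> nat" where
  "lambda_length F C c n b m a = card (Field (lambda_sep_order F C c n b m a))"

definition lambda_tuple ::
  "'a::field set \<Rightarrow> 'a set \<Rightarrow> 'a rel \<Rightarrow> nat \<Rightarrow> (nat \<Rightarrow> 'a) \<Rightarrow> nat \<Rightarrow> (nat \<Rightarrow> 'a) \<Rightarrow> (nat \<Rightarrow> 'a)" where
  "lambda_tuple F C c n b m a = enum_tuple (lambda_sep_order F C c n b m a)"

text \<open>
  The projection \<open>K\<^sup>l \<rightarrow> K\<^sup>m\<close> sending \<open>e\<close> to \<open>a\<close>, where \<open>e\<close> has distinct entries, among them those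
  of \<open>a\<close>.
\<close>

definition coord_proj ::
  "nat \<Rightarrow> (nat \<Rightarrow> 'a) \<Rightarrow> nat \<Rightarrow> (nat \<Rightarrow> 'a) \<Rightarrow> (nat \<Rightarrow> 'a) \<Rightarrow> (nat \<Rightarrow> 'a)" where
  "coord_proj l e m a x = (\<lambda>i\<in>{..<m}. x (THE j. j < l \<and> e j = a i))"


section \<open>Polynomials and loci\<close>

text \<open>Multivariate polynomials; a monomial is the finitely supported map of its exponents.\<close>

type_synonym 'a mpoly = "(nat \<Rightarrow>\<^sub>0 nat) \<Rightarrow>\<^sub>0 'a"

definition mpoly_ring :: "'a::field set \<Rightarrow> nat \<Rightarrow> 'a mpoly set" where
  "mpoly_ring C l =
     {f. (\<forall>u\<in>Poly_Mapping.keys f. Poly_Mapping.keys u \<subseteq> {..<l}) \<and>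
         (\<forall>u. Poly_Mapping.lookup f u \<in> C)}"

definition mpoly_eval :: "'a::field mpoly \<Rightarrow> (nat \<Rightarrow> 'a) \<Rightarrow> 'a" where
  "mpoly_eval f x =
     (\<Sum>u\<in>Poly_Mapping.keys f. Poly_Mapping.lookup f u *
        (\<Prod>i\<in>Poly_Mapping.keys u. x i ^ Poly_Mapping.lookup u i))"

definition mpoly_deriv :: "nat \<Rightarrow> 'a::field mpoly \<Rightarrow> 'a mpoly" where
  "mpoly_deriv i f =
     (\<Sum>u\<in>Poly_Mapping.keys f.
        Poly_Mapping.single (u - Poly_Mapping.single i 1)
          (of_nat (Poly_Mapping.lookup u i) * Poly_Mapping.lookup f u))"

text \<open>The \<open>K\<close>-rational points of the locus of \<open>e\<close> over \<open>C\<close>.\<close>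

definition locus_points :: "'a::field set \<Rightarrow> nat \<Rightarrow> (nat \<Rightarrow> 'a) \<Rightarrow> (nat \<Rightarrow> 'a) set" where
  "locus_points C l e =
     {y \<in> tuples l. \<forall>f\<in>mpoly_ring C l. mpoly_eval f e = 0 \<longrightarrow> mpoly_eval f y = 0}"


section \<open>Existential formulas in the language of rings\<close>

datatype 'a rterm =
    RVar nat
  | RParam 'a
  | RZero
  | ROne
  | RNeg "'a rterm"
  | RAdd "'a rterm" "'a rterm"
  | RMult "'a rterm" "'a rterm"

datatype 'a rformula =
    FEq "'a rterm" "'a rterm"
  | FNot "'a rformula"
  | FAnd "'a rformula" "'a rformula"
  | FOr "'a rformula" "'a rformula"
  | FEx nat "'a rformula"

primrec rterm_vars :: "'a rterm \<Rightarrow> nat set" where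
  "rterm_vars (RVar i) = {i}"
| "rterm_vars (RParam d) = {}"
| "rterm_vars RZero = {}"
| "rterm_vars ROne = {}"
| "rterm_vars (RNeg s) = rterm_vars s"
| "rterm_vars (RAdd s t) = rterm_vars s \<union> rterm_vars t"
| "rterm_vars (RMult s t) = rterm_vars s \<union> rterm_vars t"

primrec free_vars :: "'a rformula \<Rightarrow> nat set" where
  "free_vars (FEq s t) = rterm_vars s \<union> rterm_vars t"
| "free_vars (FNot \<phi>) = free_vars \<phi>"
| "free_vars (FAnd \<phi> \<psi>) = free_vars \<phi> \<union> free_vars \<psi>"
| "free_vars (FOr \<phi> \<psi>) = free_vars \<phi> \<union> free_vars \<psi>"
| "free_vars (FEx i \<phi>) = free_vars \<phi> - {i}"

primrec rterm_val :: "(nat \<Rightarrow> 'a::field) \<Rightarrow> 'a rterm \<Rightarrow> 'a" where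
  "rterm_val x (RVar i) = x i"
| "rterm_val x (RParam d) = d"
| "rterm_val x RZero = 0"
| "rterm_val x ROne = 1"
| "rterm_val x (RNeg s) = - rterm_val x s"
| "rterm_val x (RAdd s t) = rterm_val x s + rterm_val x t"
| "rterm_val x (RMult s t) = rterm_val x s * rterm_val x t"

primrec holds :: "'a::field rformula \<Rightarrow> (nat \<Rightarrow> 'a) \<Rightarrow> bool" where
  "holds (FEq s t) x \<longleftrightarrow> rterm_val x s = rterm_val x t"
| "holds (FNot \<phi>) x \<longleftrightarrow> \<not> holds \<phi> x"
| "holds (FAnd \<phi> \<psi>) x \<longleftrightarrow> holds \<phi> x \<and> holds \<psi> x"
| "holds (FOr \<phi> \<psi>) x \<longleftrightarrow> holds \<phi> x \<or> holds \<psi> x"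
| "holds (FEx i \<phi>) x \<longleftrightarrow> (\<exists>d. holds \<phi> (x(i := d)))"

primrec quantifier_free :: "'a rformula \<Rightarrow> bool" where
  "quantifier_free (FEq s t) \<longleftrightarrow> True"
| "quantifier_free (FNot \<phi>) \<longleftrightarrow> quantifier_free \<phi>"
| "quantifier_free (FAnd \<phi> \<psi>) \<longleftrightarrow> quantifier_free \<phi> \<and> quantifier_free \<psi>"
| "quantifier_free (FOr \<phi> \<psi>) \<longleftrightarrow> quantifier_free \<phi> \<and> quantifier_free \<psi>"
| "quantifier_free (FEx i \<phi>) \<longleftrightarrow> False"

inductive existential :: "'a rformula \<Rightarrow> bool" where
  "quantifier_free \<phi> \<Longrightarrow> existential \<phi>"
| "existential \<phi> \<Longrightarrow> existential (FEx i \<phi>)"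

definition existentially_definable :: "'a::field set \<Rightarrow> nat \<Rightarrow> (nat \<Rightarrow> 'a) set \<Rightarrow> bool" where
  "existentially_definable C m S \<longleftrightarrow>
     (\<exists>\<phi>. existential \<phi> \<and> set_rformula \<phi> \<subseteq> C \<and> free_vars \<phi> \<subseteq> {..<m} \<and>
          S = {x \<in> tuples m. holds \<phi> x})"


section \<open>Henselian topologies\<close>

definition abs_value :: "('a::field \<Rightarrow> real) \<Rightarrow> bool" where
  "abs_value N \<longleftrightarrow>
     (\<forall>x. N x \<ge> 0) \<and> (\<forall>x. N x = 0 \<longleftrightarrow> x = 0) \<and>
     (\<forall>x y. N (x * y) = N x * N y) \<and> (\<forall>x y. N (x + y) \<le> N x + N y)"

text \<open>
  An additively written valuation. Only its values on nonzero elements matter; the value at \<open>0\<close>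
  stands for infinity and is treated separately below.
\<close>

definition valuation :: "('a::field \<Rightarrow> 'g::linordered_ab_group_add) \<Rightarrow> bool" where
  "valuation v \<longleftrightarrow>
     (\<forall>x y. x \<noteq> 0 \<and> y \<noteq> 0 \<longrightarrow> v (x * y) = v x + v y) \<and>
     (\<forall>x y. x \<noteq> 0 \<and> y \<noteq> 0 \<and> x + y \<noteq> 0 \<longrightarrow> min (v x) (v y) \<le> v (x + y))"

definition induced_by_abs_value :: "'a::field topology \<Rightarrow> ('a \<Rightarrow> real) \<Rightarrow> bool" where
  "induced_by_abs_value \<tau> N \<longleftrightarrow>
     (\<forall>U. openin \<tau> U \<longleftrightarrow> (\<forall>x\<in>U. \<exists>\<epsilon>>0. \<forall>y. N (y - x) < \<epsilon> \<longrightarrow> y \<in> U))"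

definition induced_by_valuation ::
  "'a::field topology \<Rightarrow> ('a \<Rightarrow> 'g::linordered_ab_group_add) \<Rightarrow> bool" where
  "induced_by_valuation \<tau> v \<longleftrightarrow>
     (\<forall>U. openin \<tau> U \<longleftrightarrow> (\<forall>x\<in>U. \<exists>\<gamma>. \<forall>y. y = x \<or> \<gamma> < v (y - x) \<longrightarrow> y \<in> U))"

text \<open>
  A predicate cannot quantify over the type of the value group, so this type is an explicit argument;
  a theorem with this hypothesis and \<open>'g\<close> as a free type variable covers all value groups.
\<close>

definition V_topology :: "'g::linordered_ab_group_add itself \<Rightarrow> 'a::field topology \<Rightarrow> bool" where
  "V_topology _ \<tau> \<longleftrightarrow>
     (\<exists>N. abs_value N \<and> (\<exists>x. x \<noteq> 0 \<and> N x \<noteq> 1) \<and> induced_by_abs_value \<tau> N) \<or>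
     (\<exists>v :: 'a \<Rightarrow> 'g. valuation v \<and> (\<exists>x. x \<noteq> 0 \<and> v x \<noteq> 0) \<and> induced_by_valuation \<tau> v)"

abbreviation power_topology :: "'a topology \<Rightarrow> nat \<Rightarrow> (nat \<Rightarrow> 'a) topology" where
  "power_topology \<tau> l \<equiv> product_topology (\<lambda>_. \<tau>) {..<l}"

text \<open>In \<open>f\<close>, the variables with index below \<open>m\<close> are the \<open>X\<^sub>i\<close>, and the one with index \<open>m\<close> is \<open>Y\<close>.\<close>

definition polynomial_IFT :: "'a::field topology \<Rightarrow> bool" where
  "polynomial_IFT \<tau> \<longleftrightarrow>
     (\<forall>m. \<forall>f\<in>mpoly_ring UNIV (Suc m). \<forall>e\<in>tuples m. \<forall>d.
        mpoly_eval f (e(m := d)) = 0 \<and> mpoly_eval (mpoly_deriv m f) (e(m := d)) \<noteq> 0 \<longrightarrow>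
        (\<exists>U V g. openin (power_topology \<tau> m) U \<and> e \<in> U \<and> openin \<tau> V \<and> d \<in> V \<and>
           continuous_map (subtopology (power_topology \<tau> m) U) (subtopology \<tau> V) g \<and>
           {(x, y). x \<in> U \<and> y \<in> V \<and> mpoly_eval f (x(m := y)) = 0} =
           {(x, y). x \<in> U \<and> y = g x}))"

text \<open>
  The class of V-topologies satisfying the polynomial implicit function theorem coincides with the
  class of V-topologies locally equivalent (Prestel--Ziegler) to the topology of a nontrivial
  henselian valuation.
\<close>

definition henselian_topology ::
  "'g::linordered_ab_group_add itself \<Rightarrow> 'a::field topology \<Rightarrow> bool" where
  "henselian_topology G \<tau> \<longleftrightarrow> V_topology G \<tau> \<and> polynomial_IFT \<tau>"

definition neighbourhood :: "'b topology \<Rightarrow> 'b \<Rightarrow> 'b set \<Rightarrow> bool" where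
  "neighbourhood T x U \<longleftrightarrow> U \<subseteq> topspace T \<and> (\<exists>V. openin T V \<and> x \<in> V \<and> V \<subseteq> U)"

end

theory Submission
  imports Defs
begin

text \<open>
  Let \<open>b\<close> be a tuple of witnesses for the existential quantifiers at \<open>a\<close>, and let
  \<open>e = \<lambda>\<^bsub>K/b/c\<^esub> a\<close>. Since \<open>C(e,b)/C(e)\<close> is separable, MacLane's theorem orders \<open>b\<close> in such a way that
  each entry is transcendental over the ring generated by \<open>C\<close>, \<open>e\<close> and the earlier entries, or a simple
  root of a polynomial over it. In the first case a point of the locus near \<open>e\<close> extends by the same entry,
  in the second case by the implicit function theorem; in both cases the extended point stays on the
  locus. Hence the points of the locus of \<open>e\<close> near \<open>e\<close> extend to points of the locus of \<open>(e,b)\<close> near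
  \<open>(e,b)\<close>, where the quantifier-free part of the formula keeps its truth value.

  The number \<open>n\<close> in the definition of \<open>\<lambda>\<^bsub>K/b/c\<^esub> a\<close> exists because \<open>K\<close> is separable over the union \<open>E\<close> of
  the fields \<open>C(L\<^sup>n(a))\<close>: the union of \<open>c\<close> and the first components is a p-basis of \<open>E\<close> that is
  p-independent in \<open>K\<close>. By Noetherianity, separability of \<open>E(b)/E\<close> descends to a finite stage.
\<close>

\<comment> \<open>An extension \<open>F/E\<close> is separable iff \<open>frob\<close> carries
  families of \<open>F\<close> that are linearly independent over \<open>E\<close> to such families.
  Taking p-th roots of coefficients in the algebraic closure relates this to linear disjointness;
  all other arguments about separability stay inside \<open>K\<close>. One splitting step need not
  yield separability. It expresses each element of \<open>b\<close> by \<open>c\<close>,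
  \<open>a'\<close> and p-th powers of elements of \<open>b'\<close>, but the new elements of
  \<open>b'\<close> are not expanded yet. Nothing is left over only in the union of all stages, so a
  finite stage has to be recovered by a separate descent. Simple roots are taken over the ring
  \<open>C[e]\<close> instead of the field \<open>C(e)\<close>: an element of \<open>C[e]\<close> is
  the value of a polynomial over \<open>C\<close> and has a counterpart at every point of the locus,
  while a denominator may vanish there. Hence the clearing of denominators and the pseudo-division.
  For exponent 1, \<open>frob\<close> is the identity, every extension is separable and the index is
  0.\<close>
alias lookup = Poly_Mapping.lookup
alias keys = Poly_Mapping.keys
alias single = Poly_Mapping.single
alias coeff = Polynomial.coeff
alias degree = Polynomial.degree
alias monom = Polynomial.monom
alias smult = Polynomial.smult

section \<open>Subfields and linear independence\<close>

abbreviation is_subfield :: "'a::field set \<Rightarrow> bool" where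
  "is_subfield E \<equiv> subfield E ring_of_type_algebra"

lemma ring_of_type_algebra_simps [simp]:
  "carrier (ring_of_type_algebra :: 'a::ring_1 ring) = UNIV"
  "\<zero>\<^bsub>(ring_of_type_algebra :: 'a ring)\<^esub> = 0"
  "\<one>\<^bsub>(ring_of_type_algebra :: 'a ring)\<^esub> = 1"
  "x \<otimes>\<^bsub>(ring_of_type_algebra :: 'a ring)\<^esub> y = x * y"
  "x \<oplus>\<^bsub>(ring_of_type_algebra :: 'a ring)\<^esub> y = x + y"
  by (simp_all add: ring_of_type_algebra_def)

lemma ring_of_type_algebra_uminus [simp]:
  "\<ominus>\<^bsub>(ring_of_type_algebra :: 'a::field ring)\<^esub> x = - x"
proof -
  interpret R: Ring.field "ring_of_type_algebra :: 'a ring" by (rule field_from_type_algebra)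
  show ?thesis
    using R.minus_equality[of "- x" x] by simp
qed

lemma ring_of_type_algebra_inv:
  assumes "x \<noteq> 0"
  shows "inv\<^bsub>(ring_of_type_algebra :: 'a::field ring)\<^esub> x = inverse x"
proof -
  interpret R: Ring.field "ring_of_type_algebra :: 'a ring" by (rule field_from_type_algebra)
  show ?thesis
    using assms by (intro R.inv_char) auto
qed

text \<open>The convention \<open>inverse 0 = 0\<close> makes closure under \<open>inverse\<close>
  unconditional, so subfields can be treated with the operations of the type class from here
  on.\<close>

lemma is_subfield_iff:
  "is_subfield (E :: 'a::field set) \<longleftrightarrow>
     0 \<in> E \<and> 1 \<in> E \<and> (\<forall>x\<in>E. - x \<in> E \<and> inverse x \<in> E) \<and> (\<forall>x\<in>E. \<forall>y\<in>E. x + y \<in> E \<and> x * y \<in> E)"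
proof -
  interpret R: Ring.field "ring_of_type_algebra :: 'a ring" by (rule field_from_type_algebra)
  show ?thesis
  proof
    assume E: "is_subfield E"
    have "inverse x \<in> E" if "x \<in> E" for x
      using that R.subfield_m_inv(1)[OF E, of x] ring_of_type_algebra_inv[of x]
        subringE(2)[OF subfieldE(1)[OF E]]
      by (cases "x = 0") auto
    then show "0 \<in> E \<and> 1 \<in> E \<and> (\<forall>x\<in>E. - x \<in> E \<and> inverse x \<in> E) \<and>
        (\<forall>x\<in>E. \<forall>y\<in>E. x + y \<in> E \<and> x * y \<in> E)"
      using subringE(2,3,5,6,7)[OF subfieldE(1)[OF E]] by auto
  next
    assume E: "0 \<in> E \<and> 1 \<in> E \<and> (\<forall>x\<in>E. - x \<in> E \<and> inverse x \<in> E) \<and>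
        (\<forall>x\<in>E. \<forall>y\<in>E. x + y \<in> E \<and> x * y \<in> E)"
    show "is_subfield E"
    proof (rule R.subfieldI')
      show "subring E ring_of_type_algebra"
        by (rule R.subringI) (use E in auto)
      show "\<And>k. k \<in> E - {\<zero>\<^bsub>ring_of_type_algebra\<^esub>} \<Longrightarrow> inv\<^bsub>ring_of_type_algebra\<^esub> k \<in> E"
        using E by (simp add: ring_of_type_algebra_inv)
    qed
  qed
qed

lemma
  assumes "is_subfield E"
  shows subfield_0 [intro]: "0 \<in> E" and subfield_1 [intro]: "1 \<in> E"
    and subfield_uminus [intro]: "x \<in> E \<Longrightarrow> - x \<in> E"
    and subfield_inverse [intro]: "x \<in> E \<Longrightarrow> inverse x \<in> E"
    and subfield_add [intro]: "x \<in> E \<Longrightarrow> y \<in> E \<Longrightarrow> x + y \<in> E"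
    and subfield_mult [intro]: "x \<in> E \<Longrightarrow> y \<in> E \<Longrightarrow> x * y \<in> E"
    and subfield_minus [intro]: "x \<in> E \<Longrightarrow> y \<in> E \<Longrightarrow> x - y \<in> E"
    and subfield_divide [intro]: "x \<in> E \<Longrightarrow> y \<in> E \<Longrightarrow> x / y \<in> E"
  using assms unfolding is_subfield_iff diff_conv_add_uminus divide_inverse by blast+

lemma subfield_power [intro]: "is_subfield E \<Longrightarrow> x \<in> E \<Longrightarrow> x ^ n \<in> E"
  by (induction n) auto

lemma subfield_of_nat [intro]: "is_subfield E \<Longrightarrow> of_nat n \<in> E"
  by (induction n) auto

lemma subfield_sum [intro]: "is_subfield E \<Longrightarrow> (\<And>i. i \<in> S \<Longrightarrow> f i \<in> E) \<Longrightarrow> sum f S \<in> E"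
  by (induction S rule: infinite_finite_induct) auto

lemma subfield_prod [intro]: "is_subfield E \<Longrightarrow> (\<And>i. i \<in> S \<Longrightarrow> f i \<in> E) \<Longrightarrow> prod f S \<in> E"
  by (induction S rule: infinite_finite_induct) auto

lemma subfield_UNIV [simp]: "is_subfield UNIV"
  by (simp add: is_subfield_iff)

lemma gen_field_subfield [simp, intro]: "is_subfield (gen_field H)"
  by (rule field.generate_field_is_subfield[OF field_from_type_algebra]) simp

lemma gen_field_incl: "H \<subseteq> gen_field H"
  by (auto intro: generate_field.incl)

lemma gen_field_least: "is_subfield E \<Longrightarrow> H \<subseteq> E \<Longrightarrow> gen_field H \<subseteq> E"
  by (rule field.generate_field_min_subfield1[OF field_from_type_algebra]) simp_all

lemma gen_field_subset_iff: "gen_field H \<subseteq> gen_field G \<longleftrightarrow> H \<subseteq> gen_field G"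
  using gen_field_least[OF gen_field_subfield, of H G] gen_field_incl[of H] by (metis subset_trans)

lemma gen_field_mono: "H \<subseteq> G \<Longrightarrow> gen_field H \<subseteq> gen_field G"
  unfolding gen_field_subset_iff using gen_field_incl[of G] by simp

lemma gen_field_Un_gen_field: "gen_field (gen_field H \<union> G) = gen_field (H \<union> G)"
proof
  show "gen_field (gen_field H \<union> G) \<subseteq> gen_field (H \<union> G)"
    unfolding gen_field_subset_iff using gen_field_mono[of H "H \<union> G"] gen_field_incl[of "H \<union> G"] by auto
  show "gen_field (H \<union> G) \<subseteq> gen_field (gen_field H \<union> G)"
    by (rule gen_field_mono) (use gen_field_incl[of H] in auto)
qed


section \<open>Linear independence and spans of indexed families\<close>

definition lin_indep :: "'a::field set \<Rightarrow> 'i set \<Rightarrow> ('i \<Rightarrow> 'a) \<Rightarrow> bool" where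
  "lin_indep E S u \<longleftrightarrow>
     (\<forall>T c. finite T \<and> T \<subseteq> S \<and> (\<forall>i\<in>T. c i \<in> E) \<and> (\<Sum>i\<in>T. c i * u i) = 0 \<longrightarrow> (\<forall>i\<in>T. c i = 0))"

definition lin_span :: "'a::field set \<Rightarrow> 'i set \<Rightarrow> ('i \<Rightarrow> 'a) \<Rightarrow> 'a set" where
  "lin_span E S u = {\<Sum>i\<in>T. c i * u i | T c. finite T \<and> T \<subseteq> S \<and> (\<forall>i\<in>T. c i \<in> E)}"

lemma lin_indepI:
  assumes "\<And>T c. finite T \<Longrightarrow> T \<subseteq> S \<Longrightarrow> (\<And>i. i \<in> T \<Longrightarrow> c i \<in> E) \<Longrightarrow> (\<Sum>i\<in>T. c i * u i) = 0 \<Longrightarrow>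
    \<forall>i\<in>T. c i = 0"
  shows "lin_indep E S u"
  using assms unfolding lin_indep_def by blast

lemma lin_indepD:
  assumes "lin_indep E S u" "finite T" "T \<subseteq> S" "\<And>i. i \<in> T \<Longrightarrow> c i \<in> E" "(\<Sum>i\<in>T. c i * u i) = 0"
    "i \<in> T"
  shows "c i = 0"
  using assms unfolding lin_indep_def by blast

lemma lin_indep_finite_iff:
  assumes "finite S" "0 \<in> E"
  shows "lin_indep E S u \<longleftrightarrow>
    (\<forall>c. (\<forall>i\<in>S. c i \<in> E) \<and> (\<Sum>i\<in>S. c i * u i) = 0 \<longrightarrow> (\<forall>i\<in>S. c i = 0))" (is "_ \<longleftrightarrow> ?R")
proof
  assume "lin_indep E S u" then show ?R
    using assms(1) unfolding lin_indep_def by blast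
next
  assume R: ?R
  show "lin_indep E S u"
  proof (rule lin_indepI)
    fix T c
    assume T: "finite T" "T \<subseteq> S" and c: "\<And>i. i \<in> T \<Longrightarrow> c i \<in> E" and 0: "(\<Sum>i\<in>T. c i * u i) = 0"
    let ?c = "\<lambda>i. if i \<in> T then c i else 0"
    have "(\<Sum>i\<in>S. ?c i * u i) = (\<Sum>i\<in>T. c i * u i)"
      by (rule sum.mono_neutral_cong_right) (use assms T in auto)
    then have "(\<forall>i\<in>S. ?c i \<in> E) \<and> (\<Sum>i\<in>S. ?c i * u i) = 0"
      using c assms(2) 0 by auto
    then have "\<forall>i\<in>S. ?c i = 0"
      by (rule R[THEN spec, THEN mp])
    then show "\<forall>i\<in>T. c i = 0"
      using T by (auto split: if_splits)
  qed
qed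

lemma lin_indep_subset: "lin_indep E S u \<Longrightarrow> S' \<subseteq> S \<Longrightarrow> lin_indep E S' u"
  unfolding lin_indep_def by blast

lemma lin_indep_mono: "lin_indep E S u \<Longrightarrow> E' \<subseteq> E \<Longrightarrow> lin_indep E' S u"
  unfolding lin_indep_def by blast

lemma lin_indep_cong:
  assumes "\<And>i. i \<in> S \<Longrightarrow> u i = v i"
  shows "lin_indep E S u \<longleftrightarrow> lin_indep E S v"
proof -
  have "lin_indep E S v" if u: "lin_indep E S u" and uv: "\<And>i. i \<in> S \<Longrightarrow> u i = v i" for u v :: "'a \<Rightarrow> 'b"
  proof (rule lin_indepI)
    fix T c
    assume T: "finite T" "T \<subseteq> S" and c: "\<And>i. i \<in> T \<Longrightarrow> c i \<in> E" and 0: "(\<Sum>i\<in>T. c i * v i) = 0"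
    have "(\<Sum>i\<in>T. c i * u i) = (\<Sum>i\<in>T. c i * v i)"
      using T uv by (intro sum.cong) auto
    then have "(\<Sum>i\<in>T. c i * u i) = 0" using 0 by simp
    then show "\<forall>i\<in>T. c i = 0"
      using lin_indepD[OF u T, of c] c by blast
  qed
  from this[of u v] this[of v u] assms show ?thesis by metis
qed

lemma lin_indep_finitely:
  "lin_indep E S u \<longleftrightarrow> (\<forall>T. finite T \<and> T \<subseteq> S \<longrightarrow> lin_indep E T u)"
  unfolding lin_indep_def by (meson subset_refl subset_trans)

lemma lin_indep_reindex:
  assumes "inj_on f S"
  shows "lin_indep E (f ` S) u \<longleftrightarrow> lin_indep E S (\<lambda>i. u (f i))"
proof
  assume *: "lin_indep E (f ` S) u"
  show "lin_indep E S (\<lambda>i. u (f i))"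
  proof (rule lin_indepI)
    fix T c
    assume T: "finite T" "T \<subseteq> S" and c: "\<And>i. i \<in> T \<Longrightarrow> c i \<in> E" and 0: "(\<Sum>i\<in>T. c i * u (f i)) = 0"
    have inj: "inj_on f T" using assms T inj_on_subset by blast
    let ?c = "\<lambda>j. c (the_inv_into T f j)"
    have "(\<Sum>j\<in>f ` T. ?c j * u j) = 0"
      unfolding sum.reindex[OF inj] using 0 by (simp add: the_inv_into_f_f[OF inj])
    moreover have "?c j \<in> E" if "j \<in> f ` T" for j
      using that c by (auto simp: the_inv_into_f_f[OF inj])
    ultimately have "?c j = 0" if "j \<in> f ` T" for j
      using lin_indepD[OF *, of "f ` T" ?c j] T that by blast
    then show "\<forall>i\<in>T. c i = 0"
      by (metis imageI the_inv_into_f_f[OF inj])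
  qed
next
  assume *: "lin_indep E S (\<lambda>i. u (f i))"
  show "lin_indep E (f ` S) u"
  proof (rule lin_indepI)
    fix T c
    assume T: "finite T" "T \<subseteq> f ` S" and c: "\<And>i. i \<in> T \<Longrightarrow> c i \<in> E" and 0: "(\<Sum>i\<in>T. c i * u i) = 0"
    obtain T' where T': "T' \<subseteq> S" "finite T'" "T = f ` T'"
      using finite_subset_image[OF T] by blast
    have inj: "inj_on f T'" using assms T' inj_on_subset by blast
    have "(\<Sum>i\<in>T'. c (f i) * u (f i)) = 0"
      using 0 unfolding T'(3) sum.reindex[OF inj] by simp
    then have "\<forall>i\<in>T'. c (f i) = 0"
      using lin_indepD[OF * T'(2,1), of "\<lambda>i. c (f i)"] T'(3) c by blast
    then show "\<forall>i\<in>T. c i = 0"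
      using T'(3) by simp
  qed
qed

lemma lin_span_sumI:
  "finite T \<Longrightarrow> T \<subseteq> S \<Longrightarrow> (\<And>i. i \<in> T \<Longrightarrow> c i \<in> E) \<Longrightarrow> (\<Sum>i\<in>T. c i * u i) \<in> lin_span E S u"
  unfolding lin_span_def by blast

lemma lin_span_finite:
  assumes "finite S" "0 \<in> E"
  shows "x \<in> lin_span E S u \<longleftrightarrow> (\<exists>c. (\<forall>i\<in>S. c i \<in> E) \<and> x = (\<Sum>i\<in>S. c i * u i))"
proof
  assume "x \<in> lin_span E S u"
  then obtain T c where T: "finite T" "T \<subseteq> S" "\<forall>i\<in>T. c i \<in> E" "x = (\<Sum>i\<in>T. c i * u i)"
    unfolding lin_span_def by blast
  have "x = (\<Sum>i\<in>S. (if i \<in> T then c i else 0) * u i)"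
    unfolding T(4) by (rule sum.mono_neutral_cong_left) (use assms T in auto)
  then show "\<exists>c. (\<forall>i\<in>S. c i \<in> E) \<and> x = (\<Sum>i\<in>S. c i * u i)"
    using T(3) assms(2) by (intro exI[of _ "\<lambda>i. if i \<in> T then c i else 0"]) auto
qed (use assms in \<open>auto intro: lin_span_sumI\<close>)

lemma lin_span_subset: "S \<subseteq> S' \<Longrightarrow> lin_span E S u \<subseteq> lin_span E S' u"
  unfolding lin_span_def by blast

lemma lin_span_mono: "E \<subseteq> E' \<Longrightarrow> lin_span E S u \<subseteq> lin_span E' S u"
  unfolding lin_span_def by blast

lemma lin_span_finitely:
  "x \<in> lin_span E S u \<Longrightarrow> \<exists>T. finite T \<and> T \<subseteq> S \<and> x \<in> lin_span E T u"
  unfolding lin_span_def by blast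

lemma lin_span_0: "0 \<in> lin_span E S u"
  using lin_span_sumI[of "{}" S] by simp

lemma lin_span_base: "is_subfield E \<Longrightarrow> i \<in> S \<Longrightarrow> u i \<in> lin_span E S u"
  using lin_span_sumI[of "{i}" S "\<lambda>_. 1" E u] by auto

lemma lin_span_add:
  assumes E: "is_subfield E" and "x \<in> lin_span E S u" "y \<in> lin_span E S u"
  shows "x + y \<in> lin_span E S u"
proof -
  obtain T T' where T: "finite T" "T \<subseteq> S" "x \<in> lin_span E T u"
    and T': "finite T'" "T' \<subseteq> S" "y \<in> lin_span E T' u"
    using assms lin_span_finitely by meson
  have "x \<in> lin_span E (T \<union> T') u" "y \<in> lin_span E (T \<union> T') u"
    using T T' lin_span_subset[of T "T \<union> T'" E u] lin_span_subset[of T' "T \<union> T'" E u] by auto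
  then obtain c d where c: "\<forall>i\<in>T \<union> T'. c i \<in> E" "x = (\<Sum>i\<in>T \<union> T'. c i * u i)"
    and d: "\<forall>i\<in>T \<union> T'. d i \<in> E" "y = (\<Sum>i\<in>T \<union> T'. d i * u i)"
    using T T' lin_span_finite[of "T \<union> T'" E] subfield_0[OF E] by auto
  have "x + y = (\<Sum>i\<in>T \<union> T'. (c i + d i) * u i)"
    unfolding c(2) d(2) by (simp add: sum.distrib ring_distribs)
  also have "\<dots> \<in> lin_span E S u"
    using T T' c d E by (intro lin_span_sumI) auto
  finally show ?thesis .
qed

lemma lin_span_scale:
  assumes E: "is_subfield E" and "x \<in> lin_span E S u" "k \<in> E"
  shows "k * x \<in> lin_span E S u"
proof -
  obtain T c where T: "finite T" "T \<subseteq> S" "\<forall>i\<in>T. c i \<in> E" "x = (\<Sum>i\<in>T. c i * u i)"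
    using assms unfolding lin_span_def by blast
  have "k * x = (\<Sum>i\<in>T. (k * c i) * u i)"
    unfolding T(4) by (simp add: sum_distrib_left mult.assoc)
  also have "\<dots> \<in> lin_span E S u"
    using T assms by (intro lin_span_sumI) auto
  finally show ?thesis .
qed

text \<open>The induction principle for spans: \<open>W\<close> is later a condition on
  \<open>x\<close>, such as \<open>{x. x * u j \<in> ?T}\<close> or
  \<open>{x. frob x \<in> D}\<close>.\<close>

lemma lin_span_closed_subset:
  assumes "\<And>i. i \<in> S \<Longrightarrow> u i \<in> W" "0 \<in> W" "\<And>x y. x \<in> W \<Longrightarrow> y \<in> W \<Longrightarrow> x + y \<in> W"
    "\<And>k x. k \<in> E \<Longrightarrow> x \<in> W \<Longrightarrow> k * x \<in> W"
  shows "lin_span E S u \<subseteq> W"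
proof
  fix x assume "x \<in> lin_span E S u"
  then obtain T c where T: "finite T" "T \<subseteq> S" "\<forall>i\<in>T. c i \<in> E" "x = (\<Sum>i\<in>T. c i * u i)"
    unfolding lin_span_def by blast
  have "(\<Sum>i\<in>T. c i * u i) \<in> W"
    using T(1-3) by (induction T rule: finite_induct) (use assms in auto)
  then show "x \<in> W" using T by simp
qed

lemma lin_span_trans:
  assumes "is_subfield E" "\<And>i. i \<in> S \<Longrightarrow> u i \<in> lin_span E S' v"
  shows "lin_span E S u \<subseteq> lin_span E S' v"
  by (rule lin_span_closed_subset) (use assms in \<open>auto intro: lin_span_0 lin_span_add lin_span_scale\<close>)

text \<open>Bilinearity: the left factor is varied against a fixed \<open>u j\<close>, then the
  right factor against a fixed \<open>x\<close>.\<close>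

lemma lin_span_mult:
  assumes E: "is_subfield E" and u: "\<And>i j. i \<in> S \<Longrightarrow> j \<in> S \<Longrightarrow> u i * u j \<in> lin_span E S u"
    and x: "x \<in> lin_span E S u" and y: "y \<in> lin_span E S u"
  shows "x * y \<in> lin_span E S u"
proof -
  let ?T = "lin_span E S u"
  have "?T \<subseteq> {x. x * u j \<in> ?T}" if "j \<in> S" for j
    by (rule lin_span_closed_subset)
      (auto simp: u that lin_span_0 ring_distribs mult.assoc intro: lin_span_add[OF E] lin_span_scale[OF E])
  then have "?T \<subseteq> {y. x * y \<in> ?T}"
    by (intro lin_span_closed_subset)
      (use x in \<open>auto simp: lin_span_0 ring_distribs mult.left_commute[of x] intro: lin_span_add[OF E] lin_span_scale[OF E]\<close>)
  then show ?thesis using y by blast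
qed

lemma lin_indep_insert:
  assumes E: "is_subfield E" and S: "lin_indep E S u" and i: "u i \<notin> lin_span E S u"
  shows "lin_indep E (insert i S) u"
proof (rule lin_indepI)
  fix T c
  assume T: "finite T" "T \<subseteq> insert i S" and c: "\<And>i. i \<in> T \<Longrightarrow> c i \<in> E"
    and 0: "(\<Sum>i\<in>T. c i * u i) = 0"
  have TS: "T - {i} \<subseteq> S" using T by auto
  show "\<forall>j\<in>T. c j = 0"
  proof (cases "i \<in> T \<and> c i \<noteq> 0")
    case True
    have "c i * u i + (\<Sum>j\<in>T - {i}. c j * u j) = 0"
      using 0 sum.remove[OF T(1), of i "\<lambda>j. c j * u j"] True by metis
    then have "u i = (\<Sum>j\<in>T - {i}. (- c j / c i) * u j)"
      using True by (simp add: sum_negf sum_divide_distrib[symmetric] field_simps add_eq_0_iff)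
    also have "\<dots> \<in> lin_span E S u"
      using T TS True c E by (intro lin_span_sumI subfield_divide subfield_uminus) auto
    finally show ?thesis using i by simp
  next
    case False
    then have "(\<Sum>j\<in>T - {i}. c j * u j) = 0"
      using 0 T by (cases "i \<in> T") (auto simp: sum.remove)
    then have "\<forall>j\<in>T - {i}. c j = 0"
      using lin_indepD[OF S _ TS, of c] T(1) c by blast
    then show ?thesis using False by auto
  qed
qed

lemma lin_indep_basis_exists:
  assumes E: "is_subfield E" and "finite S"
  shows "\<exists>T\<subseteq>S. lin_indep E T u \<and> (\<forall>i\<in>S. u i \<in> lin_span E T u)"
  using assms(2)
proof (induction S rule: finite_induct)
  case empty
  show ?case by (auto simp: lin_indep_def)
next
  case (insert i S)
  then obtain T where T: "T \<subseteq> S" "lin_indep E T u" "\<forall>j\<in>S. u j \<in> lin_span E T u" by blast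
  show ?case
  proof (cases "u i \<in> lin_span E T u")
    case True
    then show ?thesis using T by (intro exI[of _ T]) auto
  next
    case False
    have "u j \<in> lin_span E (insert i T) u" if "j \<in> insert i S" for j
      using that T lin_span_subset[of T "insert i T" E u] lin_span_base[OF E, of i "insert i T" u] by auto
    then show ?thesis using T lin_indep_insert[OF E T(2) False] by (intro exI[of _ "insert i T"]) auto
  qed
qed

text \<open>The tower law for products, with pairs of factors coded by a single index:
  \<open>\<kappa> i\<close> selects the factor from the upper family, and over each fibre of
  \<open>\<kappa>\<close> the lower factors are independent. Grouping a relation by fibres produces
  coefficients in \<open>D'\<close>, which vanish first.\<close>

lemma lin_indep_tower:
  assumes D': "is_subfield D'" and "D \<subseteq> D'" and v: "lin_indep D' P v"
    and \<kappa>: "\<And>i. i \<in> S \<Longrightarrow> \<kappa> i \<in> P" and w: "\<And>i. i \<in> S \<Longrightarrow> w i \<in> D'"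
    and wD: "\<And>k. k \<in> P \<Longrightarrow> lin_indep D {i\<in>S. \<kappa> i = k} w"
  shows "lin_indep D S (\<lambda>i. v (\<kappa> i) * w i)"
proof (rule lin_indepI)
  fix T c
  assume T: "finite T" "T \<subseteq> S" and c: "\<And>i. i \<in> T \<Longrightarrow> c i \<in> D"
    and 0: "(\<Sum>i\<in>T. c i * (v (\<kappa> i) * w i)) = 0"
  define d where "d k = (\<Sum>i\<in>{i\<in>T. \<kappa> i = k}. c i * w i)" for k
  have dD': "d k \<in> D'" for k
    unfolding d_def using T c w assms(2) D' by (intro subfield_sum subfield_mult) auto
  have "(\<Sum>k\<in>\<kappa> ` T. d k * v k) = (\<Sum>k\<in>\<kappa> ` T. \<Sum>i\<in>{i\<in>T. \<kappa> i = k}. c i * (v (\<kappa> i) * w i))"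
    unfolding d_def sum_distrib_right by (intro sum.cong) (auto simp: mult_ac)
  also have "\<dots> = 0"
    using sum.group[of T "\<kappa> ` T" \<kappa> "\<lambda>i. c i * (v (\<kappa> i) * w i)"] T 0 by simp
  finally have "\<forall>k\<in>\<kappa> ` T. d k = 0"
    using lin_indepD[OF v, of "\<kappa> ` T" d] T \<kappa> dD' by blast
  show "\<forall>i\<in>T. c i = 0"
  proof
    fix j assume "j \<in> T"
    then have "d (\<kappa> j) = 0"
      using \<open>\<forall>k\<in>\<kappa> ` T. d k = 0\<close> by blast
    then have 0: "(\<Sum>i\<in>{i\<in>T. \<kappa> i = \<kappa> j}. c i * w i) = 0"
      unfolding d_def .
    have "lin_indep D {i\<in>S. \<kappa> i = \<kappa> j} w"
      using wD \<kappa> T(2) \<open>j \<in> T\<close> by blast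
    from this _ _ _ 0 show "c j = 0"
      by (rule lin_indepD) (use T c \<open>j \<in> T\<close> in auto)
  qed
qed

text \<open>The rank of a matrix does not change under field extension: if a homogeneous system over
  \<open>E\<close> has only the trivial solution in \<open>E\<close>, the same is true in
  \<open>L\<close>. Rows are eliminated one at a time with a pivot from \<open>E\<close>, so that
  the eliminated system is again over \<open>E\<close>.\<close>

lemma rows_indep_extend:
  fixes e :: "'i \<Rightarrow> 'j \<Rightarrow> 'a::field"
  assumes E: "is_subfield E" and L: "is_subfield L" "E \<subseteq> L" and "finite S"
    and "\<And>i j. i \<in> S \<Longrightarrow> j \<in> J \<Longrightarrow> e i j \<in> E"
    and "\<And>c. (\<forall>i\<in>S. c i \<in> E) \<Longrightarrow> (\<forall>j\<in>J. (\<Sum>i\<in>S. c i * e i j) = 0) \<Longrightarrow> \<forall>i\<in>S. c i = 0"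
    and "\<forall>i\<in>S. x i \<in> L" "\<forall>j\<in>J. (\<Sum>i\<in>S. x i * e i j) = 0"
  shows "\<forall>i\<in>S. x i = 0"
  using assms(4-8)
proof (induction S arbitrary: e x rule: finite_induct)
  case empty
  then show ?case by simp
next
  case (insert r S)
  \<comment> \<open>A zero row would satisfy the relation with coefficient 1 at \<open>r\<close> and
    0 elsewhere.\<close>
  have "\<exists>j\<in>J. e r j \<noteq> 0"
  proof (rule ccontr)
    assume "\<not> ?thesis"
    then have "\<forall>j\<in>J. (\<Sum>i\<in>insert r S. (if i = r then 1 else 0) * e i j) = 0"
      using insert.hyps by (auto intro!: sum.neutral)
    moreover have "\<forall>i\<in>insert r S. (if i = r then 1 else 0) \<in> E"
      using subfield_0[OF E] subfield_1[OF E] by simp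
    ultimately have "\<forall>i\<in>insert r S. (if i = r then 1 else 0 :: 'a) = 0"
      by (rule insert.prems(2)[rotated])
    then show False by simp
  qed
  then obtain j0 where j0: "j0 \<in> J" "e r j0 \<noteq> 0" by blast
  \<comment> \<open>The rows after elimination of the column \<open>j0\<close> by the pivot row
    \<open>r\<close>.\<close>
  define f where "f i j = e i j - e i j0 / e r j0 * e r j" for i j
  have sum_f: "(\<Sum>i\<in>S. c i * f i j) = (\<Sum>i\<in>S. c i * e i j) - (\<Sum>i\<in>S. c i * e i j0) / e r j0 * e r j"
    for c j
    by (simp add: f_def right_diff_distrib sum_subtractf sum_distrib_right sum_divide_distrib mult.assoc)
  have ind: "\<forall>i\<in>S. c i = 0" if c: "\<forall>i\<in>S. c i \<in> E" "\<forall>j\<in>J. (\<Sum>i\<in>S. c i * f i j) = 0" for c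
  proof -
    \<comment> \<open>The coefficient of the pivot row that lifts a relation among the reduced rows;
      the column \<open>j0\<close> forces it.\<close>
    define k where "k = - (\<Sum>i\<in>S. c i * e i j0) / e r j0"
    have "k \<in> E" unfolding k_def using c insert.prems(1) j0 E by (intro subfield_divide subfield_uminus subfield_sum) auto
    have "(\<Sum>i\<in>insert r S. (if i = r then k else c i) * e i j) = 0" if "j \<in> J" for j
    proof -
      have "(\<Sum>i\<in>insert r S. (if i = r then k else c i) * e i j) = k * e r j + (\<Sum>i\<in>S. c i * e i j)"
        using insert.hyps by (simp, intro sum.cong) auto
      also have "\<dots> = (\<Sum>i\<in>S. c i * f i j)" unfolding sum_f k_def by simp
      finally show ?thesis using c that by simp
    qed
    then have "\<forall>j\<in>J. (\<Sum>i\<in>insert r S. (if i = r then k else c i) * e i j) = 0"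
      by blast
    moreover have "\<forall>i\<in>insert r S. (if i = r then k else c i) \<in> E"
      using c \<open>k \<in> E\<close> by simp
    ultimately have "\<forall>i\<in>insert r S. (if i = r then k else c i) = 0"
      by (rule insert.prems(2)[rotated])
    then show ?thesis using insert.hyps by (metis insertCI)
  qed
  have x: "x r * e r j + (\<Sum>i\<in>S. x i * e i j) = 0" if "j \<in> J" for j
    using insert.prems(4) that insert.hyps by simp
  have "(\<Sum>i\<in>S. x i * e i j0) = - x r * e r j0"
    using x[OF j0(1)] by (simp add: add_eq_0_iff)
  then have "(\<Sum>i\<in>S. x i * f i j) = 0" if "j \<in> J" for j
    unfolding sum_f using x[OF that] j0 by (simp add: add.commute)
  then have f0: "\<forall>j\<in>J. (\<Sum>i\<in>S. x i * f i j) = 0"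
    by blast
  have fE: "f i j \<in> E" if "i \<in> S" "j \<in> J" for i j
    unfolding f_def using insert.prems(1) that j0 E
    by (intro subfield_minus subfield_mult subfield_divide) auto
  have S: "\<forall>i\<in>S. x i = 0"
    by (rule insert.IH[OF fE ind _ f0]) (use insert.prems(3) in auto)
  then have "x r * e r j0 = 0"
    using x[OF j0(1)] by simp
  then show ?case using S j0 by simp
qed


section \<open>The Frobenius map\<close>

definition frob :: "'a::field \<Rightarrow> 'a" where
  "frob x = x ^ char_exp TYPE('a)"

lemma char_exp_cases:
  obtains "char_exp TYPE('a::field) = 1" "CHAR('a) = 0"
  | "Factorial_Ring.prime (char_exp TYPE('a))" "char_exp TYPE('a) = CHAR('a)"
proof (cases "CHAR('a) = 0")
  case False
  then have "Factorial_Ring.prime CHAR('a)" by (intro prime_CHAR_semidom) simp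
  then show ?thesis using that False by (simp add: char_exp_def)
qed (use that in \<open>simp add: char_exp_def\<close>)

lemma char_exp_pos [simp]: "0 < char_exp TYPE('a::field)"
  by (cases rule: char_exp_cases[where ?'a = 'a]) (auto simp: prime_gt_0_nat)

lemma frob_add: "frob (x + y) = frob x + frob (y :: 'a::field)"
  by (cases rule: char_exp_cases[where ?'a = 'a]) (auto simp: frob_def freshmans_dream)

lemma frob_0 [simp]: "frob 0 = 0"
  by (simp add: frob_def)

lemma frob_1 [simp]: "frob 1 = 1"
  by (simp add: frob_def)

lemma frob_mult: "frob (x * y) = frob x * frob y"
  by (simp add: frob_def power_mult_distrib)

lemma frob_uminus: "frob (- x) = - frob x"
  using frob_add[of x "- x"] by (simp add: add_eq_0_iff)

lemma frob_diff: "frob (x - y) = frob x - frob y"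
  using frob_add[of x "- y"] by (simp add: frob_uminus)

lemma frob_inverse: "frob (inverse x) = inverse (frob x)"
  by (simp add: frob_def power_inverse)

lemma frob_power: "frob (x ^ n) = frob x ^ n"
  by (simp add: frob_def power_mult[symmetric] mult.commute)

lemma frob_sum: "frob (sum f S) = (\<Sum>i\<in>S. frob (f i))"
  by (induction S rule: infinite_finite_induct) (simp_all add: frob_add)

lemma frob_prod: "frob (prod f S) = (\<Prod>i\<in>S. frob (f i))"
  by (induction S rule: infinite_finite_induct) (simp_all add: frob_mult)

lemma frob_eq_0_iff [simp]: "frob x = 0 \<longleftrightarrow> x = 0"
  by (simp add: frob_def)

lemma pth_powers_frob: "pth_powers F = frob ` F"
  by (simp add: pth_powers_def frob_def)

lemma frob_in: "is_subfield E \<Longrightarrow> x \<in> E \<Longrightarrow> frob x \<in> E"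
  unfolding frob_def by (rule subfield_power)

lemma pth_powers_subfield: "is_subfield E \<Longrightarrow> is_subfield (pth_powers E)"
proof -
  assume E: "is_subfield E"
  have "0 \<in> frob ` E" "1 \<in> frob ` E"
    using subfield_0[OF E] subfield_1[OF E] frob_0 frob_1 by (metis image_eqI)+
  then show ?thesis
    using E unfolding is_subfield_iff pth_powers_frob
    by (simp add: frob_uminus[symmetric] frob_inverse[symmetric] frob_add[symmetric] frob_mult[symmetric])
qed

lemma pth_powers_mono: "E \<subseteq> F \<Longrightarrow> pth_powers E \<subseteq> pth_powers F"
  unfolding pth_powers_frob by auto


section \<open>p-monomials and p-independence\<close>

text \<open>Exponents are not bounded here; the bound sits in \<open>multi_indices\<close>. Thus
  \<open>pmon\<close> also serves for ordinary monomials in the argument of MacLane.\<close>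

definition pmon :: "('a::field \<Rightarrow>\<^sub>0 nat) \<Rightarrow> 'a" where
  "pmon I = (\<Prod>y\<in>keys I. y ^ lookup I y)"

definition index_restrict :: "'a set \<Rightarrow> ('a \<Rightarrow>\<^sub>0 nat) \<Rightarrow> 'a \<Rightarrow>\<^sub>0 nat" where
  "index_restrict A I = Abs_poly_mapping (\<lambda>y. if y \<in> A then lookup I y else 0)"

lemma lookup_index_restrict:
  "lookup (index_restrict A I) y = (if y \<in> A then lookup I y else 0)"
proof -
  have "finite {y. (if y \<in> A then lookup I y else 0) \<noteq> 0}"
    by (rule finite_subset[OF _ finite_keys[of I]]) (auto simp: in_keys_iff)
  then show ?thesis by (simp add: index_restrict_def)
qed

lemma pmon_superset:
  assumes "finite A" "keys I \<subseteq> A"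
  shows "pmon I = (\<Prod>y\<in>A. y ^ lookup I y)"
  unfolding pmon_def
  by (rule prod.mono_neutral_left) (use assms in \<open>auto simp: in_keys_iff\<close>)

lemma multi_indicesD:
  assumes "I \<in> multi_indices A"
  shows "keys I \<subseteq> A" "lookup (I :: 'a \<Rightarrow>\<^sub>0 nat) y < char_exp TYPE('a::field)"
    "y \<notin> A \<Longrightarrow> lookup I y = 0"
  using assms unfolding multi_indices_def by (auto simp: in_keys_iff)

lemma multi_indicesI:
  assumes "\<And>y. y \<notin> A \<Longrightarrow> lookup I y = 0"
    "\<And>y. lookup (I :: 'a \<Rightarrow>\<^sub>0 nat) y < char_exp TYPE('a::field)"
  shows "I \<in> multi_indices A"
  using assms unfolding multi_indices_def by (auto simp: in_keys_iff)

lemma multi_indices_mono: "A \<subseteq> B \<Longrightarrow> multi_indices A \<subseteq> multi_indices B"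
  unfolding multi_indices_def by auto

lemma index_restrict_multi_indices: "I \<in> multi_indices B \<Longrightarrow> index_restrict A I \<in> multi_indices (A \<inter> B)"
  by (rule multi_indicesI) (auto simp: lookup_index_restrict multi_indicesD)

lemma zero_multi_indices: "0 \<in> multi_indices A"
  by (rule multi_indicesI) auto

lemma pmon_0 [simp]: "pmon 0 = 1"
  by (simp add: pmon_def)

lemma pmon_in: "is_subfield E \<Longrightarrow> I \<in> multi_indices A \<Longrightarrow> A \<subseteq> E \<Longrightarrow> pmon I \<in> E"
  unfolding pmon_def using multi_indicesD(1)[of I A] by (intro subfield_prod subfield_power) auto

lemma pmon_restrict_mult:
  assumes "keys I \<subseteq> A \<union> B" "A \<inter> B = {}"
  shows "pmon I = pmon (index_restrict B I) * pmon (index_restrict A I)"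
proof -
  let ?K = "keys I"
  have "pmon (index_restrict Z I) = (\<Prod>y\<in>?K. y ^ lookup (index_restrict Z I) y)" for Z
    by (rule pmon_superset) (auto simp: in_keys_iff lookup_index_restrict split: if_splits)
  then have "pmon (index_restrict B I) * pmon (index_restrict A I) =
    (\<Prod>y\<in>?K. y ^ lookup (index_restrict B I) y * y ^ lookup (index_restrict A I) y)"
    by (simp add: prod.distrib)
  also have "\<dots> = pmon I"
    unfolding pmon_def by (intro prod.cong) (use assms in \<open>auto simp: lookup_index_restrict\<close>)
  finally show ?thesis by simp
qed

text \<open>Exponents are reduced modulo \<open>p\<close>; the quotients contribute powers of
  \<open>frob y\<close>, which lie in \<open>D\<close>.\<close>

lemma pmon_mult_reduce:
  fixes A :: "'a::field set"
  assumes D: "is_subfield D" and A: "\<And>y. y \<in> A \<Longrightarrow> frob y \<in> D"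
    and I: "I \<in> multi_indices A" and J: "J \<in> multi_indices A"
  shows "\<exists>d\<in>D. \<exists>L\<in>multi_indices A. pmon I * pmon J = d * pmon L"
proof -
  let ?p = "char_exp TYPE('a)"
  let ?l = "lookup"
  let ?S = "keys I \<union> keys J"
  define L where "L = Abs_poly_mapping (\<lambda>y. (?l I y + ?l J y) mod ?p)"
  have S: "y \<in> ?S" if "(?l I y + ?l J y) mod ?p \<noteq> 0" for y
    using that by (intro ccontr[of "y \<in> ?S"]) (simp add: in_keys_iff)
  have "finite {y. (?l I y + ?l J y) mod ?p \<noteq> 0}"
    by (rule finite_subset[of _ ?S]) (use S in \<open>blast, simp\<close>)
  then have L: "?l L y = (?l I y + ?l J y) mod ?p" for y
    by (simp add: L_def)
  have "L \<in> multi_indices A"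
    by (rule multi_indicesI) (use I J in \<open>auto simp: L multi_indicesD\<close>)
  have KL: "keys L \<subseteq> ?S"
  proof
    fix y assume "y \<in> keys L"
    then show "y \<in> ?S" by (intro S) (simp add: in_keys_iff L)
  qed
  have "pmon I = (\<Prod>y\<in>?S. y ^ ?l I y)" "pmon J = (\<Prod>y\<in>?S. y ^ ?l J y)" "pmon L = (\<Prod>y\<in>?S. y ^ ?l L y)"
    by (rule pmon_superset; (rule KL | auto))+
  then have "pmon I * pmon J = (\<Prod>y\<in>?S. y ^ (?l I y + ?l J y))"
    by (simp add: prod.distrib power_add)
  also have "\<dots> = (\<Prod>y\<in>?S. frob y ^ ((?l I y + ?l J y) div ?p) * y ^ ?l L y)"
  proof (rule prod.cong[OF refl])
    fix y
    have "y ^ (?l I y + ?l J y) = y ^ (?p * ((?l I y + ?l J y) div ?p) + (?l I y + ?l J y) mod ?p)"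
      by (simp only: mult_div_mod_eq)
    then show "y ^ (?l I y + ?l J y) = frob y ^ ((?l I y + ?l J y) div ?p) * y ^ ?l L y"
      by (simp only: power_add power_mult frob_def L)
  qed
  also have "\<dots> = (\<Prod>y\<in>?S. frob y ^ ((?l I y + ?l J y) div ?p)) * pmon L"
    using \<open>pmon L = _\<close> by (simp add: prod.distrib)
  finally have "pmon I * pmon J = (\<Prod>y\<in>?S. frob y ^ ((?l I y + ?l J y) div ?p)) * pmon L" .
  moreover have "(\<Prod>y\<in>?S. frob y ^ ((?l I y + ?l J y) div ?p)) \<in> D"
    using multi_indicesD(1)[OF I] multi_indicesD(1)[OF J] A
    by (intro subfield_prod[OF D] subfield_power[OF D]) auto
  ultimately show ?thesis using \<open>L \<in> multi_indices A\<close> by blast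
qed

lemma single_multi_index:
  assumes "y \<in> A" "k < char_exp TYPE('a::field)"
  shows "single (y::'a) k \<in> multi_indices A" "pmon (single y k) = y ^ k"
  using assms by (auto intro!: multi_indicesI simp: lookup_single when_def pmon_def)

text \<open>
  Inverses need no separate argument: \<open>1/x = x\<^bsup>p-1\<^esup> \<cdot> (1/x)\<^bsup>p\<^esup>\<close>, and \<open>p\<close>-th powers lie in \<open>D\<close>.
\<close>

lemma gen_field_eq_pmon_span:
  fixes A :: "'a::field set"
  assumes D: "is_subfield D" and A: "\<And>y. y \<in> A \<Longrightarrow> frob y \<in> D"
  shows "gen_field (D \<union> A) = lin_span D (multi_indices A) pmon"
proof
  let ?T = "lin_span D (multi_indices A) pmon"
  have DT: "d \<in> ?T" if "d \<in> D" for d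
    using lin_span_scale[OF D lin_span_base[OF D zero_multi_indices, of pmon] that] by simp
  have mult: "x * y \<in> ?T" if "x \<in> ?T" "y \<in> ?T" for x y
  proof (rule lin_span_mult[OF D _ that])
    show "pmon I * pmon J \<in> ?T" if "I \<in> multi_indices A" "J \<in> multi_indices A" for I J
      using pmon_mult_reduce[OF D A that] lin_span_base[OF D, of _ "multi_indices A" pmon] lin_span_scale[OF D]
      by metis
  qed
  have pow: "x ^ n \<in> ?T" if "x \<in> ?T" for x n
    by (induction n) (use mult that DT[of 1] subfield_1[OF D] in auto)
  \<comment> \<open>As \<open>frob\<close> is additive and multiplicative, it suffices that it maps
    \<open>D\<close> and the elements of \<open>A\<close> into \<open>D\<close>.\<close>
  have "?T \<subseteq> {x. frob x \<in> D}"
  proof (rule lin_span_closed_subset)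
    fix I assume I: "I \<in> multi_indices A"
    show "pmon I \<in> {x. frob x \<in> D}"
      using multi_indicesD(1)[OF I] A unfolding pmon_def
      by (auto simp: frob_prod frob_power intro!: subfield_prod[OF D] subfield_power[OF D])
  qed (auto simp: frob_add frob_mult intro!: subfield_0[OF D] subfield_add[OF D] subfield_mult[OF D] frob_in[OF D])
  then have inv: "inverse x \<in> ?T" if "x \<in> ?T" for x
  proof -
    have "frob x \<in> D" using that \<open>?T \<subseteq> _\<close> by blast
    then have "inverse (frob x) \<in> ?T" using D by (intro DT subfield_inverse)
    then have "x ^ (char_exp TYPE('a) - 1) * inverse (frob x) \<in> ?T" using that by (intro mult pow)
    also have "x ^ (char_exp TYPE('a) - 1) * inverse (frob x) = inverse x"
      unfolding frob_def using char_exp_pos[where ?'a='a]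
      by (cases "char_exp TYPE('a)"; cases "x = 0") (auto simp: power_0_left)
    finally show ?thesis .
  qed
  have "is_subfield ?T"
    unfolding is_subfield_iff
    using DT[of 1] DT[of "-1"] mult[of "-1"] inv mult lin_span_0 lin_span_add[OF D] subfield_1[OF D] subfield_uminus[OF D]
    by auto
  moreover have "y \<in> ?T" if y: "y \<in> A" for y
  \<comment> \<open>For exponent 1 the index \<open>single y 1\<close> is not admissible, but then
    \<open>y = frob y\<close> already lies in \<open>D\<close>.\<close>
  proof (cases rule: char_exp_cases[where ?'a = 'a])
    case 1
    then show ?thesis using A[OF y] DT by (simp add: frob_def)
  next
    case 2
    then have "1 < char_exp TYPE('a)" by (intro prime_gt_1_nat)
    then show ?thesis
      using single_multi_index[OF y, of 1] lin_span_base[OF D, of "single y 1" "multi_indices A" pmon] by simp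
  qed
  ultimately show "gen_field (D \<union> A) \<subseteq> ?T"
    using DT by (intro gen_field_least) auto
  show "?T \<subseteq> gen_field (D \<union> A)"
  proof (rule lin_span_closed_subset)
    show "pmon I \<in> gen_field (D \<union> A)" if "I \<in> multi_indices A" for I
      using that gen_field_incl[of "D \<union> A"] by (intro pmon_in[of _ I A]) auto
  qed (use gen_field_incl[of "D \<union> A"] gen_field_subfield[of "D \<union> A"] in \<open>auto intro: subfield_0 subfield_add subfield_mult\<close>)
qed

section \<open>Powers of a purely inseparable element\<close>

lemma coeff_linear_power_pred:
  "coeff ([:a, 1:] ^ Suc n) n = of_nat (Suc n) * (a :: 'a::comm_ring_1)"
proof (induction n)
  case (Suc n)
  have "degree ([:a, 1:] ^ Suc n) \<le> Suc n" for a :: 'a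
    using degree_power_le[of "[:a, 1:]" "Suc n"] degree_pCons_le[of a "[:1:]"] by (metis One_nat_def degree_pCons_0 le_trans mult.commute mult_le_mono1 nat_mult_1)
  moreover have "coeff ([:a, 1:] ^ Suc n) (Suc n) = 1"
    by (rule coeff_linear_power)
  ultimately show ?case
    using Suc by (simp del: power_Suc add: power_Suc[of _ "Suc n"] algebra_simps)
qed simp

lemma dvd_linear_power:
  fixes y :: "'a::field"
  assumes "g dvd [:- y, 1:] ^ n"
  shows "\<exists>c k. g = smult c ([:- y, 1:] ^ k)"
  using assms
proof (induction n arbitrary: g)
  case 0
  then obtain c where "g = [:c:]" by (auto simp: is_unit_poly_iff)
  then have "g = smult c ([:- y, 1:] ^ 0)" by simp
  then show ?case by blast
next
  case (Suc n)
  then obtain h where h: "[:- y, 1:] ^ Suc n = g * h" by (elim dvdE)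
  then have "poly g y * poly h y = 0"
    unfolding poly_mult[symmetric] h[symmetric] by simp
  then consider "[:- y, 1:] dvd g" | "[:- y, 1:] dvd h"
    by (auto simp: poly_eq_0_iff_dvd)
  then show ?case
  proof cases
    case 1
    then obtain g' where g': "g = [:- y, 1:] * g'" by (elim dvdE)
    then have "[:- y, 1:] ^ n = g' * h"
      using h by (simp del: mult_pCons_left mult_pCons_right add: mult.assoc)
    then obtain c k where "g' = smult c ([:- y, 1:] ^ k)" using Suc.IH[of g'] by auto
    then have "g = smult c ([:- y, 1:] ^ Suc k)"
      unfolding g' by (simp del: mult_pCons_left mult_pCons_right)
    then show ?thesis by blast
  next
    case 2
    then obtain h' where h': "h = [:- y, 1:] * h'" by (elim dvdE)
    then have "[:- y, 1:] ^ n = g * h'"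
      using h by (simp del: mult_pCons_left mult_pCons_right add: mult.left_commute)
    then show ?thesis using Suc.IH[of g] by auto
  qed
qed

text \<open>Since \<open>X^p - frob y = (X - y)^p\<close> has coefficients in \<open>D\<close>, the
  minimal polynomial of \<open>y\<close> over \<open>D\<close> is \<open>(X - y)^d\<close> up to a
  constant. A relation among the listed powers would give \<open>0 < d < p\<close>; then the
  coefficient below the leading one is a nonzero multiple of \<open>y\<close>, which puts
  \<open>y\<close> into \<open>D\<close>.\<close>

lemma power_lin_indep:
  fixes y :: "'a::field"
  assumes D: "is_subfield D" and y: "y \<notin> D" "frob y \<in> D"
  shows "lin_indep D {..<char_exp TYPE('a)} (\<lambda>k. y ^ k)"
proof (rule ccontr)
  let ?p = "char_exp TYPE('a)"
  define P where "P n g \<longleftrightarrow> g \<noteq> 0 \<and> poly g y = 0 \<and> (\<forall>i. coeff g i \<in> D) \<and> degree g = n" for n g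
  \<comment> \<open>Exponent 1 is excluded, since then \<open>y = frob y\<close> would lie in
    \<open>D\<close>.\<close>
  have p: "?p = CHAR('a)" "Factorial_Ring.prime ?p"
    using y by (cases rule: char_exp_cases[where ?'a = 'a]; simp add: frob_def)+
  assume "\<not> lin_indep D {..<?p} (\<lambda>k. y ^ k)"
  then obtain c where c: "\<forall>i<?p. c i \<in> D" "(\<Sum>i<?p. c i * y ^ i) = 0" and "\<exists>i<?p. c i \<noteq> 0"
    by (subst (asm) lin_indep_finite_iff) (use subfield_0[OF D] in auto)
  then obtain i where i: "i < ?p" "c i \<noteq> 0" by blast
  define f where "f = (\<Sum>i<?p. monom (c i) i)"
  have cf: "coeff f j = (if j < ?p then c j else 0)" for j
    unfolding f_def by (simp add: coeff_sum)
  have "poly f y = 0"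
    unfolding f_def poly_sum poly_monom using c by simp
  moreover have "f \<noteq> 0"
    using cf[of i] i by auto
  moreover have "\<forall>i. coeff f i \<in> D"
    using c(1) subfield_0[OF D] by (simp add: cf)
  ultimately have ex: "\<exists>g. P (degree f) g" unfolding P_def by blast
  define d where "d = (LEAST n. \<exists>g. P n g)"
  have "\<exists>g. P d g" unfolding d_def by (rule LeastI[of "\<lambda>n. \<exists>g. P n g", OF ex])
  then obtain g where g: "g \<noteq> 0" "poly g y = 0" "\<And>i. coeff g i \<in> D" "degree g = d"
    unfolding P_def by blast
  have min: "h = 0" if "poly h y = 0" "\<And>i. coeff h i \<in> D" "degree h < d" for h
    using that not_less_Least[of "degree h" "\<lambda>n. \<exists>g. P n g"] unfolding d_def P_def by blast
  have "degree f < ?p"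
    using cf by (intro degree_lessI) auto
  then have "d < ?p"
    using Least_le[of "\<lambda>n. \<exists>g. P n g", OF ex] unfolding d_def by simp
  \<comment> \<open>Euclidean division by \<open>g\<close> that stays within coefficients from
    \<open>D\<close>, cancelling one leading term at a time; this is needed because \<open>g\<close>
    has minimal degree only among polynomials over \<open>D\<close>.\<close>
  have div: "g dvd h" if "poly h y = 0" "\<And>i. coeff h i \<in> D" for h
    using that
  proof (induction "degree h" arbitrary: h rule: less_induct)
    case less
    show ?case
    proof (cases "degree h < d")
      case True
      then have "h = 0" using less.prems by (intro min)
      then show ?thesis by simp
    next
      case False
      have lc: "coeff g d \<noteq> 0"
        using g(1,4) by auto
      define k where "k = Polynomial.lead_coeff h / Polynomial.lead_coeff g"
      define q where "q = monom k (degree h - d)"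
      define h' where "h' = h - q * g"
      have kD: "k \<in> D" unfolding k_def using g(3) less.prems(2) by (intro subfield_divide[OF D])
      have qg: "coeff (q * g) i = (if i < degree h - d then 0 else k * coeff g (i - (degree h - d)))" for i
        unfolding q_def by (simp add: coeff_monom_mult)
      have h'D: "coeff h' i \<in> D" for i
        unfolding h'_def coeff_diff qg using kD g(3) less.prems(2) subfield_0[OF D] D by auto
      have h'y: "poly h' y = 0" unfolding h'_def using less.prems g by simp
      have "coeff h' i = 0" if "i > degree h" for i
        unfolding h'_def coeff_diff qg using that False g(4) by (simp add: coeff_eq_0)
      moreover have "coeff h' (degree h) = 0"
        unfolding h'_def coeff_diff qg k_def g(4) using False lc by (simp add: not_less)
      ultimately have "degree h' < degree h \<or> h' = 0"
        by (metis le_degree leading_coeff_0_iff linorder_neqE_nat not_less)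
      then have "g dvd h'" using less.hyps[of h'] h'D h'y by auto
      then have "g dvd h' + q * g" by simp
      then show ?thesis by (simp add: h'_def)
    qed
  qed
  have "0 < d"
    using g(1,2,4) by (metis degree_eq_zeroE gr0I mult_zero_right pCons_0_0 poly_0 poly_pCons add.right_neutral)
  have "g dvd monom 1 ?p - [:frob y:]"
  proof (rule div)
    show "poly (monom 1 ?p - [:frob y:]) y = 0"
      by (simp add: poly_monom frob_def)
    show "coeff (monom 1 ?p - [:frob y:]) i \<in> D" for i
      using y(2) D by (auto simp: coeff_pCons split: nat.splits intro!: subfield_minus subfield_0 subfield_1 subfield_uminus)
  qed
  also have "monom 1 ?p - [:frob y:] = [:- y, 1:] ^ ?p"
  proof -
    \<comment> \<open>The binomial identity is applied in the polynomial ring, which has the same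
      characteristic.\<close>
    have ch: "CHAR('a poly) = CHAR('a)" by (rule CHAR_eqI) (auto simp: of_nat_poly of_nat_eq_0_iff_char_dvd)
    have "([:0, 1:] + [:- y:]) ^ ?p = [:0, 1:] ^ ?p + [:- y:] ^ ?p"
      by (rule freshmans_dream) (use p ch in auto)
    moreover have "[:- y:] ^ ?p = [:- frob y:]"
      using frob_uminus[of y] by (simp add: frob_def poly_const_pow)
    ultimately show ?thesis by (simp add: monom_altdef)
  qed
  finally obtain c k where ck: "g = smult c ([:- y, 1:] ^ k)"
    using dvd_linear_power by blast
  then have "c \<noteq> 0" using g(1) by auto
  then have "k = d" using ck g(4) by (simp add: degree_linear_power)
  have "coeff g d = c"
    unfolding ck \<open>k = d\<close> by (simp add: coeff_linear_power)
  then have "c \<in> D" using g(3) by metis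
  have "coeff g (d - 1) = c * (of_nat d * (- y))"
    using coeff_linear_power_pred[of "- y" "d - 1"] \<open>0 < d\<close> unfolding ck \<open>k = d\<close> by simp
  then have 1: "c * (of_nat d * (- y)) \<in> D" using g(3) by metis
  \<comment> \<open>Here \<open>0 < d < p\<close> is used: the integer \<open>d\<close> is
    invertible in characteristic \<open>p\<close>.\<close>
  have "(of_nat d :: 'a) \<noteq> 0"
    using \<open>0 < d\<close> \<open>d < ?p\<close> p(1) by (auto simp: of_nat_eq_0_iff_char_dvd dest: dvd_imp_le)
  have 2: "(of_nat d :: 'a) \<in> D" using D by (rule subfield_of_nat)
  have "- (c * (of_nat d * (- y)) / (c * of_nat d)) \<in> D"
    by (rule subfield_uminus[OF D subfield_divide[OF D 1 subfield_mult[OF D \<open>c \<in> D\<close> 2]]])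
  then show False
    using y(1) \<open>c \<noteq> 0\<close> \<open>(of_nat d :: 'a) \<noteq> 0\<close> by (simp add: field_simps)
qed

text \<open>The tower law: monomials in \<open>A\<close> lie in \<open>D'\<close> and are
  independent over \<open>D\<close>, monomials in \<open>B\<close> are independent over
  \<open>D'\<close>, and by disjointness each monomial in \<open>A \<union> B\<close> is the product
  of its two restrictions.\<close>

lemma pmon_lin_indep_Un:
  fixes A :: "'a::field set"
  assumes D': "is_subfield D'" and D: "D \<subseteq> D'" and A: "A \<subseteq> D'" "A \<inter> B = {}"
    and "lin_indep D (multi_indices A) pmon" "lin_indep D' (multi_indices B) pmon"
  shows "lin_indep D (multi_indices (A \<union> B)) pmon"
proof -
  let ?S = "multi_indices (A \<union> B)"
  have "lin_indep D ?S (\<lambda>I. pmon (index_restrict B I) * pmon (index_restrict A I))"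
  proof (rule lin_indep_tower[OF D' D assms(6)])
    fix I assume I: "I \<in> ?S"
    show "index_restrict B I \<in> multi_indices B"
      using index_restrict_multi_indices[OF I, of B] by (simp add: Int_absorb2)
    have "index_restrict A I \<in> multi_indices A"
      using index_restrict_multi_indices[OF I, of A] by (simp add: Int_absorb2)
    then show "pmon (index_restrict A I) \<in> D'"
      using A(1) by (rule pmon_in[OF D'])
  next
    fix L assume "L \<in> multi_indices B"
    let ?Q = "{I \<in> ?S. index_restrict B I = L}"
    have "inj_on (index_restrict A) ?Q"
    proof (rule inj_onI, rule poly_mapping_eqI)
      fix I J y assume IJ: "I \<in> ?Q" "J \<in> ?Q" "index_restrict A I = index_restrict A J"
      then have eq: "index_restrict A I = index_restrict A J" "index_restrict B I = index_restrict B J"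
        by simp_all
      show "lookup I y = lookup J y"
        using IJ multi_indicesD(3)[of I "A \<union> B" y] multi_indicesD(3)[of J "A \<union> B" y]
          lookup_index_restrict[of A I y] lookup_index_restrict[of B I y]
        unfolding eq lookup_index_restrict by (cases "y \<in> A"; cases "y \<in> B") auto
    qed
    moreover have "index_restrict A ` ?Q \<subseteq> multi_indices A"
      using index_restrict_multi_indices[of _ "A \<union> B" A] by (auto simp: Int_absorb2)
    ultimately show "lin_indep D ?Q (\<lambda>I. pmon (index_restrict A I))"
      using lin_indep_subset[OF assms(5)] by (subst lin_indep_reindex[symmetric])
  qed
  moreover have "lin_indep D ?S pmon \<longleftrightarrow> lin_indep D ?S (\<lambda>I. pmon (index_restrict B I) * pmon (index_restrict A I))"
    by (rule lin_indep_cong) (rule pmon_restrict_mult[OF multi_indicesD(1) A(2)])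
  ultimately show ?thesis by simp
qed

lemma pmon_lin_indep_empty: "lin_indep D (multi_indices ({} :: 'a::field set)) pmon"
proof -
  have "multi_indices ({} :: 'a set) = {0}"
    using zero_multi_indices by (auto simp: multi_indices_def)
  then show ?thesis
    unfolding lin_indep_def by (auto simp: subset_singleton_iff)
qed

lemma pmon_lin_indep_singleton:
  fixes y :: "'a::field"
  assumes D: "is_subfield D" and y: "y \<notin> D" "frob y \<in> D"
  shows "lin_indep D (multi_indices {y}) pmon"
proof -
  let ?f = "\<lambda>I::'a \<Rightarrow>\<^sub>0 nat. lookup I y"
  have "inj_on ?f (multi_indices {y})"
  proof (rule inj_onI, rule poly_mapping_eqI)
    fix I J :: "'a \<Rightarrow>\<^sub>0 nat" and z assume "I \<in> multi_indices {y}" "J \<in> multi_indices {y}" "?f I = ?f J"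
    then show "lookup I z = lookup J z"
      using multi_indicesD(3)[of I "{y}" z] multi_indicesD(3)[of J "{y}" z] by (cases "z = y") auto
  qed
  moreover have "?f ` multi_indices {y} \<subseteq> {..<char_exp TYPE('a)}"
    by (auto intro: multi_indicesD)
  ultimately have "lin_indep D (multi_indices {y}) (\<lambda>I. y ^ ?f I)"
    using lin_indep_subset[OF power_lin_indep[OF D y]] by (subst lin_indep_reindex[symmetric])
  moreover have "lin_indep D (multi_indices {y}) pmon \<longleftrightarrow> lin_indep D (multi_indices {y}) (\<lambda>I. y ^ ?f I)"
  proof (rule lin_indep_cong)
    fix I assume "I \<in> multi_indices {y}"
    then show "pmon I = y ^ ?f I"
      using pmon_superset[of "{y}" I] multi_indicesD(1)[of I "{y}"] by simp
  qed
  ultimately show ?thesis by simp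
qed

lemma pmon_lin_indep_insert:
  assumes D: "is_subfield D" and A: "\<And>x. x \<in> A \<Longrightarrow> frob x \<in> D" "lin_indep D (multi_indices A) pmon"
    and y: "y \<notin> gen_field (D \<union> A)" "frob y \<in> D"
  shows "lin_indep D (multi_indices (insert y A)) pmon"
proof -
  have "lin_indep (gen_field (D \<union> A)) (multi_indices {y}) pmon"
    using y gen_field_incl[of "D \<union> A"] by (intro pmon_lin_indep_singleton) auto
  then show ?thesis
    using pmon_lin_indep_Un[of "gen_field (D \<union> A)" D A "{y}"] A(2) y gen_field_incl[of "D \<union> A"]
    by (cases "y \<in> A") auto
qed

lemma multi_indices_finite_subset:
  assumes "finite S" "S \<subseteq> multi_indices A"
  shows "\<exists>A'\<subseteq>A. finite A' \<and> S \<subseteq> multi_indices A'"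
proof (intro exI conjI)
  show "(\<Union>I\<in>S. keys I) \<subseteq> A" using assms(2) multi_indicesD(1) by blast
  show "finite (\<Union>I\<in>S. keys I)" using assms(1) by simp
  show "S \<subseteq> multi_indices (\<Union>I\<in>S. keys I)"
    using assms(2) unfolding multi_indices_def by auto
qed

section \<open>p-independence as linear independence of p-monomials\<close>

lemma p_independent_subset: "p_independent F C A \<Longrightarrow> B \<subseteq> A \<Longrightarrow> p_independent F C B"
  unfolding p_independent_def
  using gen_field_mono[of "pth_powers F \<union> C \<union> (B - {x})" "pth_powers F \<union> C \<union> (A - {x})" for x]
  by blast

text \<open>The definition only keeps each element out of the field generated by the others.
  Adjoining the elements of a finite subset one by one upgrades this to independence of all
  p-monomials.\<close>

lemma p_independent_imp_pmon:
  assumes "p_independent F C A"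
  shows "lin_indep (gen_field (pth_powers F \<union> C)) (multi_indices A) pmon"
proof -
  let ?D = "gen_field (pth_powers F \<union> C)"
  have fin: "lin_indep ?D (multi_indices B) pmon" if "finite B" "B \<subseteq> A" for B
    using that
  proof (induction B rule: finite_induct)
    case empty
    show ?case by (rule pmon_lin_indep_empty)
  next
    case (insert y B)
    have frob: "frob x \<in> ?D" if "x \<in> A" for x
      using that assms gen_field_incl[of "pth_powers F \<union> C"] unfolding p_independent_def pth_powers_frob by blast
    have "p_independent F C (insert y B)"
      using p_independent_subset[OF assms insert.prems] .
    then have "y \<notin> gen_field (pth_powers F \<union> C \<union> (insert y B - {y}))"
      unfolding p_independent_def by blast
    then have "y \<notin> gen_field (?D \<union> B)"
      using insert.hyps(2) by (simp add: gen_field_Un_gen_field)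
    then show ?case
      using insert frob by (intro pmon_lin_indep_insert) auto
  qed
  show ?thesis
    unfolding lin_indep_finitely[of _ "multi_indices A"]
    using fin multi_indices_finite_subset lin_indep_subset by meson
qed

text \<open>For exponent 1 the only p-monomial is 1, whose independence says nothing about
  \<open>A\<close>; for larger exponent \<open>x\<close> itself is a p-monomial.\<close>

lemma pmon_imp_p_independent:
  fixes A :: "'a::field set"
  assumes p: "1 < char_exp TYPE('a)" and A: "A \<subseteq> F"
    and ind: "lin_indep (gen_field (pth_powers F \<union> C)) (multi_indices A) pmon"
  shows "p_independent F C A"
  unfolding p_independent_def
proof (intro conjI ballI notI)
  let ?D = "gen_field (pth_powers F \<union> C)"
  have D: "is_subfield ?D" by simp
  fix x assume x: "x \<in> A" and "x \<in> gen_field (pth_powers F \<union> C \<union> (A - {x}))"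
  then have "x \<in> gen_field (?D \<union> (A - {x}))" by (simp add: gen_field_Un_gen_field)
  moreover have "frob y \<in> ?D" if "y \<in> A" for y
    using that A gen_field_incl[of "pth_powers F \<union> C"] unfolding pth_powers_frob by auto
  ultimately have "x \<in> lin_span ?D (multi_indices (A - {x})) pmon"
    using gen_field_eq_pmon_span[of ?D "A - {x}"] by auto
  then obtain T c where T: "finite T" "T \<subseteq> multi_indices (A - {x})" "\<forall>I\<in>T. c I \<in> ?D"
    "x = (\<Sum>I\<in>T. c I * pmon I)"
    unfolding lin_span_def by blast
  let ?J = "single x (1::nat)"
  have J: "?J \<in> multi_indices A" "pmon ?J = x" using single_multi_index[OF x p] by auto
  have "?J \<notin> T" using T(2) multi_indicesD(3)[of ?J "A - {x}" x] by auto
  let ?c = "\<lambda>I. if I = ?J then -1 else c I"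
  have "(\<Sum>I\<in>insert ?J T. ?c I * pmon I) = - x + (\<Sum>I\<in>T. ?c I * pmon I)"
    using T(1) \<open>?J \<notin> T\<close> J(2) by simp
  also have "(\<Sum>I\<in>T. ?c I * pmon I) = (\<Sum>I\<in>T. c I * pmon I)"
    using \<open>?J \<notin> T\<close> by (intro sum.cong) auto
  finally have "(\<Sum>I\<in>insert ?J T. ?c I * pmon I) = 0" using T(4) by simp
  then have "?c ?J = 0"
    by (rule lin_indepD[OF ind, rotated 3])
      (use T J multi_indices_mono[of "A - {x}" A] subfield_1[OF D] in \<open>auto intro: subfield_uminus\<close>)
  then show False by simp
qed (rule A)


section \<open>Separability in terms of the Frobenius map\<close>

text \<open>This is linear disjointness from \<open>E^(1/p)\<close> raised to the p-th power: a
  relation among the \<open>u i\<close> with coefficients in \<open>E^(1/p)\<close> becomes one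
  among their p-th powers with coefficients in \<open>E\<close>. The index sets are initial segments
  of the naturals because a definition cannot quantify over index types;
  \<open>frob_separableD\<close> transfers to arbitrary ones.\<close>

definition frob_separable :: "'a::field set \<Rightarrow> 'a set \<Rightarrow> bool" where
  "frob_separable F E \<longleftrightarrow>
     (\<forall>(n::nat) u. u ` {..<n} \<subseteq> F \<and> lin_indep E {..<n} u \<longrightarrow> lin_indep E {..<n} (\<lambda>i. frob (u i)))"

lemma frob_separableD:
  assumes "frob_separable F E" "u ` S \<subseteq> F" "lin_indep E S u"
  shows "lin_indep E S (\<lambda>i. frob (u i))"
  unfolding lin_indep_finitely[of _ S]
proof (intro allI impI, elim conjE)
  fix T assume T: "finite T" "T \<subseteq> S"
  obtain f where f: "bij_betw f {..<card T} T"
    using ex_bij_betw_nat_finite[OF T(1)] by (auto simp: atLeast0LessThan)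
  then have inj: "inj_on f {..<card T}" and im: "f ` {..<card T} = T"
    by (auto simp: bij_betw_def)
  have "lin_indep E (f ` {..<card T}) u"
    using lin_indep_subset[OF assms(3) T(2)] im by simp
  then have "lin_indep E {..<card T} (\<lambda>i. u (f i))"
    unfolding lin_indep_reindex[OF inj] .
  moreover have "(\<lambda>i. u (f i)) ` {..<card T} \<subseteq> F"
    using assms(2) im T(2) by blast
  ultimately have "lin_indep E {..<card T} (\<lambda>i. frob (u (f i)))"
    using assms(1) unfolding frob_separable_def by blast
  then have "lin_indep E (f ` {..<card T}) (\<lambda>i. frob (u i))"
    unfolding lin_indep_reindex[OF inj] .
  then show "lin_indep E T (\<lambda>i. frob (u i))" using im by simp
qed

lemma frob_separable_subset: "frob_separable F E \<Longrightarrow> F' \<subseteq> F \<Longrightarrow> frob_separable F' E"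
  unfolding frob_separable_def by blast

lemma lin_span_common_support:
  assumes "finite S" "0 \<in> E" "\<And>i. i \<in> S \<Longrightarrow> v i \<in> lin_span E W w"
  shows "\<exists>T e. finite T \<and> T \<subseteq> W \<and> (\<forall>i\<in>S. \<forall>t\<in>T. e i t \<in> E) \<and> (\<forall>i\<in>S. v i = (\<Sum>t\<in>T. e i t * w t))"
proof -
  have "\<forall>i\<in>S. \<exists>T. finite T \<and> T \<subseteq> W \<and> v i \<in> lin_span E T w"
    using assms(3) lin_span_finitely by metis
  then obtain Q where Q: "\<forall>i\<in>S. finite (Q i) \<and> Q i \<subseteq> W \<and> v i \<in> lin_span E (Q i) w"
    by metis
  let ?T = "\<Union>i\<in>S. Q i"
  have fin: "finite ?T" using assms(1) Q by blast
  have "v i \<in> lin_span E ?T w" if "i \<in> S" for i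
    using Q that lin_span_subset[of "Q i" ?T E w] by blast
  then have "\<forall>i\<in>S. \<exists>c. (\<forall>t\<in>?T. c t \<in> E) \<and> v i = (\<Sum>t\<in>?T. c t * w t)"
    by (simp only: lin_span_finite[OF fin assms(2)]) blast
  then obtain e where "\<forall>i\<in>S. (\<forall>t\<in>?T. e i t \<in> E) \<and> v i = (\<Sum>t\<in>?T. e i t * w t)"
    by metis
  moreover have "?T \<subseteq> W" using Q by blast
  ultimately show ?thesis using fin by blast
qed

text \<open>The symmetry of linear disjointness, for \<open>C\<close> and \<open>F^p\<close> over
  \<open>C^p\<close>. The coefficients of a relation among the \<open>v i\<close> are p-th powers of
  elements \<open>k i\<close> of \<open>F\<close>; expanding these in a subfamily independent over
  \<open>C\<close> gives a relation over \<open>C\<close> among p-th powers, to which separability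
  applies.\<close>

lemma frob_separable_swap:
  assumes C: "is_subfield C" and sep: "frob_separable F C"
    and v: "v ` S \<subseteq> C" "lin_indep (pth_powers C) S v"
  shows "lin_indep (pth_powers F) S v"
proof (rule lin_indepI)
  fix T c
  assume T: "finite T" "T \<subseteq> S" and c: "\<And>i. i \<in> T \<Longrightarrow> c i \<in> pth_powers F"
    and 0: "(\<Sum>i\<in>T. c i * v i) = 0"
  have "\<forall>i\<in>T. \<exists>k\<in>F. c i = frob k" using c unfolding pth_powers_frob by blast
  then obtain k where k: "\<And>i. i \<in> T \<Longrightarrow> k i \<in> F" "\<And>i. i \<in> T \<Longrightarrow> c i = frob (k i)" by metis
  obtain Q where Q: "Q \<subseteq> T" "lin_indep C Q k" "\<forall>i\<in>T. k i \<in> lin_span C Q k"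
    using lin_indep_basis_exists[OF C T(1), of k] by blast
  have finQ: "finite Q" using Q(1) T(1) finite_subset by blast
  have "\<forall>i\<in>T. \<exists>e. (\<forall>t\<in>Q. e t \<in> C) \<and> k i = (\<Sum>t\<in>Q. e t * k t)"
    using Q(3) unfolding lin_span_finite[OF finQ subfield_0[OF C]] by blast
  then obtain e where e: "\<And>i t. i \<in> T \<Longrightarrow> t \<in> Q \<Longrightarrow> e i t \<in> C" "\<And>i. i \<in> T \<Longrightarrow> k i = (\<Sum>t\<in>Q. e i t * k t)"
    by metis
  \<comment> \<open>The coefficient of \<open>frob (k t)\<close> once the relation is sorted by the
    independent subfamily. Its vanishing is in turn a relation among the \<open>v i\<close> over
    \<open>C^p\<close>.\<close>
  define d where "d t = (\<Sum>i\<in>T. frob (e i t) * v i)" for t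
  have "(\<Sum>t\<in>Q. d t * frob (k t)) = (\<Sum>t\<in>Q. \<Sum>i\<in>T. frob (e i t) * frob (k t) * v i)"
    unfolding d_def sum_distrib_right by (intro sum.cong refl) (simp add: mult_ac)
  also have "\<dots> = (\<Sum>i\<in>T. \<Sum>t\<in>Q. frob (e i t) * frob (k t) * v i)"
    by (rule sum.swap)
  also have "\<dots> = (\<Sum>i\<in>T. c i * v i)"
  proof (rule sum.cong[OF refl])
    fix i assume "i \<in> T"
    then have "c i = (\<Sum>t\<in>Q. frob (e i t) * frob (k t))"
      using k(2) e(2)[of i] by (simp add: frob_sum frob_mult)
    then show "(\<Sum>t\<in>Q. frob (e i t) * frob (k t) * v i) = c i * v i"
      by (simp add: sum_distrib_right)
  qed
  finally have d0: "(\<Sum>t\<in>Q. d t * frob (k t)) = 0" using 0 by simp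
  have dC: "d t \<in> C" if "t \<in> Q" for t
    unfolding d_def
    by (intro subfield_sum[OF C] subfield_mult[OF C] frob_in[OF C]) (use e(1) that v(1) T(2) in blast)+
  have ind: "lin_indep C Q (\<lambda>t. frob (k t))"
    using frob_separableD[OF sep _ Q(2)] k(1) Q(1) by blast
  have "frob (e i t) = 0" if "i \<in> T" "t \<in> Q" for i t
  proof -
    have "d t = 0" using lin_indepD[OF ind finQ subset_refl dC d0 that(2)] .
    then show ?thesis
      unfolding d_def
      by (rule lin_indepD[OF v(2) T _ _ that(1), rotated]) (use e(1) that in \<open>auto simp: pth_powers_frob\<close>)
  qed
  then have "k i = 0" if "i \<in> T" for i using that e(2)[OF that] by simp
  then show "\<forall>i\<in>T. c i = 0" using k(2) by simp
qed

text \<open>By separability a p-basis of \<open>C\<close> stays independent over \<open>F^p\<close>,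
  and \<open>A\<close> is independent over the larger field generated by \<open>F^p\<close> and
  \<open>C\<close>. This makes the lambda functions of the concatenation of \<open>c\<close> and
  \<open>a'\<close> well defined.\<close>

lemma p_basis_pmon_lin_indep:
  assumes C: "is_subfield C" and sep: "frob_separable F C"
    and c: "p_basis C prime_field B" and A: "p_independent F C A" and F: "is_subfield F" "C \<subseteq> F"
  shows "lin_indep (pth_powers F) (multi_indices (B \<union> A)) pmon"
proof (rule pmon_lin_indep_Un)
  let ?D = "gen_field (pth_powers F \<union> C)"
  have BC: "B \<subseteq> C" using c unfolding p_basis_def p_independent_def by blast
  show "is_subfield ?D" by simp
  show "pth_powers F \<subseteq> ?D" "B \<subseteq> ?D" using gen_field_incl[of "pth_powers F \<union> C"] BC by auto
  have "x \<in> gen_field (pth_powers F \<union> C \<union> (A - {x}))" if "x \<in> C" for x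
    using gen_field_incl[of "pth_powers F \<union> C \<union> (A - {x})"] that by blast
  then show "B \<inter> A = {}"
    using A BC unfolding p_independent_def by blast
  show "lin_indep ?D (multi_indices A) pmon" by (rule p_independent_imp_pmon[OF A])
  have "lin_indep (gen_field (pth_powers C \<union> prime_field)) (multi_indices B) pmon"
    using c unfolding p_basis_def by (intro p_independent_imp_pmon) blast
  then have "lin_indep (pth_powers C) (multi_indices B) pmon"
    by (rule lin_indep_mono) (use gen_field_incl[of "pth_powers C \<union> prime_field"] in auto)
  moreover have "pmon ` multi_indices B \<subseteq> C"
    using pmon_in[OF C] BC by blast
  ultimately show "lin_indep (pth_powers F) (multi_indices B) pmon"
    by (intro frob_separable_swap[OF C sep])
qed

text \<open>\<open>E\<close> has a p-basis that stays p-independent in \<open>F\<close>.\<close>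

lemma frob_separable_if_pmon_lin_indep:
  assumes E: "is_subfield E" and B: "B \<subseteq> E" "E \<subseteq> gen_field (pth_powers E \<union> B)"
    and ind: "lin_indep (pth_powers F) (multi_indices B) pmon" and F: "is_subfield F" "E \<subseteq> F"
  shows "frob_separable F E"
  unfolding frob_separable_def
proof (intro allI impI, elim conjE)
  fix n :: nat and u :: "nat \<Rightarrow> 'a"
  assume uF: "u ` {..<n} \<subseteq> F" and u: "lin_indep E {..<n} u"
  show "lin_indep E {..<n} (\<lambda>i. frob (u i))"
  proof (rule lin_indepI)
    fix S x assume S: "finite S" "S \<subseteq> {..<n}" and x: "\<And>i. i \<in> S \<Longrightarrow> x i \<in> E"
      and 0: "(\<Sum>i\<in>S. x i * frob (u i)) = 0"
    have pE: "is_subfield (pth_powers E)" by (rule pth_powers_subfield[OF E])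
    have "gen_field (pth_powers E \<union> B) = lin_span (pth_powers E) (multi_indices B) pmon"
      by (rule gen_field_eq_pmon_span[OF pE]) (use B(1) in \<open>auto simp: pth_powers_frob\<close>)
    then have "x i \<in> lin_span (pth_powers E) (multi_indices B) pmon" if "i \<in> S" for i
      using x[OF that] B(2) by blast
    then obtain T d where T: "finite T" "T \<subseteq> multi_indices B"
      and d: "\<forall>i\<in>S. \<forall>t\<in>T. d i t \<in> pth_powers E" "\<forall>i\<in>S. x i = (\<Sum>t\<in>T. d i t * pmon t)"
      using lin_span_common_support[OF S(1) subfield_0[OF pE], of x "multi_indices B" pmon] by blast
    have "\<forall>i\<in>S. \<forall>t\<in>T. \<exists>y\<in>E. d i t = frob y" using d(1) unfolding pth_powers_frob by blast
    then obtain y where y: "\<And>i t. i \<in> S \<Longrightarrow> t \<in> T \<Longrightarrow> y i t \<in> E" "\<And>i t. i \<in> S \<Longrightarrow> t \<in> T \<Longrightarrow> d i t = frob (y i t)"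
      by metis
    \<comment> \<open>Expanding the \<open>x i\<close> in p-monomials of \<open>B\<close> turns the
      relation into one over \<open>F^p\<close>, with coefficient \<open>frob (w t)\<close> at the
      monomial \<open>t\<close>; so every \<open>w t\<close> vanishes, and this is a relation among
      the \<open>u i\<close> over \<open>E\<close>.\<close>
    define w where "w t = (\<Sum>i\<in>S. y i t * u i)" for t
    have wF: "w t \<in> F" if "t \<in> T" for t
      unfolding w_def
      by (intro subfield_sum[OF F(1)] subfield_mult[OF F(1)]) (use y(1) that uF S(2) F(2) in blast)+
    have "(\<Sum>t\<in>T. frob (w t) * pmon t) = (\<Sum>t\<in>T. \<Sum>i\<in>S. d i t * pmon t * frob (u i))"
      unfolding w_def frob_sum sum_distrib_right
      by (intro sum.cong refl) (simp add: y(2) frob_mult mult_ac)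
    also have "\<dots> = (\<Sum>i\<in>S. \<Sum>t\<in>T. d i t * pmon t * frob (u i))" by (rule sum.swap)
    also have "\<dots> = (\<Sum>i\<in>S. x i * frob (u i))"
      using d(2) by (intro sum.cong refl) (simp add: sum_distrib_right)
    finally have w0: "(\<Sum>t\<in>T. frob (w t) * pmon t) = 0" using 0 by simp
    have "y i t = 0" if "i \<in> S" "t \<in> T" for i t
    proof -
      have "frob (w t) = 0"
        by (rule lin_indepD[OF ind T _ w0 that(2)]) (use wF in \<open>auto simp: pth_powers_frob\<close>)
      then have "(\<Sum>i\<in>S. y i t * u i) = 0" unfolding w_def by simp
      then show ?thesis
        by (rule lin_indepD[OF u S _ _ that(1), rotated]) (use y(1) that in auto)
    qed
    then have "d i t = 0" if "i \<in> S" "t \<in> T" for i t using that y(2) by simp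
    then show "\<forall>i\<in>S. x i = 0" using d(2) by simp
  qed
qed


section \<open>Stabilization of finitely generated extensions along a chain of fields\<close>

lemma gen_field_fractions:
  assumes R: "1 \<in> R" "\<And>x y. x \<in> R \<Longrightarrow> y \<in> R \<Longrightarrow> x + y \<in> R" "\<And>x y. x \<in> R \<Longrightarrow> y \<in> R \<Longrightarrow> x * y \<in> R"
    "\<And>x. x \<in> R \<Longrightarrow> - x \<in> R" and H: "H \<subseteq> R"
    and z: "z \<in> gen_field H"
  shows "\<exists>x\<in>R. \<exists>y\<in>R. y \<noteq> 0 \<and> z = x / (y :: 'a::field)"
proof -
  let ?Q = "{x / y | x y. x \<in> R \<and> y \<in> R \<and> y \<noteq> 0}"
  have QI: "x / y \<in> ?Q" if "x \<in> R" "y \<in> R" "y \<noteq> 0" for x y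
    using that by blast
  have RQ: "x \<in> ?Q" if "x \<in> R" for x
    using QI[OF that R(1)] by simp
  have 0: "0 \<in> R" using R(2)[OF R(1) R(4)[OF R(1)]] by simp
  have "is_subfield ?Q"
    unfolding is_subfield_iff
  proof (intro conjI ballI)
    show "0 \<in> ?Q" "1 \<in> ?Q" using RQ[OF 0] RQ[OF R(1)] by auto
    fix a assume "a \<in> ?Q"
    then obtain x y where a: "a = x / y" "x \<in> R" "y \<in> R" "y \<noteq> 0" by blast
    have "- a = (- x) / y" using a(1) by simp
    then show "- a \<in> ?Q" using QI[OF R(4)[OF a(2)] a(3,4)] by metis
    show "inverse a \<in> ?Q"
    proof (cases "x = 0")
      case True
      then show ?thesis using a RQ[OF 0] by simp
    next
      case False
      have "inverse a = y / x" using a(1) by simp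
      then show ?thesis using QI[OF a(3,2) False] by metis
    qed
    fix b assume "b \<in> ?Q"
    then obtain x' y' where b: "b = x' / y'" "x' \<in> R" "y' \<in> R" "y' \<noteq> 0" by blast
    have yy: "y * y' \<in> R" "y * y' \<noteq> 0" using a b R(3) by auto
    have "a * b = (x * x') / (y * y')" using a(1) b(1) by simp
    then show "a * b \<in> ?Q" using QI[OF R(3)[OF a(2) b(2)] yy] by metis
    have "a + b = (x * y' + x' * y) / (y * y')" using a b by (simp add: field_simps)
    then show "a + b \<in> ?Q" using QI[OF R(2)[OF R(3)[OF a(2) b(3)] R(3)[OF b(2) a(3)]] yy] by metis
  qed
  moreover have "H \<subseteq> ?Q" using RQ H by blast
  ultimately have "gen_field H \<subseteq> ?Q" by (rule gen_field_least)
  then have "z \<in> ?Q" using z by (rule subsetD)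
  then obtain x y where "z = x / y" "x \<in> R" "y \<in> R" "y \<noteq> 0" by (elim CollectE exE conjE)
  then show ?thesis by (intro bexI conjI)
qed

lemma common_denominator:
  assumes R: "1 \<in> R" "\<And>x y. x \<in> R \<Longrightarrow> y \<in> R \<Longrightarrow> x * y \<in> R"
    and "finite S" "\<And>i. i \<in> S \<Longrightarrow> \<exists>x\<in>R. \<exists>y\<in>R. y \<noteq> 0 \<and> u i = x / (y :: 'a::field)"
  shows "\<exists>s\<in>R. s \<noteq> 0 \<and> (\<forall>i\<in>S. s * u i \<in> R)"
  using assms(3,4)
proof (induction S rule: finite_induct)
  case empty
  show ?case using R(1) by (intro bexI[of _ 1]) auto
next
  case (insert i S)
  then obtain s where s: "s \<in> R" "s \<noteq> 0" "\<forall>i\<in>S. s * u i \<in> R" by auto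
  obtain x y where xy: "x \<in> R" "y \<in> R" "y \<noteq> 0" "u i = x / y" using insert.prems[of i] by auto
  have "s * y * u j \<in> R" if "j \<in> insert i S" for j
  proof (cases "j = i")
    case True
    then have "s * y * u j = s * x" using xy by simp
    then show ?thesis using R(2)[OF s(1) xy(1)] by metis
  next
    case False
    then have "s * u j \<in> R" using s(3) that by simp
    moreover have "s * y * u j = (s * u j) * y" by simp
    ultimately show ?thesis using R(2)[OF _ xy(2)] by metis
  qed
  then show ?case using s xy R(2) by (intro bexI[of _ "s * y"]) auto
qed

text \<open>Induction on the length: the tails of \<open>M\<close> are dominated from below by
  finitely many tails, coming from a finite \<open>B'\<close>. A list whose head is at least
  \<open>N\<close>, the largest head in \<open>B'\<close>, lies above an element of
  \<open>B'\<close>; each of the finitely many smaller heads \<open>n\<close> receives its own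
  finite set \<open>C n\<close>.\<close>

lemma dickson:
  "\<exists>B\<subseteq>M. finite B \<and> (\<forall>\<alpha>\<in>M. length \<alpha> = k \<longrightarrow> (\<exists>\<beta>\<in>B. list_all2 (\<le>) \<beta> (\<alpha> :: nat list)))"
proof (induction k arbitrary: M)
  case 0
  show ?case
    by (rule exI[of _ "M \<inter> {[]}"]) auto
next
  case (Suc k)
  obtain B where B: "B \<subseteq> tl ` (M - {[]})" "finite B"
    "\<forall>\<alpha>\<in>tl ` (M - {[]}). length \<alpha> = k \<longrightarrow> (\<exists>\<beta>\<in>B. list_all2 (\<le>) \<beta> \<alpha>)"
    using Suc.IH by blast
  obtain B' where B': "B' \<subseteq> M - {[]}" "finite B'" "B = tl ` B'"
    using finite_subset_image[OF B(2,1)] by blast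
  have "\<forall>n. \<exists>C. C \<subseteq> {\<alpha>. n # \<alpha> \<in> M} \<and> finite C \<and>
      (\<forall>\<alpha>\<in>{\<alpha>. n # \<alpha> \<in> M}. length \<alpha> = k \<longrightarrow> (\<exists>\<beta>\<in>C. list_all2 (\<le>) \<beta> \<alpha>))"
    using Suc.IH by blast
  then obtain C where C: "\<And>n. C n \<subseteq> {\<alpha>. n # \<alpha> \<in> M}" "\<And>n. finite (C n)"
    "\<And>n \<alpha>. n # \<alpha> \<in> M \<Longrightarrow> length \<alpha> = k \<Longrightarrow> \<exists>\<beta>\<in>C n. list_all2 (\<le>) \<beta> \<alpha>"
    by (metis mem_Collect_eq)
  define N where "N = Max (insert 0 (hd ` B'))"
  let ?B = "B' \<union> (\<Union>n<N. (#) n ` C n)"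
  show ?case
  proof (intro exI[of _ ?B] conjI ballI impI)
    show "?B \<subseteq> M" using B'(1) C(1) by blast
    show "finite ?B" using B'(2) C(2) by blast
    fix \<alpha> assume \<alpha>: "\<alpha> \<in> M" "length \<alpha> = Suc k"
    then obtain a \<alpha>' where a: "\<alpha> = a # \<alpha>'" "length \<alpha>' = k" by (cases \<alpha>) auto
    show "\<exists>\<beta>\<in>?B. list_all2 (\<le>) \<beta> \<alpha>"
    proof (cases "a < N")
      case True
      obtain \<beta> where "\<beta> \<in> C a" "list_all2 (\<le>) \<beta> \<alpha>'" using C(3)[of a \<alpha>'] \<alpha> a by blast
      then show ?thesis using True a by (intro bexI[of _ "a # \<beta>"]) auto
    next
      case False
      have "\<alpha>' \<in> tl ` (M - {[]})" using \<alpha> a by force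
      then obtain \<beta> where \<beta>: "\<beta> \<in> B" "list_all2 (\<le>) \<beta> \<alpha>'" using B(3) a by blast
      then obtain b where b: "b \<in> B'" "\<beta> = tl b" using B'(3) by blast
      then have "hd b \<le> N" unfolding N_def using B'(2) by (intro Max_ge) auto
      moreover have "b = hd b # \<beta>" using b B'(1) by (cases b) auto
      ultimately have "list_all2 (\<le>) b \<alpha>" using False \<beta> a by (metis list_all2_Cons le_trans not_less)
      then show ?thesis using b by blast
    qed
  qed
qed

text \<open>Exponents are lists here, since the generators form a fixed sequence and exponent
  vectors have to be compared in a monomial order. When the lengths agree, the last clause is
  reached only by empty lists.\<close>

fun list_mon :: "'a::field list \<Rightarrow> nat list \<Rightarrow> 'a" where
  "list_mon (x # xs) (n # \<alpha>) = x ^ n * list_mon xs \<alpha>"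
| "list_mon _ _ = 1"

lemma list_mon_add:
  "length \<alpha> = length xs \<Longrightarrow> length \<beta> = length xs \<Longrightarrow>
     list_mon xs (map2 (+) \<alpha> \<beta>) = list_mon xs \<alpha> * list_mon xs \<beta>"
  by (induction xs \<alpha> arbitrary: \<beta> rule: list_mon.induct) (auto simp: power_add length_Suc_conv mult_ac)

text \<open>On lists of one length \<open>lenlex\<close> is the lexicographic order, so this is the
  compatibility of a monomial order with multiplication.\<close>

lemma lenlex_add:
  "(\<alpha>, \<beta>) \<in> lenlex less_than \<Longrightarrow> length \<alpha> = length \<gamma> \<Longrightarrow> length \<beta> = length \<gamma> \<Longrightarrow>
     (map2 (+) \<alpha> \<gamma>, map2 (+) \<beta> \<gamma>) \<in> lenlex less_than"
proof (induction \<gamma> arbitrary: \<alpha> \<beta>)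
  case (Cons c \<gamma>)
  then obtain a \<alpha>' b \<beta>' where "\<alpha> = a # \<alpha>'" "\<beta> = b # \<beta>'" "length \<alpha>' = length \<gamma>" "length \<beta>' = length \<gamma>"
    by (metis length_Suc_conv)
  then show ?case using Cons.IH[of \<alpha>' \<beta>'] Cons.prems by (auto simp: Cons_lenlex_iff)
qed simp

lemma finite_lenlex_max:
  assumes "finite S" "S \<noteq> {}"
  shows "\<exists>m\<in>S. \<forall>\<beta>\<in>S. \<beta> = m \<or> (\<beta>, m) \<in> lenlex (less_than :: nat rel)"
  using assms
proof (induction S rule: finite_ne_induct)
  case (insert x S)
  then obtain m where m: "m \<in> S" "\<forall>\<beta>\<in>S. \<beta> = m \<or> (\<beta>, m) \<in> lenlex less_than" by blast
  have tot: "total (lenlex (less_than :: nat rel))" and tr: "trans (lenlex (less_than :: nat rel))"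
    by (auto intro: total_lenlex lenlex_transI)
  consider "x = m" | "(x, m) \<in> lenlex less_than" | "(m, x) \<in> lenlex less_than"
    using tot unfolding total_on_def by blast
  then show ?case
  proof cases
    case 3
    then have "\<beta> = x \<or> (\<beta>, x) \<in> lenlex less_than" if "\<beta> \<in> insert x S" for \<beta>
      using m(2) that transD[OF tr, of \<beta> m x] by auto
    then show ?thesis by blast
  qed (use m in blast)+
qed simp

text \<open>
  The monomials in \<open>xs\<close> that are not leading monomials of a relation over \<open>\<Union>n. E n\<close> form, from some
  stage on, a basis of \<open>E n[xs]\<close> over \<open>E n\<close>, because by Dickson's lemma the leading monomials are
  detected at a finite stage. Hence \<open>E n(xs)\<close> and \<open>\<Union>n. E n\<close> are linearly disjoint over \<open>E n\<close>, and
  separability descends.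
\<close>

lemma frob_separable_stage:
  fixes E :: "nat \<Rightarrow> 'a::field set"
  assumes E: "\<And>n. is_subfield (E n)" "\<And>n. E n \<subseteq> E (Suc n)"
    and L: "L = (\<Union>n. E n)" "is_subfield L" and sep: "frob_separable UNIV L"
  shows "\<exists>N. \<forall>n\<ge>N. frob_separable (gen_field (E n \<union> set xs)) (E n)"
proof -
  let ?k = "length xs"
  let ?lt = "lenlex (less_than :: nat rel)"
  have mono: "E m \<subseteq> E n" if "m \<le> n" for m n
    using lift_Suc_mono_le[of E, OF E(2) that] .
  \<comment> \<open>The exponents of leading monomials of relations over \<open>E n\<close>: such a
    monomial is a combination of smaller ones.\<close>
  define M where "M n = {\<alpha>. length \<alpha> = ?k \<and>
      list_mon xs \<alpha> \<in> lin_span (E n) {\<beta>. length \<beta> = ?k \<and> (\<beta>, \<alpha>) \<in> ?lt} (list_mon xs)}" for n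
  have M_mono: "M m \<subseteq> M n" if "m \<le> n" for m n
    unfolding M_def using lin_span_mono[OF mono[OF that]] by blast
  \<comment> \<open>A relation may be multiplied by a monomial, so these exponents form an ideal, as
    Dickson's lemma requires.\<close>
  have M_up: "map2 (+) \<alpha> \<gamma> \<in> M n" if \<alpha>: "\<alpha> \<in> M n" and \<gamma>: "length \<gamma> = ?k" for \<alpha> \<gamma> n
  proof -
    let ?W = "lin_span (E n) {\<beta>. length \<beta> = ?k \<and> (\<beta>, map2 (+) \<alpha> \<gamma>) \<in> ?lt} (list_mon xs)"
    have len: "length \<alpha> = ?k" using \<alpha> unfolding M_def by blast
    have "lin_span (E n) {\<beta>. length \<beta> = ?k \<and> (\<beta>, \<alpha>) \<in> ?lt} (list_mon xs) \<subseteq> {x. x * list_mon xs \<gamma> \<in> ?W}"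
    proof (rule lin_span_closed_subset)
      fix \<beta> assume "\<beta> \<in> {\<beta>. length \<beta> = ?k \<and> (\<beta>, \<alpha>) \<in> ?lt}"
      then have \<beta>: "length \<beta> = ?k" "(\<beta>, \<alpha>) \<in> ?lt" by auto
      have "list_mon xs (map2 (+) \<beta> \<gamma>) \<in> ?W"
        by (rule lin_span_base[OF E(1)]) (use lenlex_add[OF \<beta>(2)] \<beta> \<gamma> len in auto)
      then show "list_mon xs \<beta> \<in> {x. x * list_mon xs \<gamma> \<in> ?W}"
        using list_mon_add[OF \<beta>(1) \<gamma>] by simp
    qed (auto simp: lin_span_0 ring_distribs mult.assoc intro: lin_span_add[OF E(1)] lin_span_scale[OF E(1)])
    then have "list_mon xs (map2 (+) \<alpha> \<gamma>) \<in> ?W"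
      using \<alpha> list_mon_add[OF len \<gamma>] unfolding M_def by auto
    then show ?thesis unfolding M_def using len \<gamma> by simp
  qed
  define MM where "MM = (\<Union>n. M n)"
  obtain B where B: "B \<subseteq> MM" "finite B" "\<forall>\<alpha>\<in>MM. length \<alpha> = ?k \<longrightarrow> (\<exists>\<beta>\<in>B. list_all2 (\<le>) \<beta> \<alpha>)"
    using dickson by blast
  have "\<exists>N. B \<subseteq> M N"
    using B(2,1)
  proof (induction B rule: finite_induct)
    case (insert b B)
    then obtain N N' where "B \<subseteq> M N" "b \<in> M N'" unfolding MM_def by blast
    then have "insert b B \<subseteq> M (max N N')"
      using M_mono[of N "max N N'"] M_mono[of N' "max N N'"] by auto
    then show ?case by blast
  qed simp
  then obtain N where N: "B \<subseteq> M N" by blast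
  have MM_N: "MM \<subseteq> M N"
  proof
    fix \<alpha> assume "\<alpha> \<in> MM"
    then have len: "length \<alpha> = ?k" unfolding MM_def M_def by blast
    then obtain \<beta> where \<beta>: "\<beta> \<in> B" "list_all2 (\<le>) \<beta> \<alpha>" using B(3) \<open>\<alpha> \<in> MM\<close> by blast
    have "length \<beta> = length \<alpha>" using \<beta>(2) by (rule list_all2_lengthD)
    moreover have "\<alpha> = map2 (+) \<beta> (map2 (-) \<alpha> \<beta>)"
      using \<beta>(2) by (induction rule: list_all2_induct) auto
    ultimately show "\<alpha> \<in> M N" using M_up[of \<beta> N "map2 (-) \<alpha> \<beta>"] \<beta>(1) N len by auto
  qed
  \<comment> \<open>The standard monomials, as for a Groebner basis. They are defined from the union
    \<open>MM\<close> and are therefore the same at every stage.\<close>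
  define St where "St = {\<beta>. length \<beta> = ?k \<and> \<beta> \<notin> MM}"
  \<comment> \<open>Well-founded rewriting: from stage \<open>N\<close> on, an exponent in
    \<open>MM\<close> can be reduced with coefficients from \<open>E n\<close> itself.\<close>
  have span: "list_mon xs \<alpha> \<in> lin_span (E n) St (list_mon xs)" if "N \<le> n" "length \<alpha> = ?k" for n \<alpha>
    using that(2)
  proof (induction \<alpha> rule: wf_induct_rule[OF wf_lenlex[OF wf_less_than]])
    case (1 \<alpha>)
    show ?case
    proof (cases "\<alpha> \<in> MM")
      case True
      then have "\<alpha> \<in> M n" using MM_N M_mono[OF that(1)] by blast
      moreover have "lin_span (E n) {\<beta>. length \<beta> = ?k \<and> (\<beta>, \<alpha>) \<in> ?lt} (list_mon xs) \<subseteq> lin_span (E n) St (list_mon xs)"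
        by (rule lin_span_trans[OF E(1)]) (use 1 in auto)
      ultimately show ?thesis unfolding M_def by blast
    next
      case False
      then show ?thesis using 1 by (intro lin_span_base[OF E(1)]) (simp add: St_def)
    qed
  qed
  \<comment> \<open>In a nontrivial relation over \<open>L\<close> the largest exponent with nonzero
    coefficient would be a leading exponent over any stage that contains all coefficients, so it
    would lie in \<open>MM\<close>.\<close>
  have ind: "lin_indep L St (list_mon xs)"
  proof (rule lin_indepI, rule ccontr)
    fix T c
    assume T: "finite T" "T \<subseteq> St" and c: "\<And>i. i \<in> T \<Longrightarrow> c i \<in> L"
      and 0: "(\<Sum>i\<in>T. c i * list_mon xs i) = 0" and nz: "\<not> (\<forall>i\<in>T. c i = 0)"
    let ?T = "{i\<in>T. c i \<noteq> 0}"
    obtain m where m: "m \<in> ?T" "\<forall>\<beta>\<in>?T. \<beta> = m \<or> (\<beta>, m) \<in> ?lt"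
      using finite_lenlex_max[of ?T] T(1) nz by auto
    have "(\<Sum>i\<in>?T. c i * list_mon xs i) = 0"
      using 0 sum.mono_neutral_left[OF T(1), of ?T "\<lambda>i. c i * list_mon xs i"] by auto
    then have "c m * list_mon xs m + (\<Sum>i\<in>?T - {m}. c i * list_mon xs i) = 0"
      using sum.remove[of ?T m "\<lambda>i. c i * list_mon xs i"] T(1) m(1) by simp
    then have eq: "list_mon xs m = (\<Sum>i\<in>?T - {m}. (- c i / c m) * list_mon xs i)"
      using m(1) by (simp add: sum_negf sum_divide_distrib[symmetric] field_simps add_eq_0_iff)
    have "\<exists>n. \<forall>i\<in>T. c i \<in> E n"
      using T(1) c
    proof (induction T rule: finite_induct)
      case (insert j T)
      then obtain n where n: "\<forall>i\<in>T. c i \<in> E n" by auto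
      obtain n' where n': "c j \<in> E n'" using insert.prems[of j] L(1) by auto
      have "\<forall>i\<in>insert j T. c i \<in> E (max n n')"
        using n n' mono[of n "max n n'"] mono[of n' "max n n'"] by auto
      then show ?case by blast
    qed simp
    then obtain n where n: "\<And>i. i \<in> T \<Longrightarrow> c i \<in> E n" by blast
    have "list_mon xs m \<in> lin_span (E n) {\<beta>. length \<beta> = ?k \<and> (\<beta>, m) \<in> ?lt} (list_mon xs)"
      unfolding eq
    proof (rule lin_span_sumI)
      show "?T - {m} \<subseteq> {\<beta>. length \<beta> = ?k \<and> (\<beta>, m) \<in> ?lt}"
        using m(2) T(2) unfolding St_def by blast
      show "- c i / c m \<in> E n" if "i \<in> ?T - {m}" for i
        using that m(1) n by (intro subfield_divide[OF E(1)] subfield_uminus[OF E(1)]) auto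
    qed (use T(1) in simp)
    then have "m \<in> MM" using m(1) T(2) unfolding MM_def M_def St_def by blast
    then show False using m(1) T(2) unfolding St_def by blast
  qed
  have "frob_separable (gen_field (E n \<union> set xs)) (E n)" if n: "N \<le> n" for n
    unfolding frob_separable_def
  proof (intro allI impI, elim conjE)
    fix q :: nat and u :: "nat \<Rightarrow> 'a"
    assume uF: "u ` {..<q} \<subseteq> gen_field (E n \<union> set xs)" and u: "lin_indep (E n) {..<q} u"
    let ?Mo = "{\<alpha> :: nat list. length \<alpha> = ?k}"
    \<comment> \<open>The ring \<open>E n [xs]\<close>, whose fractions are the elements of the
      field generated by \<open>xs\<close> over \<open>E n\<close>.\<close>
    let ?R = "lin_span (E n) ?Mo (list_mon xs)"
    have R_mult: "x * y \<in> ?R" if "x \<in> ?R" "y \<in> ?R" for x y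
    proof (rule lin_span_mult[OF E(1) _ that])
      show "list_mon xs \<alpha> * list_mon xs \<beta> \<in> ?R" if "\<alpha> \<in> ?Mo" "\<beta> \<in> ?Mo" for \<alpha> \<beta>
        using that lin_span_base[OF E(1)[of n], of "map2 (+) \<alpha> \<beta>" ?Mo "list_mon xs"]
        by (simp add: list_mon_add)
    qed
    have mon0: "list_mon ys (replicate (length ys) 0) = 1" for ys :: "'a list"
      by (induction ys) auto
    have ER: "e \<in> ?R" if "e \<in> E n" for e
      using lin_span_scale[OF E(1) lin_span_base[OF E(1)] that, of "replicate ?k 0" ?Mo "list_mon xs"] mon0[of xs]
      by simp
    have xR: "x \<in> ?R" if "x \<in> set xs" for x
    proof -
      have "\<exists>\<alpha>. length \<alpha> = length ys \<and> list_mon ys \<alpha> = x" if "x \<in> set ys" for ys :: "'a list"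
        using that
      proof (induction ys)
        case (Cons y ys)
        show ?case
        proof (cases "x = y")
          case True
          then show ?thesis by (intro exI[of _ "1 # replicate (length ys) 0"]) (simp add: mon0)
        next
          case False
          then obtain \<alpha> where "length \<alpha> = length ys" "list_mon ys \<alpha> = x" using Cons by auto
          then show ?thesis by (intro exI[of _ "0 # \<alpha>"]) simp
        qed
      qed simp
      then obtain \<alpha> where "length \<alpha> = ?k" "list_mon xs \<alpha> = x" using \<open>x \<in> set xs\<close> by blast
      then show ?thesis using lin_span_base[OF E(1), of \<alpha> ?Mo "list_mon xs"] by simp
    qed
    have "1 \<in> ?R" "-1 \<in> ?R"
      using subfield_1[OF E(1)] by (auto intro!: ER subfield_uminus[OF E(1)])
    then have frac: "\<exists>x\<in>?R. \<exists>y\<in>?R. y \<noteq> 0 \<and> z = x / y" if "z \<in> gen_field (E n \<union> set xs)" for z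
      using R_mult[of "-1"] ER xR that
      by (intro gen_field_fractions[of ?R "E n \<union> set xs"] lin_span_add[OF E(1)] R_mult) auto
    have u_frac: "\<exists>x\<in>?R. \<exists>y\<in>?R. y \<noteq> 0 \<and> u i = x / y" if "i \<in> {..<q}" for i
      by (rule frac) (use uF that in blast)
    have "\<exists>s\<in>?R. s \<noteq> 0 \<and> (\<forall>i\<in>{..<q}. s * u i \<in> ?R)"
      by (rule common_denominator[OF \<open>1 \<in> ?R\<close> R_mult finite_lessThan u_frac])
    then obtain s where s: "s \<in> ?R" "s \<noteq> 0" "\<forall>i\<in>{..<q}. s * u i \<in> ?R" by blast
    have "?R \<subseteq> lin_span (E n) St (list_mon xs)"
      using span[OF n] by (intro lin_span_trans[OF E(1)]) auto
    then have "s * u i \<in> lin_span (E n) St (list_mon xs)" if "i \<in> {..<q}" for i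
      using s(3) that by blast
    then obtain T e where T: "finite T" "T \<subseteq> St" and e: "\<forall>i\<in>{..<q}. \<forall>t\<in>T. e i t \<in> E n"
      "\<forall>i\<in>{..<q}. s * u i = (\<Sum>t\<in>T. e i t * list_mon xs t)"
      using lin_span_common_support[OF finite_lessThan subfield_0[OF E(1)], of q "\<lambda>i. s * u i" n St "list_mon xs"] by blast
    have comb: "s * (\<Sum>i<q. x i * u i) = (\<Sum>t\<in>T. (\<Sum>i<q. x i * e i t) * list_mon xs t)" for x
    proof -
      have "s * (\<Sum>i<q. x i * u i) = (\<Sum>i<q. x i * (s * u i))"
        by (simp add: sum_distrib_left mult.left_commute)
      also have "\<dots> = (\<Sum>i<q. x i * (\<Sum>t\<in>T. e i t * list_mon xs t))"
        using e(2) by (intro sum.cong refl) simp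
      also have "\<dots> = (\<Sum>i<q. \<Sum>t\<in>T. x i * e i t * list_mon xs t)"
        by (simp add: sum_distrib_left mult.assoc)
      also have "\<dots> = (\<Sum>t\<in>T. \<Sum>i<q. x i * e i t * list_mon xs t)" by (rule sum.swap)
      finally show ?thesis by (simp add: sum_distrib_right)
    qed
    have EL: "E n \<subseteq> L" using L(1) by blast
    \<comment> \<open>Independence of \<open>u\<close> over \<open>E n\<close> means independence of
      the rows \<open>e i\<close> of coordinates in the standard monomials. This extends from
      \<open>E n\<close> to \<open>L\<close>, where the standard monomials remain
      independent.\<close>
    have rows: "\<forall>i\<in>{..<q}. c i = 0" if c: "\<forall>i\<in>{..<q}. c i \<in> E n" "\<forall>t\<in>T. (\<Sum>i<q. c i * e i t) = 0" for c
    proof -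
      have "(\<Sum>i<q. c i * u i) = 0" using comb[of c] c(2) s(2) by simp
      then show ?thesis using lin_indepD[OF u finite_lessThan subset_refl, of c] c(1) by blast
    qed
    have "lin_indep L {..<q} u"
      unfolding lin_indep_finite_iff[OF finite_lessThan subfield_0[OF L(2)]]
    proof (intro allI impI, elim conjE)
      fix x assume x: "\<forall>i\<in>{..<q}. x i \<in> L" "(\<Sum>i<q. x i * u i) = 0"
      have "(\<Sum>t\<in>T. (\<Sum>i<q. x i * e i t) * list_mon xs t) = 0" using comb[of x] x(2) by simp
      then have "(\<Sum>i<q. x i * e i t) = 0" if "t \<in> T" for t
        by (rule lin_indepD[OF ind T _ _ that, rotated])
          (use x(1) e(1) EL in \<open>auto intro!: subfield_sum[OF L(2)] subfield_mult[OF L(2)]\<close>)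
      then show "\<forall>i\<in>{..<q}. x i = 0"
        by (intro rows_indep_extend[OF E(1) L(2) EL finite_lessThan, of q T e x]) (use e(1) rows x(1) in blast)+
    qed
    then have "lin_indep L {..<q} (\<lambda>i. frob (u i))"
      by (rule frob_separableD[OF sep subset_UNIV])
    then show "lin_indep (E n) {..<q} (\<lambda>i. frob (u i))"
      using EL by (rule lin_indep_mono)
  qed
  then show ?thesis by blast
qed


section \<open>Well-orders\<close>

text \<open>Least elements of pairs yield totality and least elements of triples yield transitivity,
  so only these three conditions have to be checked.\<close>

lemma Well_orderI:
  assumes refl: "\<And>x. x \<in> Field r \<Longrightarrow> (x, x) \<in> r"
    and antisym: "\<And>x y. (x, y) \<in> r \<Longrightarrow> (y, x) \<in> r \<Longrightarrow> x = y"
    and least: "\<And>Q. Q \<subseteq> Field r \<Longrightarrow> Q \<noteq> {} \<Longrightarrow> \<exists>m\<in>Q. \<forall>y\<in>Q. (m, y) \<in> r"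
  shows "Well_order r"
proof -
  have tot: "(x, y) \<in> r \<or> (y, x) \<in> r" if "x \<in> Field r" "y \<in> Field r" for x y
    using least[of "{x, y}"] that by auto
  have "(x, z) \<in> r" if xy: "(x, y) \<in> r" and yz: "(y, z) \<in> r" for x y z
  proof -
    have "{x, y, z} \<subseteq> Field r" using xy yz by (auto simp: Field_def)
    then obtain m where "m \<in> {x, y, z}" "\<forall>w\<in>{x, y, z}. (m, w) \<in> r" using least[of "{x, y, z}"] by blast
    then consider "(x, z) \<in> r" | "m = y" "(y, x) \<in> r" | "m = z" "(z, y) \<in> r" by blast
    then show ?thesis
    proof cases
      case 2
      then show ?thesis using antisym[OF xy 2(2)] yz by simp
    next
      case 3
      then show ?thesis using antisym[OF yz 3(2)] xy by simp
    qed
  qed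
  then have "trans r" by (rule transI)
  moreover have "wf (r - Id)"
    unfolding wf_eq_minimal
  proof (intro allI impI)
    fix Q :: "'a set" and x assume "x \<in> Q"
    show "\<exists>z\<in>Q. \<forall>y. (y, z) \<in> r - Id \<longrightarrow> y \<notin> Q"
    proof (cases "Q \<inter> Field r = {}")
      case True
      then show ?thesis using \<open>x \<in> Q\<close> by (intro bexI[of _ x]) (auto simp: Field_def)
    next
      case False
      then obtain m where m: "m \<in> Q \<inter> Field r" "\<forall>y\<in>Q \<inter> Field r. (m, y) \<in> r"
        using least[of "Q \<inter> Field r"] by blast
      have "y \<notin> Q" if "(y, m) \<in> r - Id" for y
      proof
        assume "y \<in> Q"
        then have "(m, y) \<in> r" using m(2) that by (auto simp: Field_def)
        then show False using antisym[of y m] that by auto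
      qed
      then show ?thesis using m(1) by blast
    qed
  qed
  moreover have "r \<subseteq> Field r \<times> Field r" by (auto simp: Field_def)
  moreover have "refl_on (Field r) r" unfolding refl_on_def using refl by blast
  moreover have "antisym r" by (rule antisymI) (rule antisym)
  moreover have "total_on (Field r) r" unfolding total_on_def using tot by blast
  ultimately show ?thesis unfolding order_on_defs by (intro conjI)
qed

lemma
  assumes "Well_order r"
  shows Well_order_refl: "x \<in> Field r \<Longrightarrow> (x, x) \<in> r"
    and Well_order_antisym: "(x, y) \<in> r \<Longrightarrow> (y, x) \<in> r \<Longrightarrow> x = y"
    and Well_order_trans: "(x, y) \<in> r \<Longrightarrow> (y, z) \<in> r \<Longrightarrow> (x, z) \<in> r"
    and Well_order_total: "x \<in> Field r \<Longrightarrow> y \<in> Field r \<Longrightarrow> (x, y) \<in> r \<or> (y, x) \<in> r"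
    and Well_order_wf: "wf (r - Id)"
proof -
  have *: "refl_on (Field r) r" "trans r" "antisym r" "total_on (Field r) r" "wf (r - Id)"
    using assms unfolding order_on_defs by simp_all
  show "x \<in> Field r \<Longrightarrow> (x, x) \<in> r" using *(1) unfolding refl_on_def by blast
  show "(x, y) \<in> r \<Longrightarrow> (y, x) \<in> r \<Longrightarrow> x = y" using *(3) by (rule antisymD)
  show "(x, y) \<in> r \<Longrightarrow> (y, z) \<in> r \<Longrightarrow> (x, z) \<in> r" using *(2) by (rule transD)
  show "x \<in> Field r \<Longrightarrow> y \<in> Field r \<Longrightarrow> (x, y) \<in> r \<or> (y, x) \<in> r"
    using *(1,4) unfolding refl_on_def total_on_def by (cases "x = y") auto
qed (use assms in \<open>simp add: order_on_defs\<close>)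

lemma Well_order_least:
  assumes r: "Well_order r" and Q: "Q \<subseteq> Field r" "Q \<noteq> {}"
  shows "\<exists>m\<in>Q. \<forall>y\<in>Q. (m, y) \<in> r"
proof -
  obtain m where m: "m \<in> Q" "\<And>y. (y, m) \<in> r - Id \<Longrightarrow> y \<notin> Q"
    using wfE_min'[OF Well_order_wf[OF r] Q(2)] by blast
  have "(m, y) \<in> r" if "y \<in> Q" for y
    using m(2)[of y] that m(1) Q(1) Well_order_total[OF r, of m y] Well_order_refl[OF r, of m] by blast
  then show ?thesis using m(1) by blast
qed

lemma Well_order_finite_greatest:
  assumes r: "Well_order r" and "finite Q" "Q \<noteq> {}" "Q \<subseteq> Field r"
  shows "\<exists>m\<in>Q. \<forall>y\<in>Q. (y, m) \<in> r"
  using assms(2-4)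
proof (induction Q rule: finite_ne_induct)
  case (singleton x)
  then show ?case using Well_order_refl[OF r] by simp
next
  case (insert x Q)
  then obtain m where m: "m \<in> Q" "\<forall>y\<in>Q. (y, m) \<in> r" by auto
  have x: "x \<in> Field r" "m \<in> Field r" using insert.prems m(1) by auto
  show ?case
  proof (cases "(x, m) \<in> r")
    case True
    then show ?thesis using m by blast
  next
    case False
    then have "(m, x) \<in> r" using Well_order_total[OF r] x by blast
    then have "(y, x) \<in> r" if "y \<in> insert x Q" for y
      using that m(2) Well_order_trans[OF r, of y m x] Well_order_refl[OF r x(1)] by blast
    then show ?thesis by blast
  qed
qed

lemma Field_Restr_Well_order: "Well_order r \<Longrightarrow> A \<subseteq> Field r \<Longrightarrow> Field (Restr r A) = A"
  using Well_order_refl[of r] FieldI1[of _ _ "Restr r A"] unfolding Field_def[of "Restr r A"] by blast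

lemma
  assumes r: "Well_order r" and s: "Well_order s"
  shows Field_order_append: "Field (order_append r s) = Field r \<union> Field s"
    and Well_order_order_append: "Well_order (order_append r s)"
proof -
  have iff: "(x, y) \<in> order_append r s \<longleftrightarrow> (x, y) \<in> r \<or> x \<in> Field r \<and> y \<in> Field s - Field r \<or>
      (x, y) \<in> s \<and> x \<in> Field s - Field r \<and> y \<in> Field s - Field r" for x y
    unfolding order_append_def by blast
  show F: "Field (order_append r s) = Field r \<union> Field s"
  proof
    show "Field (order_append r s) \<subseteq> Field r \<union> Field s"
      unfolding Field_def[of "order_append r s"] Domain_unfold Range_iff using iff
      by (auto simp: Field_def)
    show "Field r \<union> Field s \<subseteq> Field (order_append r s)"
    proof
      fix x assume "x \<in> Field r \<union> Field s"
      then have "(x, x) \<in> order_append r s"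
        using iff[of x x] Well_order_refl[OF r, of x] Well_order_refl[OF s, of x] by blast
      then show "x \<in> Field (order_append r s)" by (auto simp: Field_def)
    qed
  qed
  show "Well_order (order_append r s)"
  proof (rule Well_orderI)
    fix x assume "x \<in> Field (order_append r s)"
    then show "(x, x) \<in> order_append r s"
      unfolding F using iff[of x x] Well_order_refl[OF r, of x] Well_order_refl[OF s, of x] by blast
  next
    fix x y assume "(x, y) \<in> order_append r s" "(y, x) \<in> order_append r s"
    then show "x = y"
      unfolding iff using Well_order_antisym[OF r, of x y] Well_order_antisym[OF s, of x y] FieldI1[of x y r] FieldI2[of x y r]
        FieldI1[of y x r] FieldI2[of y x r] by blast
  next
    fix Q assume Q: "Q \<subseteq> Field (order_append r s)" "Q \<noteq> {}"
    show "\<exists>m\<in>Q. \<forall>y\<in>Q. (m, y) \<in> order_append r s"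
    proof (cases "Q \<inter> Field r = {}")
      case True
      then have "Q \<subseteq> Field s - Field r" using Q(1) unfolding F by blast
      moreover from this obtain m where "m \<in> Q" "\<forall>y\<in>Q. (m, y) \<in> s" using Well_order_least[OF s _ Q(2)] by blast
      ultimately have "\<forall>y\<in>Q. (m, y) \<in> order_append r s" unfolding iff by blast
      then show ?thesis using \<open>m \<in> Q\<close> by blast
    next
      case False
      then obtain m where m: "m \<in> Q \<inter> Field r" "\<forall>y\<in>Q \<inter> Field r. (m, y) \<in> r"
        using Well_order_least[OF r, of "Q \<inter> Field r"] by blast
      have "(m, y) \<in> order_append r s" if "y \<in> Q" for y
        unfolding iff using m that Q(1) F by blast
      then show ?thesis using m(1) by blast
    qed
  qed
qed

lemma Field_tuple_order: "Field (tuple_order m a) = entries m a"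
  unfolding tuple_order_def Field_def by auto

lemma Well_order_tuple_order: "Well_order (tuple_order m a)"
proof -
  define f where "f x = (LEAST i. i < m \<and> a i = x)" for x
  have f: "f x < m \<and> a (f x) = x" if "x \<in> entries m a" for x
    unfolding f_def by (rule LeastI_ex) (use that in \<open>auto simp: entries_def\<close>)
  have iff: "(x, y) \<in> tuple_order m a \<longleftrightarrow> x \<in> entries m a \<and> y \<in> entries m a \<and> f x \<le> f y" for x y
    unfolding tuple_order_def f_def by simp
  show ?thesis
  proof (rule Well_orderI)
    fix x y assume "(x, y) \<in> tuple_order m a" "(y, x) \<in> tuple_order m a"
    then have "f x = f y" "x \<in> entries m a" "y \<in> entries m a" unfolding iff by auto
    then show "x = y" using f[of x] f[of y] by metis
  next
    fix Q assume Q: "Q \<subseteq> Field (tuple_order m a)" "Q \<noteq> {}"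
    then obtain x where "x \<in> Q" by blast
    then obtain z where "z \<in> Q" "\<forall>y. y \<in> Q \<longrightarrow> f z \<le> f y"
      using ex_has_least_nat[of "\<lambda>x. x \<in> Q" x f] by blast
    then show "\<exists>m'\<in>Q. \<forall>y\<in>Q. (m', y) \<in> tuple_order m a"
      using Q(1) unfolding Field_tuple_order iff by blast
  qed (simp add: Field_tuple_order iff)
qed

text \<open>
  Comparing multi-indices at the largest difference is the multiset order, hence well-founded.
\<close>

lemma multi_index_less_mult:
  fixes r :: "'a::field rel"
  assumes r: "Well_order r" and I: "I \<in> multi_indices (Field r)" and J: "J \<in> multi_indices (Field r)"
    and y: "y \<in> Field r" "lookup I y < lookup J y"
      "\<And>z. (y, z) \<in> r \<Longrightarrow> z \<noteq> y \<Longrightarrow> lookup I z = lookup J z"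
  shows "(Abs_multiset (lookup I), Abs_multiset (lookup J)) \<in> Multiset.mult (r - Id)"
proof -
  define ms where "ms K = Abs_multiset (lookup K)" for K :: "'a \<Rightarrow>\<^sub>0 nat"
  have cnt: "count (ms K) z = lookup K z" for K z
    unfolding ms_def by (simp add: count_Abs_multiset)
  \<comment> \<open>Splitting off the common part leaves two differences; every element of the first
    lies below \<open>y\<close>, which belongs to the second.\<close>
  have "((ms I \<inter># ms J) + (ms I - ms J), (ms I \<inter># ms J) + (ms J - ms I)) \<in> Multiset.mult (r - Id)"
  proof (rule one_step_implies_mult)
    have yin: "y \<in># ms J - ms I" using y(2) by (simp add: in_diff_count cnt)
    then show "ms J - ms I \<noteq> {#}" by auto
    show "\<forall>k\<in>set_mset (ms I - ms J). \<exists>j\<in>set_mset (ms J - ms I). (k, j) \<in> r - Id"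
    proof
      fix k assume "k \<in># ms I - ms J"
      then have k: "lookup J k < lookup I k" by (simp add: in_diff_count cnt)
      then have "k \<noteq> y" using y(2) by auto
      have "k \<in> Field r" using multi_indicesD(3)[OF I, of k] k by auto
      then have "(k, y) \<in> r" using Well_order_total[OF r _ y(1)] y(3)[of k] \<open>k \<noteq> y\<close> k by auto
      then show "\<exists>j\<in>set_mset (ms J - ms I). (k, j) \<in> r - Id" using yin \<open>k \<noteq> y\<close> by blast
    qed
  qed
  moreover have "(ms I \<inter># ms J) + (ms I - ms J) = ms I" "(ms I \<inter># ms J) + (ms J - ms I) = ms J"
    by (auto simp: multiset_eq_iff min_def)
  ultimately show ?thesis by (simp add: ms_def)
qed

lemma multi_index_le_antisym:
  assumes r: "Well_order r" and IJ: "multi_index_le r I J" "multi_index_le r J I"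
  shows "I = J"
proof (rule ccontr)
  assume "I \<noteq> J"
  then obtain y y' where y: "y \<in> Field r" "lookup I y < lookup J y"
      "\<forall>z. (y, z) \<in> r \<and> z \<noteq> y \<longrightarrow> lookup I z = lookup J z"
    and y': "y' \<in> Field r" "lookup J y' < lookup I y'"
      "\<forall>z. (y', z) \<in> r \<and> z \<noteq> y' \<longrightarrow> lookup J z = lookup I z"
    using IJ unfolding multi_index_le_def by blast
  have "y \<noteq> y'" using y(2) y'(2) by auto
  with Well_order_total[OF r y(1) y'(1)] show False
    using y(2,3) y'(2,3) by (metis less_irrefl)
qed

text \<open>Supports are finite, so there is a largest place of difference even if the order
  \<open>r\<close> is infinite.\<close>

lemma multi_index_le_total:
  assumes r: "Well_order r" and I: "I \<in> multi_indices (Field r)" and J: "J \<in> multi_indices (Field r)" and "I \<noteq> J"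
  shows "\<exists>y\<in>Field r. lookup I y \<noteq> lookup J y \<and>
    (\<forall>z. (y, z) \<in> r \<and> z \<noteq> y \<longrightarrow> lookup I z = lookup J z)"
proof -
  let ?Q = "{y. lookup I y \<noteq> lookup J y}"
  have sub: "?Q \<subseteq> keys I \<union> keys J"
    by (auto simp: in_keys_iff)
  then have fin: "finite ?Q" by (rule finite_subset) simp
  have QF: "?Q \<subseteq> Field r" using sub multi_indicesD(1)[OF I] multi_indicesD(1)[OF J] by blast
  have ne: "?Q \<noteq> {}" using \<open>I \<noteq> J\<close> poly_mapping_eqI[of I J] by blast
  obtain y where y: "y \<in> ?Q" "\<forall>z\<in>?Q. (z, y) \<in> r"
    using Well_order_finite_greatest[OF r fin ne QF] by blast
  have "lookup I z = lookup J z" if "(y, z) \<in> r" "z \<noteq> y" for z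
    using y(2) that Well_order_antisym[OF r that(1)] by blast
  then show ?thesis using y(1) QF by blast
qed

lemma multi_index_le_least:
  assumes r: "Well_order r" and Q: "Q \<subseteq> multi_indices (Field r)" "Q \<noteq> {}"
  shows "\<exists>I\<in>Q. \<forall>J\<in>Q. multi_index_le r I J"
proof -
  let ?R = "inv_image (Multiset.mult (r - Id)) (\<lambda>I. Abs_multiset (lookup I))"
  have "wf ?R" by (intro wf_inv_image wf_mult Well_order_wf[OF r])
  then obtain I where I: "I \<in> Q" "\<And>J. (J, I) \<in> ?R \<Longrightarrow> J \<notin> Q"
    using wfE_min'[of ?R Q] Q(2) by blast
  have "multi_index_le r I J" if "J \<in> Q" for J
  proof (cases "I = J")
    case False
    have IJ: "I \<in> multi_indices (Field r)" "J \<in> multi_indices (Field r)" using I(1) that Q(1) by auto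
    obtain y where y: "y \<in> Field r" "lookup I y \<noteq> lookup J y"
      "\<forall>z. (y, z) \<in> r \<and> z \<noteq> y \<longrightarrow> lookup I z = lookup J z"
      using multi_index_le_total[OF r IJ False] by (elim bexE conjE)
    have "\<not> lookup J y < lookup I y"
    proof
      assume "lookup J y < lookup I y"
      then have "(J, I) \<in> ?R"
        unfolding in_inv_image using y(3) by (intro multi_index_less_mult[OF r IJ(2,1) y(1)]) simp_all
      then show False using I(2) that by blast
    qed
    then show ?thesis unfolding multi_index_le_def using y by (metis linorder_neqE_nat)
  qed (simp add: multi_index_le_def)
  then show ?thesis using I(1) by blast
qed

section \<open>The orders of pairs and of lambda values\<close>

lemma lex_le_antisym:
  assumes r: "Well_order r" and s: "Well_order s" and "lex_le r s u v" "lex_le r s v u"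
  shows "u = v"
  using assms(3,4) multi_index_le_antisym[OF r] Well_order_antisym[OF s]
  unfolding lex_le_def by (auto split: prod.splits)

lemma lex_le_least:
  assumes r: "Well_order r" and s: "Well_order s"
    and Q: "Q \<subseteq> Field s \<times> multi_indices (Field r)" "Q \<noteq> {}"
  shows "\<exists>u\<in>Q. \<forall>v\<in>Q. lex_le r s u v"
proof -
  have "fst ` Q \<subseteq> Field s" "fst ` Q \<noteq> {}" using Q by auto
  then obtain x where x: "x \<in> fst ` Q" "\<forall>y\<in>fst ` Q. (x, y) \<in> s"
    using Well_order_least[OF s] by blast
  let ?P = "{I. (x, I) \<in> Q}"
  have "?P \<subseteq> multi_indices (Field r)" "?P \<noteq> {}" using Q(1) x(1) by auto
  then obtain I where I: "I \<in> ?P" "\<forall>J\<in>?P. multi_index_le r I J"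
    using multi_index_le_least[OF r] by blast
  have "lex_le r s (x, I) v" if "v \<in> Q" for v
    using that x(2) I(2) unfolding lex_le_def by (cases v) force
  then show ?thesis using I(1) by blast
qed

text \<open>Distinct elements have disjoint sets of occurrences \<open>(x, I)\<close>, so comparing
  elements by their least occurrences inherits antisymmetry and the existence of least elements from
  \<open>lex_le\<close>.\<close>

lemma
  assumes r: "Well_order r" and s: "Well_order s"
  shows Field_lambda_order:
      "Field (lambda_order F r s) = {lambda_fun F (Field r) I x | x I. x \<in> Field s \<and> I \<in> multi_indices (Field r)}"
    and Well_order_lambda_order: "Well_order (lambda_order F r s)"
proof -
  define occ where "occ z = {(x, I). x \<in> Field s \<and> I \<in> multi_indices (Field r) \<and> lambda_fun F (Field r) I x = z}" for z
  have iff: "(z, w) \<in> lambda_order F r s \<longleftrightarrow> occ w \<noteq> {} \<and> (\<exists>u\<in>occ z. \<forall>v\<in>occ w. lex_le r s u v)" for z w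
    unfolding lambda_order_def occ_def Let_def by simp
  have occ_sub: "occ z \<subseteq> Field s \<times> multi_indices (Field r)" for z
    unfolding occ_def by blast
  have occ_inj: "z = w" if "u \<in> occ z" "u \<in> occ w" for u z w
    using that unfolding occ_def by auto
  have refl: "(z, z) \<in> lambda_order F r s" if "occ z \<noteq> {}" for z
    unfolding iff using that lex_le_least[OF r s occ_sub that] by blast
  have F: "z \<in> Field (lambda_order F r s) \<longleftrightarrow> occ z \<noteq> {}" for z
  proof
    assume "z \<in> Field (lambda_order F r s)"
    then show "occ z \<noteq> {}" unfolding Field_def Domain_iff Range_iff Un_iff using iff by blast
  next
    assume "occ z \<noteq> {}"
    then show "z \<in> Field (lambda_order F r s)" using refl by (auto simp: Field_def)
  qed
  show "Field (lambda_order F r s) = {lambda_fun F (Field r) I x | x I. x \<in> Field s \<and> I \<in> multi_indices (Field r)}"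
    unfolding set_eq_iff F unfolding occ_def by auto
  show "Well_order (lambda_order F r s)"
  proof (rule Well_orderI)
    fix z w assume "(z, w) \<in> lambda_order F r s" "(w, z) \<in> lambda_order F r s"
    then obtain u v where u: "u \<in> occ z" "\<forall>v\<in>occ w. lex_le r s u v" and v: "v \<in> occ w" "\<forall>u\<in>occ z. lex_le r s v u"
      unfolding iff by blast
    then have "u = v" using lex_le_antisym[OF r s] by blast
    then show "z = w" using u(1) v(1) occ_inj by blast
  next
    fix Q assume Q: "Q \<subseteq> Field (lambda_order F r s)" "Q \<noteq> {}"
    then have "(\<Union>z\<in>Q. occ z) \<noteq> {}" using F by blast
    moreover have "(\<Union>z\<in>Q. occ z) \<subseteq> Field s \<times> multi_indices (Field r)" using occ_sub by blast
    ultimately obtain u where u: "u \<in> (\<Union>z\<in>Q. occ z)" "\<forall>v\<in>(\<Union>z\<in>Q. occ z). lex_le r s u v"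
      using lex_le_least[OF r s] by meson
    then obtain z where z: "z \<in> Q" "u \<in> occ z" by blast
    have "(z, w) \<in> lambda_order F r s" if "w \<in> Q" for w
      unfolding iff using u(2) z(2) that Q(1) F[of w] by blast
    then show "\<exists>m\<in>Q. \<forall>y\<in>Q. (m, y) \<in> lambda_order F r s" using z(1) by blast
  qed (simp add: F refl)
qed

text \<open>Whether \<open>x\<close> is taken depends only on the elements taken before it:
  existence follows by well-founded recursion and uniqueness by induction, which justifies the
  definite description.\<close>

lemma greedy_subset:
  assumes b: "Well_order b"
  shows "greedy_subset F D b \<subseteq> Field b \<and>
    (\<forall>x\<in>Field b. x \<in> greedy_subset F D b \<longleftrightarrow>
       p_independent F D (insert x {y\<in>greedy_subset F D b. y \<noteq> x \<and> (y, x) \<in> b}))"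
  unfolding greedy_subset_def
proof (rule theI', rule ex_ex1I)
  have wf: "wf (b - Id)" by (rule Well_order_wf[OF b])
  define P where "P = wfrec (b - Id) (\<lambda>f x. p_independent F D (insert x {y. f y \<and> y \<noteq> x \<and> (y, x) \<in> b}))"
  have P: "P x \<longleftrightarrow> p_independent F D (insert x {y. P y \<and> y \<noteq> x \<and> (y, x) \<in> b})" for x
  proof -
    \<comment> \<open>Cutting off the recursive call at the predecessors of \<open>x\<close> has no
      effect, since only these are inspected.\<close>
    have "{y. cut P (b - Id) x y \<and> y \<noteq> x \<and> (y, x) \<in> b} = {y. P y \<and> y \<noteq> x \<and> (y, x) \<in> b}"
      using cut_apply[of _ x "b - Id" P] by auto
    then show ?thesis
      using wfrec[OF wf, of "\<lambda>f x. p_independent F D (insert x {y. f y \<and> y \<noteq> x \<and> (y, x) \<in> b})" x]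
      unfolding P_def[symmetric] by simp
  qed
  let ?S = "{x \<in> Field b. P x}"
  have "x \<in> ?S \<longleftrightarrow> p_independent F D (insert x {y\<in>?S. y \<noteq> x \<and> (y, x) \<in> b})" if "x \<in> Field b" for x
  proof -
    have "x \<in> ?S \<longleftrightarrow> P x" using that by simp
    also have "\<dots> \<longleftrightarrow> p_independent F D (insert x {y. P y \<and> y \<noteq> x \<and> (y, x) \<in> b})" by (rule P)
    also have "{y. P y \<and> y \<noteq> x \<and> (y, x) \<in> b} = {y\<in>?S. y \<noteq> x \<and> (y, x) \<in> b}"
      by (auto simp: Field_def)
    finally show ?thesis .
  qed
  then have "?S \<subseteq> Field b \<and> (\<forall>x\<in>Field b. x \<in> ?S \<longleftrightarrow> p_independent F D (insert x {y\<in>?S. y \<noteq> x \<and> (y, x) \<in> b}))"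
    by blast
  then show "\<exists>S. S \<subseteq> Field b \<and> (\<forall>x\<in>Field b. x \<in> S \<longleftrightarrow> p_independent F D (insert x {y\<in>S. y \<noteq> x \<and> (y, x) \<in> b}))"
    by blast
  fix S S'
  assume S: "S \<subseteq> Field b \<and> (\<forall>x\<in>Field b. x \<in> S \<longleftrightarrow> p_independent F D (insert x {y\<in>S. y \<noteq> x \<and> (y, x) \<in> b}))"
    and S': "S' \<subseteq> Field b \<and> (\<forall>x\<in>Field b. x \<in> S' \<longleftrightarrow> p_independent F D (insert x {y\<in>S'. y \<noteq> x \<and> (y, x) \<in> b}))"
  have "x \<in> Field b \<longrightarrow> (x \<in> S \<longleftrightarrow> x \<in> S')" for x
  proof (induction x rule: wf_induct_rule[OF wf])
    case (1 x)
    have "{y\<in>S. y \<noteq> x \<and> (y, x) \<in> b} = {y\<in>S'. y \<noteq> x \<and> (y, x) \<in> b}"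
      using 1 by (auto simp: Field_def)
    then show ?case using S S' by auto
  qed
  then show "S = S'" using S S' by blast
qed


section \<open>The splitting iteration\<close>

text \<open>Spanning by p-monomials gives a family of coefficients; their independence and the
  injectivity of \<open>frob\<close> make it unique, as the definite description demands.\<close>

lemma lambda_family_sum:
  fixes B :: "'a::field set"
  assumes ind: "lin_indep (pth_powers UNIV) (multi_indices B) pmon"
    and x: "x \<in> gen_field (pth_powers UNIV \<union> B)"
  defines "g \<equiv> lambda_family UNIV B x"
  shows "keys g \<subseteq> multi_indices B"
    "x = (\<Sum>I\<in>keys g. pmon I * frob (lookup g I))"
proof -
  define P where "P g \<longleftrightarrow> keys g \<subseteq> multi_indices B \<and> (\<forall>I. lookup g I \<in> UNIV) \<and>
    x = (\<Sum>I\<in>keys g. (\<Prod>y\<in>keys I. y ^ lookup I y) *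
      lookup g I ^ char_exp TYPE('a))" for g
  have P: "P g \<longleftrightarrow> keys g \<subseteq> multi_indices B \<and>
    x = (\<Sum>I\<in>keys g. pmon I * frob (lookup g I))" for g
    by (simp add: P_def pmon_def frob_def)
  have ex: "\<exists>g. P g"
  proof -
    have "x \<in> lin_span (pth_powers UNIV) (multi_indices B) pmon"
      using x gen_field_eq_pmon_span[OF pth_powers_subfield[OF subfield_UNIV], of B]
      by (auto simp: pth_powers_frob)
    then obtain T c where T: "finite T" "T \<subseteq> multi_indices B" "\<forall>I\<in>T. c I \<in> pth_powers UNIV"
      "x = (\<Sum>I\<in>T. c I * pmon I)"
      unfolding lin_span_def by blast
    have "\<forall>I\<in>T. \<exists>k. c I = frob k" using T(3) unfolding pth_powers_frob by blast
    then obtain k where k: "\<forall>I\<in>T. c I = frob (k I)" by metis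
    define g where "g = Abs_poly_mapping (\<lambda>I. if I \<in> T then k I else 0)"
    have "finite {I. (if I \<in> T then k I else 0) \<noteq> 0}"
      by (rule finite_subset[OF _ T(1)]) auto
    then have g: "lookup g I = (if I \<in> T then k I else 0)" for I
      by (simp add: g_def)
    have gT: "keys g \<subseteq> T" by (auto simp: in_keys_iff g split: if_splits)
    have "x = (\<Sum>I\<in>T. pmon I * frob (lookup g I))"
      unfolding T(4) using k by (intro sum.cong) (auto simp: g)
    also have "\<dots> = (\<Sum>I\<in>keys g. pmon I * frob (lookup g I))"
      by (rule sum.mono_neutral_right) (use T(1) gT in \<open>auto simp: in_keys_iff\<close>)
    finally show ?thesis unfolding P using gT T(2) by blast
  qed
  have unique: "g = h" if "P g" "P h" for g h
  proof (rule poly_mapping_eqI)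
    let ?T = "keys g \<union> keys h"
    let ?l = "lookup"
    have "(\<Sum>I\<in>keys k. pmon I * frob (?l k I)) = (\<Sum>I\<in>?T. pmon I * frob (?l k I))"
      if "keys k \<subseteq> ?T" for k
      by (rule sum.mono_neutral_left) (use that in \<open>auto simp: in_keys_iff\<close>)
    from this[of g] this[of h]
    have sum: "x = (\<Sum>I\<in>?T. pmon I * frob (?l g I))" "x = (\<Sum>I\<in>?T. pmon I * frob (?l h I))"
      using that unfolding P by simp_all
    have "(\<Sum>I\<in>?T. frob (?l g I - ?l h I) * pmon I) =
        (\<Sum>I\<in>?T. pmon I * frob (?l g I)) - (\<Sum>I\<in>?T. pmon I * frob (?l h I))"
      by (simp add: frob_diff algebra_simps sum_subtractf)
    then have 0: "(\<Sum>I\<in>?T. frob (?l g I - ?l h I) * pmon I) = 0"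
      unfolding sum[symmetric] by simp
    fix I
    show "?l g I = ?l h I"
    proof (cases "I \<in> ?T")
      case True
      have "frob (?l g I - ?l h I) = 0"
        by (rule lin_indepD[OF ind _ _ _ 0 True]) (use that in \<open>auto simp: P pth_powers_frob\<close>)
      then show ?thesis by simp
    qed (simp add: in_keys_iff)
  qed
  have "g = (THE g. P g)" unfolding g_def lambda_family_def P_def ..
  then have "P g" using theI'[of P] ex unique by metis
  then show "keys g \<subseteq> multi_indices B"
    "x = (\<Sum>I\<in>keys g. pmon I * frob (lookup g I))"
    unfolding P by blast+
qed

text \<open>There may be infinitely many multi-indices, as \<open>c\<close> may be infinite, but
  each family has finite support and hence takes finitely many values.\<close>

lemma finite_Field_lambda_order:
  assumes "Well_order r" "Well_order s" "finite (Field s)"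
  shows "finite (Field (lambda_order F r s))"
proof -
  have "finite (range (lookup g))" for g :: "('a \<Rightarrow>\<^sub>0 nat) \<Rightarrow>\<^sub>0 'a"
    by (rule finite_subset[of _ "insert 0 (lookup g ` keys g)"])
      (auto simp: in_keys_iff)
  then have "finite (\<Union>x\<in>Field s. range (lookup (lambda_family F (Field r) x)))"
    using assms(3) by blast
  then show ?thesis
    unfolding Field_lambda_order[OF assms(1,2)] lambda_fun_def by (rule rev_finite_subset) blast
qed

text \<open>In a finite set, the last element taken was tested together with all the others.\<close>

lemma greedy_subset_p_independent:
  assumes b: "Well_order b" "finite (Field b)"
  shows "p_independent F D (greedy_subset F D b)"
proof (cases "greedy_subset F D b = {}")
  case True
  then show ?thesis by (simp add: p_independent_def)
next
  case False
  let ?S = "greedy_subset F D b"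
  have S: "?S \<subseteq> Field b" using greedy_subset[OF b(1)] by blast
  then have "finite ?S" using b(2) finite_subset by blast
  then obtain m where m: "m \<in> ?S" "\<forall>y\<in>?S. (y, m) \<in> b"
    using Well_order_finite_greatest[OF b(1) _ False S] by blast
  have "p_independent F D (insert m {y\<in>?S. y \<noteq> m \<and> (y, m) \<in> b})"
    using greedy_subset[OF b(1)] m(1) S by blast
  moreover have "insert m {y\<in>?S. y \<noteq> m \<and> (y, m) \<in> b} = ?S" using m by blast
  ultimately show ?thesis by simp
qed

text \<open>An element that was not taken lies in the field generated by those taken before it;
  otherwise the p-monomials would stay independent after adjoining it, and it would have passed the
  test.\<close>

lemma greedy_subset_spans:
  fixes b :: "'a::field rel"
  assumes p: "1 < char_exp TYPE('a)" and b: "Well_order b" "finite (Field b)" "Field b \<subseteq> F"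
    and x: "x \<in> Field b"
  shows "x \<in> gen_field (pth_powers F \<union> D \<union> greedy_subset F D b)"
proof (cases "x \<in> greedy_subset F D b")
  case True
  then show ?thesis using gen_field_incl[of "pth_powers F \<union> D \<union> greedy_subset F D b"] by blast
next
  case False
  let ?S = "greedy_subset F D b"
  let ?S' = "{y\<in>?S. y \<noteq> x \<and> (y, x) \<in> b}"
  let ?D = "gen_field (pth_powers F \<union> D)"
  have SF: "?S \<subseteq> F" using greedy_subset[OF b(1)] b(3) by blast
  have nind: "\<not> p_independent F D (insert x ?S')"
    using greedy_subset[OF b(1)] x False by blast
  have frob: "frob y \<in> ?D" if "y \<in> F" for y
    using gen_field_incl[of "pth_powers F \<union> D"] that by (auto simp: pth_powers_frob)
  have "p_independent F D ?S'"
    by (rule p_independent_subset[OF greedy_subset_p_independent[OF b(1,2)]]) blast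
  then have ind: "lin_indep ?D (multi_indices ?S') pmon" by (rule p_independent_imp_pmon)
  have "x \<in> gen_field (?D \<union> ?S')"
  proof (rule ccontr)
    assume *: "x \<notin> gen_field (?D \<union> ?S')"
    have "lin_indep ?D (multi_indices (insert x ?S')) pmon"
      by (rule pmon_lin_indep_insert[OF gen_field_subfield _ ind * frob]) (use SF frob b(3) x in auto)
    then have "p_independent F D (insert x ?S')"
      by (intro pmon_imp_p_independent[OF p]) (use SF b(3) x in auto)
    then show False using nind by blast
  qed
  then have "x \<in> gen_field (pth_powers F \<union> D \<union> ?S')"
    by (simp add: gen_field_Un_gen_field)
  then show ?thesis
    using gen_field_mono[of "pth_powers F \<union> D \<union> ?S'" "pth_powers F \<union> D \<union> ?S"] by blast
qed

lemma p_independent_Un: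
  fixes A :: "'a::field set"
  assumes p: "1 < char_exp TYPE('a)" and A: "p_independent F C A"
    and S: "p_independent F (gen_field (C \<union> A)) S"
  shows "p_independent F C (A \<union> S)"
proof (rule pmon_imp_p_independent[OF p])
  let ?D' = "gen_field (pth_powers F \<union> gen_field (C \<union> A))"
  have AD: "A \<subseteq> ?D'" "pth_powers F \<union> C \<subseteq> ?D'"
    using gen_field_incl[of "C \<union> A"] gen_field_incl[of "pth_powers F \<union> gen_field (C \<union> A)"] by auto
  show "A \<union> S \<subseteq> F" using A S unfolding p_independent_def by blast
  have "x \<in> gen_field (pth_powers F \<union> gen_field (C \<union> A) \<union> (S - {x}))" if "x \<in> A" for x
    using that gen_field_incl[of "C \<union> A"] gen_field_incl[of "pth_powers F \<union> gen_field (C \<union> A) \<union> (S - {x})"] by auto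
  then have "A \<inter> S = {}" using S unfolding p_independent_def by blast
  then show "lin_indep (gen_field (pth_powers F \<union> C)) (multi_indices (A \<union> S)) pmon"
    by (intro pmon_lin_indep_Un[OF gen_field_subfield _ AD(1) _ p_independent_imp_pmon[OF A] p_independent_imp_pmon[OF S]])
      (use AD(2) gen_field_least[OF gen_field_subfield] in blast)+
qed

text \<open>The inclusion \<open>Field a \<subseteq> Field b\<close> lets the second component alone
  generate the field of a stage.\<close>

definition split_inv :: "'a::field set \<Rightarrow> 'a rel \<times> 'a rel \<Rightarrow> bool" where
  "split_inv C = (\<lambda>(a, b). Well_order a \<and> Well_order b \<and> finite (Field a) \<and> finite (Field b) \<and>
     Field a \<subseteq> Field b \<and> p_independent UNIV C (Field a))"

text \<open>The last inclusion is the purpose of a step: the greedy choice places each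
  \<open>x\<close> of \<open>b\<close> into the field generated over the p-th powers by
  \<open>c\<close> and \<open>a'\<close>, and the elements added to \<open>b\<close> include the
  coefficients of its expansion, which enter only as p-th powers.\<close>

lemma split_step_props:
  fixes a b :: "'a::field rel"
  assumes p: "1 < char_exp TYPE('a)" and C: "is_subfield C" and sep: "frob_separable UNIV C"
    and c: "Well_order c" "p_basis C prime_field (Field c)"
    and inv: "split_inv C (a, b)" and step: "split_step UNIV C c (a, b) = (a', b')"
  shows "split_inv C (a', b')" "Field a \<subseteq> Field a'" "Field b \<subseteq> Field b'"
    "Field b \<subseteq> gen_field (pth_powers (Field b') \<union> (Field c \<union> Field a'))"
proof -
  let ?D = "gen_field (C \<union> Field a)"
  let ?S = "greedy_subset UNIV ?D b"
  have a: "Well_order a" and b: "Well_order b" and fin: "finite (Field a)" "finite (Field b)"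
    and ab: "Field a \<subseteq> Field b" and ind: "p_independent UNIV C (Field a)"
    using inv unfolding split_inv_def by auto
  have a': "a' = order_append a (Restr b ?S)"
    and b': "b' = order_append b (lambda_order UNIV (order_append c a') b)"
    using step unfolding split_step_def Let_def by auto
  have S: "?S \<subseteq> Field b" using greedy_subset[OF b] by blast
  have wS: "Well_order (Restr b ?S)" "Field (Restr b ?S) = ?S"
    by (rule Well_order_Restr[OF b], rule Field_Restr_Well_order[OF b S])
  have Fa': "Field a' = Field a \<union> ?S" and wa': "Well_order a'"
    unfolding a' using Field_order_append[OF a wS(1)] Well_order_order_append[OF a wS(1)] wS(2) by auto
  have Fca': "Field (order_append c a') = Field c \<union> Field a'" and wca': "Well_order (order_append c a')"
    using Field_order_append[OF c(1) wa'] Well_order_order_append[OF c(1) wa'] by auto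
  let ?B = "Field c \<union> Field a'"
  let ?l = "lambda_order UNIV (order_append c a') b"
  have wl: "Well_order ?l" by (rule Well_order_lambda_order[OF wca' b])
  have Fl: "Field ?l = {lambda_fun UNIV ?B I x | x I. x \<in> Field b \<and> I \<in> multi_indices ?B}"
    unfolding Field_lambda_order[OF wca' b] Fca' ..
  have Fb': "Field b' = Field b \<union> Field ?l" and wb': "Well_order b'"
    unfolding b' using Field_order_append[OF b wl] Well_order_order_append[OF b wl] by auto
  have ind': "p_independent UNIV C (Field a')"
    unfolding Fa' using greedy_subset_p_independent[OF b fin(2)] by (intro p_independent_Un[OF p ind])
  show "Field a \<subseteq> Field a'" "Field b \<subseteq> Field b'" unfolding Fa' Fb' by auto
  show "split_inv C (a', b')"
    unfolding split_inv_def using wa' wb' ind' fin S ab finite_Field_lambda_order[OF wca' b fin(2)]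
      finite_subset[OF S fin(2)] by (auto simp: Fa' Fb')
  show "Field b \<subseteq> gen_field (pth_powers (Field b') \<union> ?B)"
  proof
    fix x assume x: "x \<in> Field b"
    let ?G = "gen_field (pth_powers UNIV \<union> ?B)"
    have "x \<in> gen_field (pth_powers UNIV \<union> ?D \<union> ?S)"
      by (rule greedy_subset_spans[OF p b fin(2) subset_UNIV x])
    also have "gen_field (pth_powers UNIV \<union> ?D \<union> ?S) \<subseteq> ?G"
    proof (rule gen_field_least[OF gen_field_subfield])
      have B: "pth_powers UNIV \<union> ?B \<subseteq> ?G" by (rule gen_field_incl)
      \<comment> \<open>As \<open>C = C^p(c)\<close>, the elements of \<open>C\<close> are absorbed
        by p-th powers and \<open>c\<close>.\<close>
      have "C = gen_field (pth_powers C \<union> prime_field \<union> Field c)"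
        using c(2) unfolding p_basis_def by blast
      moreover have "pth_powers C \<union> prime_field \<union> Field c \<subseteq> ?G"
        using B pth_powers_mono[of C UNIV] gen_field_least[OF gen_field_subfield, of "{}" "pth_powers UNIV \<union> ?B"] by auto
      ultimately have "C \<subseteq> ?G"
        using gen_field_least[OF gen_field_subfield, of "pth_powers C \<union> prime_field \<union> Field c" "pth_powers UNIV \<union> ?B"] by simp
      then have "?D \<subseteq> ?G"
        using B Fa' by (intro gen_field_least[OF gen_field_subfield]) auto
      then show "pth_powers UNIV \<union> ?D \<union> ?S \<subseteq> ?G" using B Fa' by auto
    qed
    finally have xG: "x \<in> ?G" .
    have "lin_indep (pth_powers UNIV) (multi_indices ?B) pmon"
      by (rule p_basis_pmon_lin_indep[OF C sep c(2) ind' subfield_UNIV subset_UNIV])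
    note lam = lambda_family_sum[OF this xG]
    let ?g = "lambda_family UNIV ?B x"
    let ?H = "gen_field (pth_powers (Field b') \<union> ?B)"
    have H: "pth_powers (Field b') \<union> ?B \<subseteq> ?H" by (rule gen_field_incl)
    have "pmon I * frob (lookup ?g I) \<in> ?H" if "I \<in> keys ?g" for I
    proof (rule subfield_mult[OF gen_field_subfield])
      show "pmon I \<in> ?H" using lam(1) that H by (intro pmon_in[OF gen_field_subfield, of I ?B]) auto
      have "lookup ?g I \<in> Field b'"
        unfolding Fb' Fl using that lam(1) x unfolding lambda_fun_def by blast
      then show "frob (lookup ?g I) \<in> ?H" using H by (auto simp: pth_powers_frob)
    qed
    then have "(\<Sum>I\<in>keys ?g. pmon I * frob (lookup ?g I)) \<in> ?H"
      by (intro subfield_sum[OF gen_field_subfield])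
    then show "x \<in> ?H" unfolding lam(2)[symmetric] .
  qed
qed

lemma split_iter_Suc: "split_iter F C c (Suc n) r = split_step F C c (split_iter F C c n r)"
  by (simp add: split_iter_def)

lemma split_iter_inv:
  fixes C :: "'a::field set"
  assumes p: "1 < char_exp TYPE('a)" and C: "is_subfield C" and sep: "frob_separable UNIV C"
    and c: "Well_order c" "p_basis C prime_field (Field c)" and r: "Well_order r" "finite (Field r)"
  shows "split_inv C (split_iter UNIV C c n r)"
proof (induction n)
  case 0
  show ?case using r by (simp add: split_iter_def split_inv_def p_independent_def)
next
  case (Suc n)
  obtain a b where ab: "split_iter UNIV C c n r = (a, b)" by (metis surj_pair)
  obtain a' b' where "split_step UNIV C c (a, b) = (a', b')" by (metis surj_pair)
  then show ?case
    using split_step_props(1)[OF p C sep c] Suc unfolding split_iter_Suc ab by metis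
qed

text \<open>Each \<open>B n\<close> is generated by \<open>W\<close> and p-th powers of elements of
  the next stage, so the union satisfies \<open>L \<subseteq> L^p(W)\<close>. Since \<open>W\<close>
  is the union of the increasing sets \<open>Field c \<union> A n\<close>, any finite part of it is
  already p-independent at one stage.\<close>

lemma split_set_separable:
  fixes C :: "'a::field set"
  assumes p: "1 < char_exp TYPE('a)" and C: "is_subfield C" and sep: "frob_separable UNIV C"
    and c: "Well_order c" "p_basis C prime_field (Field c)" and r: "Well_order r" "finite (Field r)"
  shows "\<exists>N. \<forall>n\<ge>N. frob_separable (gen_field (C \<union> split_set UNIV C c n r \<union> set xs))
      (gen_field (C \<union> split_set UNIV C c n r))"
proof -
  define A where "A n = Field (fst (split_iter UNIV C c n r))" for n
  define B where "B n = Field (snd (split_iter UNIV C c n r))" for n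
  have inv: "split_inv C (split_iter UNIV C c n r)" for n
    by (rule split_iter_inv[OF p C sep c r])
  have step: "A n \<subseteq> A (Suc n) \<and> B n \<subseteq> B (Suc n) \<and> B n \<subseteq> gen_field (pth_powers (B (Suc n)) \<union> (Field c \<union> A (Suc n)))" for n
  proof -
    obtain a b where ab: "split_iter UNIV C c n r = (a, b)" by (metis surj_pair)
    obtain a' b' where ab': "split_step UNIV C c (a, b) = (a', b')" by (metis surj_pair)
    have "split_inv C (a, b)" using inv[of n] ab by simp
    from split_step_props(2-4)[OF p C sep c this ab'] show ?thesis
      unfolding A_def B_def split_iter_Suc ab ab' by simp
  qed
  have AB: "A n \<subseteq> B n" and Aind: "p_independent UNIV C (A n)" for n
    using inv[of n] unfolding split_inv_def A_def B_def by (auto split: prod.splits)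
  define E where "E n = gen_field (C \<union> B n)" for n
  have E_eq: "gen_field (C \<union> split_set UNIV C c n r) = E n" for n
    using AB[of n] unfolding E_def split_set_def A_def B_def by (simp add: Un_absorb1)
  have E: "is_subfield (E n)" for n unfolding E_def by simp
  have E_Suc: "E n \<subseteq> E (Suc n)" for n
    unfolding E_def using step[of n] by (intro gen_field_mono) auto
  have E_mono: "E m \<subseteq> E n" if "m \<le> n" for m n
    using lift_Suc_mono_le[of E, OF E_Suc that] .
  have A_mono: "A m \<subseteq> A n" if "m \<le> n" for m n
    using lift_Suc_mono_le[of A, OF _ that] step by blast
  have CE: "C \<subseteq> E n" and BE: "B n \<subseteq> E n" for n
    unfolding E_def using gen_field_incl[of "C \<union> B n"] by auto
  define L where "L = (\<Union>n. E n)"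
  have L: "is_subfield L"
  proof -
    have two: "\<exists>n. x \<in> E n \<and> y \<in> E n" if "x \<in> L" "y \<in> L" for x y
    proof -
      obtain m n where "x \<in> E m" "y \<in> E n" using \<open>x \<in> L\<close> \<open>y \<in> L\<close> unfolding L_def by blast
      then show ?thesis using E_mono[of m "max m n"] E_mono[of n "max m n"] by auto
    qed
    have EL: "E n \<subseteq> L" for n unfolding L_def by blast
    have "x + y \<in> L \<and> x * y \<in> L" if xy: "x \<in> L" "y \<in> L" for x y
      using two[OF xy] subfield_add[OF E] subfield_mult[OF E] EL by (metis subset_iff)
    moreover have "- x \<in> L \<and> inverse x \<in> L" if x: "x \<in> L" for x
      using two[OF x x] subfield_uminus[OF E] subfield_inverse[OF E] EL by (metis subset_iff)
    ultimately show ?thesis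
      unfolding is_subfield_iff using subfield_0[OF E] subfield_1[OF E] EL by blast
  qed
  define W where "W = Field c \<union> (\<Union>n. A n)"
  have cC: "Field c \<subseteq> C" using c(2) unfolding p_basis_def p_independent_def by blast
  have CL: "C \<subseteq> L" and BL: "B n \<subseteq> L" for n using CE BE unfolding L_def by blast+
  have "frob_separable UNIV L"
  proof (rule frob_separable_if_pmon_lin_indep[OF L])
    show "W \<subseteq> L" unfolding W_def using cC CL AB BL by blast
    let ?G = "gen_field (pth_powers L \<union> W)"
    have G: "pth_powers L \<union> W \<subseteq> ?G" by (rule gen_field_incl)
    have "C = gen_field (pth_powers C \<union> prime_field \<union> Field c)"
      using c(2) unfolding p_basis_def by blast
    moreover have "pth_powers C \<union> prime_field \<union> Field c \<subseteq> ?G"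
      using G pth_powers_mono[OF CL] gen_field_least[OF gen_field_subfield, of "{}" "pth_powers L \<union> W"]
      unfolding W_def by auto
    ultimately have "C \<subseteq> ?G"
      using gen_field_least[OF gen_field_subfield, of "pth_powers C \<union> prime_field \<union> Field c" "pth_powers L \<union> W"] by simp
    moreover have "B n \<subseteq> ?G" for n
    proof -
      have "gen_field (pth_powers (B (Suc n)) \<union> (Field c \<union> A (Suc n))) \<subseteq> ?G"
        by (rule gen_field_mono) (use pth_powers_mono[OF BL[of "Suc n"]] in \<open>auto simp: W_def\<close>)
      then show ?thesis using step[of n] by blast
    qed
    ultimately have "E n \<subseteq> ?G" for n
      unfolding E_def by (intro gen_field_least[OF gen_field_subfield]) blast
    then show "L \<subseteq> ?G" unfolding L_def by blast
    show "lin_indep (pth_powers UNIV) (multi_indices W) pmon"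
      unfolding lin_indep_finitely[of _ "multi_indices W"]
    proof (intro allI impI, elim conjE)
      fix T assume T: "finite T" "T \<subseteq> multi_indices W"
      obtain W' where W': "W' \<subseteq> W" "finite W'" "T \<subseteq> multi_indices W'"
        using multi_indices_finite_subset[OF T] by blast
      have "\<exists>n. W' \<subseteq> Field c \<union> A n"
        using W'(2,1)
      proof (induction W' rule: finite_induct)
        case (insert w W')
        then obtain n where n: "W' \<subseteq> Field c \<union> A n" by blast
        obtain m where m: "w \<in> Field c \<union> A m" using insert.prems unfolding W_def by blast
        have "insert w W' \<subseteq> Field c \<union> A (max m n)"
          using n m A_mono[of m "max m n"] A_mono[of n "max m n"] by auto
        then show ?case by blast
      qed simp
      then obtain n where "W' \<subseteq> Field c \<union> A n" by blast
      then have "T \<subseteq> multi_indices (Field c \<union> A n)" using W'(3) multi_indices_mono by blast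
      with p_basis_pmon_lin_indep[OF C sep c(2) Aind subfield_UNIV subset_UNIV]
      show "lin_indep (pth_powers UNIV) T pmon" by (rule lin_indep_subset)
    qed
  qed auto
  then have "\<exists>N. \<forall>n\<ge>N. frob_separable (gen_field (E n \<union> set xs)) (E n)"
    by (intro frob_separable_stage[OF E E_Suc L_def L])
  moreover have "gen_field (C \<union> split_set UNIV C c n r \<union> set xs) = gen_field (E n \<union> set xs)" for n
    unfolding E_eq[symmetric] gen_field_Un_gen_field ..
  ultimately show ?thesis unfolding E_eq by simp
qed


section \<open>Comparison with linear disjointness in the algebraic closure\<close>

lemma independent_iff_lin_indep:
  fixes us :: "'a::field list"
  assumes K: "is_subfield K"
  shows "ring.independent ring_of_type_algebra K us \<longleftrightarrow> lin_indep K {..<length us} (\<lambda>i. us ! i)"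
proof -
  interpret R: ring "ring_of_type_algebra :: 'a ring" by (rule ring_from_type_algebra)
  \<comment> \<open>The function \<open>combine\<close> stops at the end of the shorter list, so
    missing coefficients count as 0.\<close>
  have comb: "R.combine ks us = (\<Sum>i<length us. (if i < length ks then ks ! i else 0) * us ! i)" for ks us
  proof (induction us arbitrary: ks)
    case Nil
    then show ?case by (cases ks) simp_all
  next
    case (Cons u us)
    show ?case
    proof (cases ks)
      case (Cons k ks')
      then show ?thesis
        unfolding \<open>ks = k # ks'\<close> using Cons.IH[of ks'] by (simp add: sum.lessThan_Suc_shift del: sum.lessThan_Suc cong: if_cong)
    qed simp
  qed
  show ?thesis
    unfolding lin_indep_finite_iff[OF finite_lessThan subfield_0[OF K]]
  proof
    assume ind: "R.independent K us"
    show "\<forall>c. (\<forall>i\<in>{..<length us}. c i \<in> K) \<and> (\<Sum>i<length us. c i * us ! i) = 0 \<longrightarrow> (\<forall>i\<in>{..<length us}. c i = 0)"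
    proof (intro allI impI, elim conjE)
      fix c assume c: "\<forall>i\<in>{..<length us}. c i \<in> K" "(\<Sum>i<length us. c i * us ! i) = 0"
      let ?ks = "map c [0..<length us]"
      have "R.combine ?ks us = (\<Sum>i<length us. c i * us ! i)"
        unfolding comb by (intro sum.cong) auto
      moreover have "set ?ks \<subseteq> K" using c(1) by auto
      ultimately have "set (take (length us) ?ks) \<subseteq> {0}"
        using R.independent_imp_trivial_combine[OF K ind, of ?ks] c(2) by simp
      then show "\<forall>i\<in>{..<length us}. c i = 0" by (auto simp: image_subset_iff)
    qed
  next
    assume R: "\<forall>c. (\<forall>i\<in>{..<length us}. c i \<in> K) \<and> (\<Sum>i<length us. c i * us ! i) = 0 \<longrightarrow> (\<forall>i\<in>{..<length us}. c i = 0)"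
    show "R.independent K us"
    proof (rule R.trivial_combine_imp_independent[OF K])
      fix ks assume ks: "set ks \<subseteq> K" "R.combine ks us = \<zero>\<^bsub>ring_of_type_algebra\<^esub>"
      let ?c = "\<lambda>i. if i < length ks then ks ! i else 0"
      have "\<forall>i\<in>{..<length us}. ?c i \<in> K" using ks(1) subfield_0[OF K] by auto
      moreover have "(\<Sum>i<length us. ?c i * us ! i) = 0" using ks(2) unfolding comb by simp
      ultimately have 0: "\<forall>i\<in>{..<length us}. ?c i = 0" by (intro R[THEN spec, THEN mp] conjI)
      show "set (take (length us) ks) \<subseteq> {\<zero>\<^bsub>ring_of_type_algebra\<^esub>}"
      proof
        fix k assume "k \<in> set (take (length us) ks)"
        then obtain i where "i < length us" "i < length ks" "k = ks ! i"
          by (auto simp: in_set_conv_nth)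
        then show "k \<in> {\<zero>\<^bsub>ring_of_type_algebra\<^esub>}" using bspec[OF 0, of i] by simp
      qed
    qed simp
  qed
qed

lemma char_exp_alg_closure: "char_exp TYPE('a::field alg_closure) = char_exp TYPE('a)"
  by (simp add: char_exp_def)

lemma frob_to_ac: "frob (to_ac x) = to_ac (frob x)"
  by (simp add: frob_def char_exp_alg_closure)

lemma pth_roots_frob: "pth_roots C = {x. frob x \<in> to_ac ` C}"
  by (simp add: pth_roots_def frob_def char_exp_alg_closure)

lemma is_subfield_to_ac: "is_subfield E \<Longrightarrow> is_subfield (to_ac ` E)"
  unfolding is_subfield_iff
  by (auto simp flip: to_ac_0 to_ac_1 to_ac_minus to_ac_inverse to_ac_add to_ac_mult)

lemma is_subfield_pth_roots:
  assumes "is_subfield E"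
  shows "is_subfield (pth_roots E)"
proof -
  note E = is_subfield_to_ac[OF assms]
  show ?thesis
    unfolding is_subfield_iff pth_roots_frob
    by (auto simp: frob_uminus frob_inverse frob_add frob_mult simp del: to_ac_0
      intro: subfield_0[OF E] subfield_1[OF E] subfield_uminus[OF E] subfield_inverse[OF E] subfield_add[OF E] subfield_mult[OF E])
qed

lemma lin_indep_to_ac:
  "lin_indep (to_ac ` E) S (\<lambda>i. to_ac (u i)) \<longleftrightarrow> lin_indep E S u"
proof
  assume ind: "lin_indep (to_ac ` E) S (\<lambda>i. to_ac (u i))"
  show "lin_indep E S u"
  proof (rule lin_indepI)
    fix T c assume T: "finite T" "T \<subseteq> S" "\<And>i. i \<in> T \<Longrightarrow> c i \<in> E" "(\<Sum>i\<in>T. c i * u i) = 0"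
    have "(\<Sum>i\<in>T. to_ac (c i) * to_ac (u i)) = to_ac (\<Sum>i\<in>T. c i * u i)"
      by (simp add: to_ac_sum)
    then have "to_ac (c i) = 0" if "i \<in> T" for i
      by (intro lin_indepD[OF ind T(1,2) _ _ that, of "\<lambda>i. to_ac (c i)"]) (use T(3,4) in auto)
    then show "\<forall>i\<in>T. c i = 0" by simp
  qed
next
  assume ind: "lin_indep E S u"
  show "lin_indep (to_ac ` E) S (\<lambda>i. to_ac (u i))"
  proof (rule lin_indepI)
    fix T c assume T: "finite T" "T \<subseteq> S" "\<And>i. i \<in> T \<Longrightarrow> c i \<in> to_ac ` E" "(\<Sum>i\<in>T. c i * to_ac (u i)) = 0"
    then have "\<forall>i\<in>T. \<exists>d\<in>E. c i = to_ac d" by blast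
    then obtain d where d: "\<forall>i\<in>T. d i \<in> E \<and> c i = to_ac (d i)" by metis
    have "(\<Sum>i\<in>T. c i * to_ac (u i)) = (\<Sum>i\<in>T. to_ac (d i * u i))"
      using d by (intro sum.cong) auto
    then have "to_ac (\<Sum>i\<in>T. d i * u i) = 0" using T(4) by (simp add: to_ac_sum)
    then have "(\<Sum>i\<in>T. d i * u i) = 0" by simp
    then have "d i = 0" if "i \<in> T" for i
      by (intro lin_indepD[OF ind T(1,2) _ _ that, of d]) (use d in auto)
    then show "\<forall>i\<in>T. c i = 0" using d by simp
  qed
qed

text \<open>A relation with coefficients in \<open>E^(1/p)\<close> is raised to the p-th power, and
  conversely coefficients in \<open>E\<close> have p-th roots in the algebraic closure; injectivity
  of \<open>frob\<close> carries the vanishing back.\<close>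

lemma lin_indep_pth_roots:
  assumes E: "is_subfield E"
  shows "lin_indep (pth_roots E) S (\<lambda>i. to_ac (u i)) \<longleftrightarrow> lin_indep E S (\<lambda>i. frob (u i))"
proof
  assume ind: "lin_indep (pth_roots E) S (\<lambda>i. to_ac (u i))"
  show "lin_indep E S (\<lambda>i. frob (u i))"
  proof (rule lin_indepI)
    fix T c assume T: "finite T" "T \<subseteq> S" and c: "\<And>i. i \<in> T \<Longrightarrow> c i \<in> E" "(\<Sum>i\<in>T. c i * frob (u i)) = 0"
    have "\<exists>x. frob x = to_ac (c i)" for i
      unfolding frob_def using nth_root_exists[OF char_exp_pos] .
    then obtain x where x: "\<And>i. frob (x i) = to_ac (c i)" by metis
    have "frob (\<Sum>i\<in>T. x i * to_ac (u i)) = to_ac (\<Sum>i\<in>T. c i * frob (u i))"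
      by (simp add: frob_sum frob_mult x frob_to_ac to_ac_sum)
    then have "(\<Sum>i\<in>T. x i * to_ac (u i)) = 0" using c(2) by simp
    then have "x i = 0" if "i \<in> T" for i
      by (intro lin_indepD[OF ind T _ _ that, of x]) (use c(1) in \<open>auto simp: pth_roots_frob x\<close>)
    then have "to_ac (c i) = 0" if "i \<in> T" for i using that x[of i] by simp
    then show "\<forall>i\<in>T. c i = 0" by simp
  qed
next
  assume ind: "lin_indep E S (\<lambda>i. frob (u i))"
  show "lin_indep (pth_roots E) S (\<lambda>i. to_ac (u i))"
  proof (rule lin_indepI)
    fix T x assume T: "finite T" "T \<subseteq> S" and x: "\<And>i. i \<in> T \<Longrightarrow> x i \<in> pth_roots E" "(\<Sum>i\<in>T. x i * to_ac (u i)) = 0"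
    have "\<forall>i\<in>T. \<exists>d\<in>E. frob (x i) = to_ac d" using x(1) unfolding pth_roots_frob by blast
    then obtain d where d: "\<forall>i\<in>T. d i \<in> E \<and> frob (x i) = to_ac (d i)" by metis
    have "to_ac (\<Sum>i\<in>T. d i * frob (u i)) = frob (\<Sum>i\<in>T. x i * to_ac (u i))"
      unfolding frob_sum to_ac_sum using d by (intro sum.cong) (auto simp: frob_mult frob_to_ac)
    then have "(\<Sum>i\<in>T. d i * frob (u i)) = 0" using x(2) by simp
    then have "d i = 0" if "i \<in> T" for i
      by (intro lin_indepD[OF ind T _ _ that, of d]) (use d in auto)
    then show "\<forall>i\<in>T. x i = 0" using d by simp
  qed
qed

lemma separable_ext_iff:
  fixes E :: "'a::field set"
  assumes F: "is_subfield F" and E: "is_subfield E" and EF: "E \<subseteq> F"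
  shows "separable_ext F E \<longleftrightarrow> frob_separable F E"
proof -
  have list: "linearly_disjoint ring_of_type_algebra (to_ac ` F) (pth_roots E) (to_ac ` E) \<longleftrightarrow>
    (\<forall>us. set us \<subseteq> to_ac ` F \<and> lin_indep (to_ac ` E) {..<length us} (\<lambda>i. us ! i) \<longrightarrow>
       lin_indep (pth_roots E) {..<length us} (\<lambda>i. us ! i))"
    unfolding linearly_disjoint_def independent_iff_lin_indep[OF is_subfield_to_ac[OF E]]
      independent_iff_lin_indep[OF is_subfield_pth_roots[OF E]] ..
  have "linearly_disjoint ring_of_type_algebra (to_ac ` F) (pth_roots E) (to_ac ` E) \<longleftrightarrow> frob_separable F E"
    unfolding list
  proof
    assume *: "\<forall>us. set us \<subseteq> to_ac ` F \<and> lin_indep (to_ac ` E) {..<length us} (\<lambda>i. us ! i) \<longrightarrow>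
       lin_indep (pth_roots E) {..<length us} (\<lambda>i. us ! i)"
    show "frob_separable F E"
      unfolding frob_separable_def
    proof (intro allI impI, elim conjE)
      fix n :: nat and u :: "nat \<Rightarrow> 'a"
      assume u: "u ` {..<n} \<subseteq> F" "lin_indep E {..<n} u"
      let ?us = "map (\<lambda>i. to_ac (u i)) [0..<n]"
      have cong: "lin_indep D {..<n} (\<lambda>i. ?us ! i) \<longleftrightarrow> lin_indep D {..<n} (\<lambda>i. to_ac (u i))" for D
        by (rule lin_indep_cong) simp
      have "lin_indep (to_ac ` E) {..<length ?us} (\<lambda>i. ?us ! i)"
        using u(2) by (simp add: cong lin_indep_to_ac del: upt_Suc)
      moreover have "set ?us \<subseteq> to_ac ` F" using u(1) by (auto simp: image_subset_iff)
      ultimately have "lin_indep (pth_roots E) {..<length ?us} (\<lambda>i. ?us ! i)" using * by blast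
      then show "lin_indep E {..<n} (\<lambda>i. frob (u i))"
        by (simp add: cong lin_indep_pth_roots[OF E] del: upt_Suc)
    qed
  next
    assume sep: "frob_separable F E"
    show "\<forall>us. set us \<subseteq> to_ac ` F \<and> lin_indep (to_ac ` E) {..<length us} (\<lambda>i. us ! i) \<longrightarrow>
       lin_indep (pth_roots E) {..<length us} (\<lambda>i. us ! i)"
    proof (intro allI impI, elim conjE)
      fix us assume us: "set us \<subseteq> to_ac ` F" "lin_indep (to_ac ` E) {..<length us} (\<lambda>i. us ! i)"
      define u where "u i = of_ac (us ! i)" for i
      have usu: "us ! i = to_ac (u i)" "u i \<in> F" if "i < length us" for i
      proof -
        have "us ! i \<in> to_ac ` F" using us(1) nth_mem[OF that] by (rule subsetD)
        then obtain y where "y \<in> F" "us ! i = to_ac y" by (elim imageE)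
        then show "us ! i = to_ac (u i)" "u i \<in> F" by (simp_all add: u_def)
      qed
      have cong: "lin_indep D {..<length us} (\<lambda>i. us ! i) \<longleftrightarrow> lin_indep D {..<length us} (\<lambda>i. to_ac (u i))" for D
        by (rule lin_indep_cong) (simp add: usu)
      have "lin_indep E {..<length us} u" using us(2) unfolding cong lin_indep_to_ac .
      then have "lin_indep E {..<length us} (\<lambda>i. frob (u i))"
        using usu(2) by (intro frob_separableD[OF sep]) auto
      then show "lin_indep (pth_roots E) {..<length us} (\<lambda>i. us ! i)"
        unfolding cong lin_indep_pth_roots[OF E] .
    qed
  qed
  then show ?thesis unfolding separable_ext_def using F E EF by blast
qed

lemma frob_separable_char_exp_1:
  assumes "char_exp TYPE('a::field) = 1"
  shows "frob_separable F (E :: 'a set)"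
proof -
  have "frob x = x" for x :: 'a by (simp add: frob_def assms)
  then show ?thesis by (simp add: frob_separable_def)
qed


section \<open>The tuple \<open>\<lambda>\<^bsub>K/b/c\<^esub> a\<close>\<close>

text \<open>Each ordering of \<open>A\<close> is separable from some stage on, not just at one
  stage, and a finite set has finitely many orderings. The largest of these stages therefore serves
  all of them, so the least number exists.\<close>

lemma sep_index:
  fixes C :: "'a::field set"
  assumes C: "separable_ext UNIV C" and c: "Well_order c" "p_basis C prime_field (Field c)"
    and fin: "finite A" "finite B"
  shows "\<forall>r. Well_order r \<and> Field r = A \<longrightarrow>
      frob_separable (gen_field (C \<union> split_set UNIV C c (sep_index UNIV C c B A) r \<union> B))
        (gen_field (C \<union> split_set UNIV C c (sep_index UNIV C c B A) r))"
    and "char_exp TYPE('a) = 1 \<Longrightarrow> sep_index UNIV C c B A = 0"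
proof -
  have C': "is_subfield C" using C unfolding separable_ext_def by blast
  have sep: "frob_separable UNIV C"
    using C separable_ext_iff[OF subfield_UNIV C' subset_UNIV] by blast
  define P where "P n \<longleftrightarrow> (\<forall>r. Well_order r \<and> Field r = A \<longrightarrow>
      frob_separable (gen_field (C \<union> split_set UNIV C c n r \<union> B)) (gen_field (C \<union> split_set UNIV C c n r)))" for n
  have "separable_ext (gen_field (G \<union> B)) (gen_field G) \<longleftrightarrow> frob_separable (gen_field (G \<union> B)) (gen_field G)" for G :: "'a set"
    by (rule separable_ext_iff) (auto intro!: gen_field_mono)
  then have idx: "sep_index UNIV C c B A = (LEAST n. P n)"
    unfolding sep_index_def P_def by simp
  have P0: "P 0" if "char_exp TYPE('a) = 1"
    unfolding P_def using frob_separable_char_exp_1[OF that] by blast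
  then show "char_exp TYPE('a) = 1 \<Longrightarrow> sep_index UNIV C c B A = 0"
    unfolding idx using Least_eq_0 by blast
  have "\<exists>n. P n"
  proof (cases "char_exp TYPE('a) = 1")
    case False
    then have p: "1 < char_exp TYPE('a)" using char_exp_pos[where ?'a = 'a] by linarith
    obtain xs where xs: "set xs = B" using finite_list[OF fin(2)] by blast
    let ?R = "{r. Well_order r \<and> Field r = A}"
    have "?R \<subseteq> Pow (A \<times> A)" by (auto simp: Field_def)
    then have finR: "finite ?R" by (rule finite_subset) (simp add: fin)
    define Q where "Q r n \<longleftrightarrow> frob_separable (gen_field (C \<union> split_set UNIV C c n r \<union> B)) (gen_field (C \<union> split_set UNIV C c n r))" for r n
    have "\<forall>r\<in>?R. \<exists>N. \<forall>n\<ge>N. Q r n"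
    proof
      fix r assume r: "r \<in> ?R"
      show "\<exists>N. \<forall>n\<ge>N. Q r n"
        unfolding Q_def xs[symmetric] by (rule split_set_separable[OF p C' sep c]) (use r fin(1) in auto)
    qed
    then obtain N where N: "\<forall>r\<in>?R. \<forall>n\<ge>N r. Q r n" by (rule bchoice[THEN exE])
    have "P (Max (N ` ?R))"
      unfolding P_def Q_def[symmetric]
    proof (intro allI impI)
      fix r assume r: "Well_order r \<and> Field r = A"
      then have "N r \<le> Max (N ` ?R)" using finR by (intro Max_ge) auto
      then show "Q r (Max (N ` ?R))" using N r by blast
    qed
    then show ?thesis by blast
  qed (use P0 in blast)
  then have "P (sep_index UNIV C c B A)" unfolding idx by (rule LeastI_ex)
  then show "\<forall>r. Well_order r \<and> Field r = A \<longrightarrow>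
      frob_separable (gen_field (C \<union> split_set UNIV C c (sep_index UNIV C c B A) r \<union> B))
        (gen_field (C \<union> split_set UNIV C c (sep_index UNIV C c B A) r))"
    unfolding P_def .
qed

lemma finite_entries: "finite (entries m a)"
  by (simp add: entries_def)

text \<open>The invariant of the iteration is available for exponent above 1. For exponent 1 the
  index is 0, so the pair is \<open>({}, tuple_order m a)\<close> and can be inspected
  directly.\<close>

lemma lambda_sep_order_props:
  fixes C :: "'a::field set" and a b :: "nat \<Rightarrow> 'a" and m n :: nat
  assumes C: "separable_ext UNIV C" and c: "Well_order c" "p_basis C prime_field (Field c)"
  defines "r \<equiv> lambda_sep_order UNIV C c n b m a"
  shows "Well_order r" "finite (Field r)" "entries m a \<subseteq> Field r"
    "frob_separable (gen_field (C \<union> Field r \<union> entries n b)) (gen_field (C \<union> Field r))"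
proof -
  have C': "is_subfield C" using C unfolding separable_ext_def by blast
  have sep: "frob_separable UNIV C"
    using C separable_ext_iff[OF subfield_UNIV C' subset_UNIV] by blast
  let ?N = "sep_index UNIV C c (entries n b) (entries m a)"
  let ?t = "tuple_order m a"
  obtain A B where AB: "split_iter UNIV C c ?N ?t = (A, B)" by (metis surj_pair)
  have t: "Well_order ?t" "Field ?t = entries m a"
    by (rule Well_order_tuple_order, rule Field_tuple_order)
  have ABp: "Well_order A \<and> Well_order B \<and> finite (Field A) \<and> finite (Field B) \<and> entries m a \<subseteq> Field B"
  proof (cases "char_exp TYPE('a) = 1")
    case True
    then have "?N = 0" using sep_index(2)[OF C c] finite_entries by blast
    then have "A = {}" "B = ?t" using AB by (simp_all add: split_iter_def)
    then show ?thesis using t finite_entries by simp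
  next
    case False
    then have p: "1 < char_exp TYPE('a)" using char_exp_pos[where ?'a = 'a] by linarith
    have fin: "finite (Field ?t)" using t finite_entries by simp
    have inv: "split_inv C (split_iter UNIV C c k ?t)" for k
      by (rule split_iter_inv[OF p C' sep c t(1) fin])
    have "entries m a \<subseteq> Field (snd (split_iter UNIV C c k ?t))" for k
    proof (induction k)
      case 0
      show ?case using t by (simp add: split_iter_def)
    next
      case (Suc k)
      obtain a1 b1 where 1: "split_iter UNIV C c k ?t = (a1, b1)" by (metis surj_pair)
      obtain a2 b2 where 2: "split_step UNIV C c (a1, b1) = (a2, b2)" by (metis surj_pair)
      have "split_inv C (a1, b1)" using inv[of k] 1 by simp
      from split_step_props(3)[OF p C' sep c this 2] show ?case
        using Suc unfolding split_iter_Suc 1 2 by simp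
    qed
    from this[of ?N] show ?thesis using inv[of ?N] unfolding AB split_inv_def by simp
  qed
  have r: "r = order_append A B" unfolding r_def lambda_sep_order_def AB Let_def by simp
  show "Well_order r" unfolding r using ABp by (intro Well_order_order_append) blast+
  have Fr: "Field r = Field A \<union> Field B" unfolding r using ABp by (intro Field_order_append) blast+
  show "finite (Field r)" "entries m a \<subseteq> Field r" unfolding Fr using ABp by auto
  have "frob_separable (gen_field (C \<union> split_set UNIV C c ?N ?t \<union> entries n b)) (gen_field (C \<union> split_set UNIV C c ?N ?t))"
    using sep_index(1)[OF C c finite_entries[of m a] finite_entries[of n b]] t by blast
  moreover have "split_set UNIV C c ?N ?t = Field r" unfolding split_set_def AB Fr by simp
  ultimately show "frob_separable (gen_field (C \<union> Field r \<union> entries n b)) (gen_field (C \<union> Field r))"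
    by simp
qed

text \<open>The position of an element must be the number of elements strictly below it, which gives
  both existence and uniqueness of the enumeration.\<close>

lemma enum_tuple_props:
  assumes r: "Well_order r" and fin: "finite (Field r)"
  shows "enum_tuple r \<in> tuples (card (Field r))" "bij_betw (enum_tuple r) {..<card (Field r)} (Field r)"
proof -
  let ?l = "card (Field r)"
  define below where "below x = {y\<in>Field r. (y, x) \<in> r \<and> y \<noteq> x}" for x
  define P where "P e \<longleftrightarrow> e \<in> tuples ?l \<and> bij_betw e {..<?l} (Field r) \<and>
    (\<forall>i j. i \<le> j \<and> j < ?l \<longrightarrow> (e i, e j) \<in> r)" for e
  have finb: "finite (below x)" for x unfolding below_def using fin by simp
  have less: "card (below x) < card (below y)" if "(x, y) \<in> r" "x \<noteq> y" for x y
  proof (rule psubset_card_mono[OF finb])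
    have "x \<in> below y" "x \<notin> below x" using that by (auto simp: below_def Field_def)
    moreover have "z \<in> below y" if z: "z \<in> below x" for z
    proof -
      have zx: "z \<in> Field r" "(z, x) \<in> r" using z unfolding below_def by auto
      then have "(z, y) \<in> r" using Well_order_trans[OF r zx(2) \<open>(x, y) \<in> r\<close>] by blast
      moreover have "z \<noteq> y" using Well_order_antisym[OF r \<open>(x, y) \<in> r\<close>] zx(2) \<open>x \<noteq> y\<close> by blast
      ultimately show ?thesis using zx(1) unfolding below_def by blast
    qed
    ultimately show "below x \<subset> below y" by blast
  qed
  have inj: "inj_on (\<lambda>x. card (below x)) (Field r)"
  proof (rule inj_onI)
    fix x y assume xy: "x \<in> Field r" "y \<in> Field r" "card (below x) = card (below y)"
    show "x = y"
      using Well_order_total[OF r xy(1,2)] less[of x y] less[of y x] xy(3) by force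
  qed
  have img: "(\<lambda>x. card (below x)) ` Field r = {..<?l}"
  proof (rule card_subset_eq)
    have "card (below x) < ?l" if "x \<in> Field r" for x
      by (rule psubset_card_mono[OF fin]) (use that in \<open>auto simp: below_def\<close>)
    then show "(\<lambda>x. card (below x)) ` Field r \<subseteq> {..<?l}" by auto
  qed (simp_all add: card_image[OF inj])
  define e where "e = restrict (the_inv_into (Field r) (\<lambda>x. card (below x))) {..<?l}"
  have bij: "bij_betw (\<lambda>x. card (below x)) (Field r) {..<?l}" using inj img by (simp add: bij_betw_def)
  have "bij_betw e {..<?l} (Field r) \<longleftrightarrow> bij_betw (the_inv_into (Field r) (\<lambda>x. card (below x))) {..<?l} (Field r)"
    by (rule bij_betw_cong) (simp add: e_def)
  then have be: "bij_betw e {..<?l} (Field r)" using bij_betw_the_inv_into[OF bij] by simp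
  have pos_e: "card (below (e i)) = i" if "i < ?l" for i
    unfolding e_def using that f_the_inv_into_f[OF inj, of i] img by simp
  have Pe: "P e"
    unfolding P_def
  proof (intro conjI allI impI be)
    show "e \<in> tuples ?l" unfolding e_def by simp
    fix i j assume ij: "i \<le> j \<and> j < ?l"
    then have F: "e i \<in> Field r" "e j \<in> Field r" using be by (auto simp: bij_betw_def)
    show "(e i, e j) \<in> r"
    proof (rule ccontr)
      assume *: "(e i, e j) \<notin> r"
      then have "(e j, e i) \<in> r" "e j \<noteq> e i" using Well_order_total[OF r F] Well_order_refl[OF r F(1)] by auto
      then have "card (below (e j)) < card (below (e i))" by (rule less)
      then show False using ij pos_e[of i] pos_e[of j] by simp
    qed
  qed
  have pos: "card (below (f i)) = i" if "P f" "i < ?l" for f i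
  proof -
    have f: "bij_betw f {..<?l} (Field r)" "\<And>i j. i \<le> j \<Longrightarrow> j < ?l \<Longrightarrow> (f i, f j) \<in> r"
      using that(1) unfolding P_def by auto
    have injf: "inj_on f {..<?l}" using f(1) by (simp add: bij_betw_def)
    have "below (f i) = f ` {..<i}"
    proof
      show "f ` {..<i} \<subseteq> below (f i)"
      proof
        fix y assume "y \<in> f ` {..<i}"
        then obtain j where j: "j < i" "y = f j" by auto
        then have "(y, f i) \<in> r" "y \<noteq> f i"
          using f(2)[of j i] that(2) inj_onD[OF injf, of j i] by auto
        then show "y \<in> below (f i)" unfolding below_def by (auto simp: Field_def)
      qed
      show "below (f i) \<subseteq> f ` {..<i}"
      proof
        fix y assume y: "y \<in> below (f i)"
        then obtain j where j: "j < ?l" "y = f j" using f(1) unfolding below_def bij_betw_def by auto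
        have "\<not> i \<le> j" using f(2)[of i j] j y Well_order_antisym[OF r, of y "f i"] unfolding below_def by auto
        then show "y \<in> f ` {..<i}" using j by auto
      qed
    qed
    moreover have "inj_on f {..<i}" by (rule inj_on_subset[OF injf]) (use that(2) in auto)
    ultimately show ?thesis by (simp add: card_image)
  qed
  have "f = e" if "P f" for f
  proof (rule ext)
    fix i
    show "f i = e i"
    proof (cases "i < ?l")
      case True
      have "f i \<in> Field r" "e i \<in> Field r" using that Pe True unfolding P_def bij_betw_def by auto
      then show ?thesis using inj_onD[OF inj, of "f i" "e i"] pos[OF that True] pos[OF Pe True] by simp
    next
      case False
      then show ?thesis using that Pe unfolding P_def PiE_def extensional_def by simp
    qed
  qed
  then have "enum_tuple r = e"
    unfolding enum_tuple_def P_def[symmetric] using Pe by (intro the_equality) blast+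
  then show "enum_tuple r \<in> tuples ?l" "bij_betw (enum_tuple r) {..<?l} (Field r)"
    using Pe unfolding P_def by simp_all
qed


section \<open>Multivariate polynomials\<close>

definition mmon :: "(nat \<Rightarrow>\<^sub>0 nat) \<Rightarrow> (nat \<Rightarrow> 'a::field) \<Rightarrow> 'a" where
  "mmon u x = (\<Prod>i\<in>keys u. x i ^ lookup u i)"

lemma mpoly_eval_mmon: "mpoly_eval f x = (\<Sum>u\<in>keys f. lookup f u * mmon u x)"
  by (simp add: mpoly_eval_def mmon_def)

lemma mmon_superset:
  assumes "finite A" "keys u \<subseteq> A"
  shows "mmon u x = (\<Prod>i\<in>A. x i ^ lookup u i)"
  unfolding mmon_def by (rule prod.mono_neutral_left) (use assms in \<open>auto simp: in_keys_iff\<close>)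

lemma mmon_add: "mmon (u + v) x = mmon u x * mmon v x"
proof -
  let ?A = "keys u \<union> keys v"
  have "mmon (u + v) x = (\<Prod>i\<in>?A. x i ^ lookup (u + v) i)"
    by (rule mmon_superset) (use Poly_Mapping.keys_add[of u v] in auto)
  also have "\<dots> = (\<Prod>i\<in>?A. x i ^ lookup u i) * (\<Prod>i\<in>?A. x i ^ lookup v i)"
    by (simp add: lookup_add power_add prod.distrib)
  also have "\<dots> = mmon u x * mmon v x"
    by (simp add: mmon_superset[of ?A u] mmon_superset[of ?A v])
  finally show ?thesis .
qed

lemma mmon_0 [simp]: "mmon 0 x = 1"
  by (simp add: mmon_def)

lemma mmon_single [simp]: "mmon (single i k) x = x i ^ k"
  by (simp add: mmon_def)

lemma mpoly_eval_0 [simp]: "mpoly_eval 0 x = 0"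
  by (simp add: mpoly_eval_mmon)

lemma mpoly_eval_single [simp]: "mpoly_eval (single u c) x = c * mmon u x"
  by (simp add: mpoly_eval_mmon)

lemma mpoly_eval_add: "mpoly_eval (f + g) x = mpoly_eval f x + mpoly_eval g x"
  unfolding mpoly_eval_mmon by (rule setsum_keys_plus_distrib) (simp_all add: ring_distribs)

lemma mpoly_eval_sum: "mpoly_eval (\<Sum>i\<in>S. f i) x = (\<Sum>i\<in>S. mpoly_eval (f i) x)"
  by (induction S rule: infinite_finite_induct) (simp_all add: mpoly_eval_add)

lemma mpoly_eval_uminus: "mpoly_eval (- f) x = - mpoly_eval f x"
  using mpoly_eval_add[of f "- f" x] by (simp add: add_eq_0_iff)

lemma mpoly_eval_diff: "mpoly_eval (f - g) x = mpoly_eval f x - mpoly_eval g x"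
  using mpoly_eval_add[of f "- g" x] by (simp add: mpoly_eval_uminus)

lemma poly_mapping_sum_single:
  "f = (\<Sum>u\<in>keys f. single u (lookup f u))"
proof (rule poly_mapping_eqI)
  fix v
  have "lookup (\<Sum>u\<in>keys f. single u (lookup f u)) v =
      (\<Sum>u\<in>keys f. if u = v then lookup f u else 0)"
    unfolding lookup_sum by (intro sum.cong) (auto simp: lookup_single when_def)
  also have "\<dots> = lookup f v"
    by (auto simp: in_keys_iff)
  finally show "lookup f v =
      lookup (\<Sum>u\<in>keys f. single u (lookup f u)) v" by simp
qed

lemma mpoly_mult_sum:
  "f * g = (\<Sum>u\<in>keys f. \<Sum>v\<in>keys g.
     single (u + v) (lookup f u * lookup g v))"
proof -
  have "f * g = (\<Sum>u\<in>keys f. single u (lookup f u)) *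
      (\<Sum>v\<in>keys g. single v (lookup g v))"
    by (simp flip: poly_mapping_sum_single)
  then show ?thesis unfolding sum_product mult_single .
qed

lemma mpoly_eval_mult: "mpoly_eval (f * g) x = mpoly_eval f x * mpoly_eval g x"
  unfolding mpoly_mult_sum[of f g] mpoly_eval_sum mpoly_eval_single mmon_add
  unfolding mpoly_eval_mmon sum_product by (intro sum.cong refl) (simp add: mult_ac)

lemma mpoly_eval_cong:
  assumes "f \<in> mpoly_ring C l" "\<And>i. i < l \<Longrightarrow> x i = y i"
  shows "mpoly_eval f x = mpoly_eval f y"
proof -
  have "x i = y i" if "u \<in> keys f" "i \<in> keys u" for u i
    using assms that unfolding mpoly_ring_def by blast
  then show ?thesis unfolding mpoly_eval_def by (intro sum.cong prod.cong refl arg_cong2[of _ _ _ _ "(*)"]) auto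
qed

lemma mpoly_ring_single:
  "c \<in> C \<Longrightarrow> 0 \<in> C \<Longrightarrow> keys u \<subseteq> {..<l} \<Longrightarrow> single u c \<in> mpoly_ring C l"
  unfolding mpoly_ring_def by (auto simp: lookup_single when_def)

lemma mpoly_ring_add: "is_subfield C \<Longrightarrow> f \<in> mpoly_ring C l \<Longrightarrow> g \<in> mpoly_ring C l \<Longrightarrow> f + g \<in> mpoly_ring C l"
proof -
  assume C: "is_subfield C" and f: "f \<in> mpoly_ring C l" and g: "g \<in> mpoly_ring C l"
  show ?thesis
    unfolding mpoly_ring_def mem_Collect_eq
  proof (intro conjI ballI allI)
    fix u assume "u \<in> keys (f + g)"
    then have "u \<in> keys f \<or> u \<in> keys g" using Poly_Mapping.keys_add[of f g] by blast
    then show "keys u \<subseteq> {..<l}" using f g unfolding mpoly_ring_def by blast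
  next
    fix u
    show "lookup (f + g) u \<in> C"
      unfolding lookup_add using f g by (intro subfield_add[OF C]) (auto simp: mpoly_ring_def)
  qed
qed

lemma mpoly_ring_uminus: "is_subfield C \<Longrightarrow> f \<in> mpoly_ring C l \<Longrightarrow> - f \<in> mpoly_ring C l"
  unfolding mpoly_ring_def by (auto simp: in_keys_iff intro: subfield_uminus)

lemma mpoly_ring_diff: "is_subfield C \<Longrightarrow> f \<in> mpoly_ring C l \<Longrightarrow> g \<in> mpoly_ring C l \<Longrightarrow> f - g \<in> mpoly_ring C l"
  using mpoly_ring_add[of C f l "- g"] by (simp add: mpoly_ring_uminus)

lemma mpoly_ring_0: "is_subfield C \<Longrightarrow> 0 \<in> mpoly_ring C l"
  unfolding mpoly_ring_def by (auto intro: subfield_0)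

lemma mpoly_ring_sum: "is_subfield C \<Longrightarrow> (\<And>i. i \<in> S \<Longrightarrow> f i \<in> mpoly_ring C l) \<Longrightarrow> (\<Sum>i\<in>S. f i) \<in> mpoly_ring C l"
  by (induction S rule: infinite_finite_induct) (auto intro: mpoly_ring_add mpoly_ring_0)

lemma mpoly_ring_mult:
  assumes C: "is_subfield C" and f: "f \<in> mpoly_ring C l" and g: "g \<in> mpoly_ring C l"
  shows "f * g \<in> mpoly_ring C l"
  unfolding mpoly_mult_sum
proof (intro mpoly_ring_sum[OF C] mpoly_ring_single)
  fix u v assume "u \<in> keys f" "v \<in> keys g"
  then show "keys (u + v) \<subseteq> {..<l}"
    using f g Poly_Mapping.keys_add[of u v] unfolding mpoly_ring_def by blast
qed (use f g C in \<open>auto simp: mpoly_ring_def\<close>)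

lemma mpoly_ring_mono: "l \<le> l' \<Longrightarrow> mpoly_ring C l \<subseteq> mpoly_ring C l'"
  unfolding mpoly_ring_def by fastforce

lemma mpoly_ring_mono_coeffs: "C \<subseteq> C' \<Longrightarrow> mpoly_ring C l \<subseteq> mpoly_ring C' l"
  unfolding mpoly_ring_def by fastforce

lemma mpoly_ring_const: "is_subfield C \<Longrightarrow> c \<in> C \<Longrightarrow> single 0 c \<in> mpoly_ring C l"
  by (rule mpoly_ring_single) (auto intro: subfield_0)

lemma mpoly_ring_var: "is_subfield C \<Longrightarrow> i < l \<Longrightarrow> single (single i k) 1 \<in> mpoly_ring C l"
  by (rule mpoly_ring_single) (auto intro: subfield_0 subfield_1)


section \<open>Partial evaluation: polynomials in one distinguished variable\<close>

definition upoly :: "nat \<Rightarrow> (nat \<Rightarrow> 'a::field) \<Rightarrow> 'a mpoly \<Rightarrow> 'a poly" where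
  "upoly i x f = (\<Sum>u\<in>keys f. monom
     (lookup f u * (\<Prod>j\<in>keys u - {i}. x j ^ lookup u j)) (lookup u i))"

lemma upoly_add: "upoly i x (f + g) = upoly i x f + upoly i x g"
  unfolding upoly_def by (rule setsum_keys_plus_distrib) (simp_all add: ring_distribs add_monom)

lemma upoly_0: "upoly i x 0 = 0"
  by (simp add: upoly_def)

lemma upoly_sum: "upoly i x (\<Sum>j\<in>S. f j) = (\<Sum>j\<in>S. upoly i x (f j))"
  by (induction S rule: infinite_finite_induct) (simp_all add: upoly_add upoly_0)

lemma upoly_single:
  "upoly i x (single u c) = monom
     (c * (\<Prod>j\<in>keys u - {i}. x j ^ lookup u j)) (lookup u i)"
  by (simp add: upoly_def)

lemma mmon_upd:
  "mmon u (x(i := y)) = (\<Prod>j\<in>keys u - {i}. x j ^ lookup u j) * y ^ lookup u i"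
proof (cases "i \<in> keys u")
  case True
  then show ?thesis
    unfolding mmon_def by (simp add: prod.remove[of _ i] mult.commute)
next
  case False
  then have "lookup u i = 0" by (simp add: in_keys_iff)
  moreover have "(\<Prod>j\<in>keys u. (x(i := y)) j ^ lookup u j) =
      (\<Prod>j\<in>keys u - {i}. x j ^ lookup u j)"
    by (rule prod.cong) (use False in auto)
  ultimately show ?thesis unfolding mmon_def by simp
qed

lemma poly_upoly: "poly (upoly i x f) y = mpoly_eval f (x(i := y))"
  unfolding upoly_def mpoly_eval_mmon poly_sum poly_monom mmon_upd by (simp add: mult_ac)

lemma poly_pderiv_upoly: "poly (pderiv (upoly i x f)) y = mpoly_eval (mpoly_deriv i f) (x(i := y))"
proof -
  let ?l = "lookup"
  have lm: "?l (u - single i 1) j = ?l u j - (if j = i then 1 else 0)" for u :: "nat \<Rightarrow>\<^sub>0 nat" and j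
    by (simp add: lookup_minus lookup_single when_def)
  have mm: "mmon (u - single i 1) (x(i := y)) =
      (\<Prod>j\<in>keys u - {i}. x j ^ ?l u j) * y ^ (?l u i - 1)" for u :: "nat \<Rightarrow>\<^sub>0 nat"
  proof -
    have keys: "keys (u - single i 1) - {i} = keys u - {i}"
      by (auto simp: in_keys_iff lm[unfolded One_nat_def])
    have "mmon (u - single i 1) (x(i := y)) =
      (\<Prod>j\<in>keys u - {i}. x j ^ ?l (u - single i 1) j) * y ^ (?l (u - single i 1) i)"
      unfolding mmon_upd keys ..
    also have "(\<Prod>j\<in>keys u - {i}. x j ^ ?l (u - single i 1) j) =
        (\<Prod>j\<in>keys u - {i}. x j ^ ?l u j)"
      by (rule prod.cong) (auto simp: lm[unfolded One_nat_def])
    finally show ?thesis unfolding lm by (simp del: One_nat_def fun_upd_apply)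
  qed
  have pderiv_sum: "pderiv (sum g S) = (\<Sum>u\<in>S. pderiv (g u))" for g :: "(nat \<Rightarrow>\<^sub>0 nat) \<Rightarrow> 'a poly" and S
    by (induction S rule: infinite_finite_induct) (simp_all add: pderiv_add)
  show ?thesis
    unfolding upoly_def mpoly_deriv_def mpoly_eval_sum mpoly_eval_single mm pderiv_sum poly_sum pderiv_monom poly_monom
    by (simp add: mult_ac)
qed

text \<open>The coefficient of the \<open>k\<close>-th power of variable \<open>l\<close>, still as
  a polynomial in the others. It shows that the coefficients of \<open>upoly l x f\<close> are
  polynomial functions of \<open>x\<close> defined over the same field.\<close>

definition mpoly_coeff :: "nat \<Rightarrow> nat \<Rightarrow> 'a::field mpoly \<Rightarrow> 'a mpoly" where
  "mpoly_coeff l k f = (\<Sum>u\<in>{u\<in>keys f. lookup u l = k}.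
     single (u - single l k) (lookup f u))"

lemma mpoly_coeff_in:
  assumes C: "is_subfield C" and f: "f \<in> mpoly_ring C (Suc l)"
  shows "mpoly_coeff l k f \<in> mpoly_ring C l"
  unfolding mpoly_coeff_def
proof (intro mpoly_ring_sum[OF C] mpoly_ring_single subfield_0[OF C])
  fix u assume u: "u \<in> {u\<in>keys f. lookup u l = k}"
  then have "keys u \<subseteq> {..<Suc l}" using f unfolding mpoly_ring_def by blast
  then have "i < l" if "i \<in> keys (u - single l k)" for i
  proof -
    have "lookup u i - (if i = l then k else 0) \<noteq> 0"
      using that by (cases "i = l") (auto simp: in_keys_iff lookup_minus lookup_single when_def)
    then have "i \<noteq> l" "i \<in> keys u" using u by (auto simp: in_keys_iff)
    then show ?thesis using \<open>keys u \<subseteq> {..<Suc l}\<close> by (auto simp: less_Suc_eq)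
  qed
  then show "keys (u - single l k) \<subseteq> {..<l}" by blast
  show "lookup f u \<in> C" using f unfolding mpoly_ring_def by blast
qed

lemma coeff_upoly: "coeff (upoly l x f) k = mpoly_eval (mpoly_coeff l k f) x"
proof -
  have mm: "mmon (u - single l k) x = (\<Prod>j\<in>keys u - {l}. x j ^ lookup u j)"
    if "lookup u l = k" for u
  proof -
    have l: "lookup (u - single l k) j = (if j = l then 0 else lookup u j)" for j
      using that by (simp add: lookup_minus lookup_single when_def)
    have keys: "keys (u - single l k) = keys u - {l}"
      by (auto simp: in_keys_iff l split: if_splits)
    show ?thesis unfolding mmon_def keys by (rule prod.cong) (auto simp: l)
  qed
  have "coeff (upoly l x f) k = (\<Sum>u\<in>keys f. if lookup u l = k
      then lookup f u * (\<Prod>j\<in>keys u - {l}. x j ^ lookup u j) else 0)"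
    unfolding upoly_def coeff_sum by (intro sum.cong) auto
  also have "\<dots> = (\<Sum>u\<in>{u\<in>keys f. lookup u l = k}.
      lookup f u * (\<Prod>j\<in>keys u - {l}. x j ^ lookup u j))"
    by (rule sum.mono_neutral_cong_right) auto
  also have "\<dots> = mpoly_eval (mpoly_coeff l k f) x"
    unfolding mpoly_coeff_def mpoly_eval_sum mpoly_eval_single by (rule sum.cong) (auto simp: mm)
  finally show ?thesis .
qed

lemma upoly_mult_var:
  assumes "f \<in> mpoly_ring C l"
  shows "upoly l x (f * single (single l k) 1) = monom (mpoly_eval f x) k"
proof -
  have "upoly l x (f * single (single l k) 1) =
      (\<Sum>u\<in>keys f. upoly l x (single (u + single l k) (lookup f u)))"
    unfolding mpoly_mult_sum[of f] by (simp add: upoly_sum)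
  also have "\<dots> = (\<Sum>u\<in>keys f. monom (lookup f u * mmon u x) k)"
  proof (rule sum.cong[OF refl])
    fix u assume "u \<in> keys f"
    then have "l \<notin> keys u" using assms unfolding mpoly_ring_def by auto
    then have l: "lookup (u + single l k) j = (if j = l then k else lookup u j)" for j
      by (auto simp: lookup_add lookup_single when_def in_keys_iff)
    have keys: "keys (u + single l k) - {l} = keys u"
      using \<open>l \<notin> keys u\<close> by (auto simp: in_keys_iff l split: if_splits)
    have "(\<Prod>j\<in>keys u. x j ^ lookup (u + single l k) j) = mmon u x"
      unfolding mmon_def by (rule prod.cong) (use \<open>l \<notin> keys u\<close> in \<open>auto simp: l\<close>)
    then show "upoly l x (single (u + single l k) (lookup f u)) =
        monom (lookup f u * mmon u x) k"
      unfolding upoly_single keys by (simp add: l)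
  qed
  also have "\<dots> = monom (mpoly_eval f x) k"
    unfolding mpoly_eval_mmon by (simp add: poly_eq_iff coeff_sum)
  finally show ?thesis .
qed

section \<open>The ring \<open>C[e]\<close> of values at a point\<close>

definition val_ring :: "'a::field set \<Rightarrow> nat \<Rightarrow> (nat \<Rightarrow> 'a) \<Rightarrow> 'a set" where
  "val_ring C l e = (\<lambda>f. mpoly_eval f e) ` mpoly_ring C l"

lemma
  assumes C: "is_subfield C"
  shows val_ring_add: "x \<in> val_ring C l e \<Longrightarrow> y \<in> val_ring C l e \<Longrightarrow> x + y \<in> val_ring C l e"
    and val_ring_mult: "x \<in> val_ring C l e \<Longrightarrow> y \<in> val_ring C l e \<Longrightarrow> x * y \<in> val_ring C l e"
    and val_ring_uminus: "x \<in> val_ring C l e \<Longrightarrow> - x \<in> val_ring C l e"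
    and val_ring_const: "c \<in> C \<Longrightarrow> c \<in> val_ring C l e"
    and val_ring_var: "i < l \<Longrightarrow> e i \<in> val_ring C l e"
proof -
  show "x \<in> val_ring C l e \<Longrightarrow> y \<in> val_ring C l e \<Longrightarrow> x + y \<in> val_ring C l e"
    unfolding val_ring_def by (auto simp flip: mpoly_eval_add intro!: imageI mpoly_ring_add[OF C])
  show "x \<in> val_ring C l e \<Longrightarrow> y \<in> val_ring C l e \<Longrightarrow> x * y \<in> val_ring C l e"
    unfolding val_ring_def by (auto simp flip: mpoly_eval_mult intro!: imageI mpoly_ring_mult[OF C])
  show "x \<in> val_ring C l e \<Longrightarrow> - x \<in> val_ring C l e"
    unfolding val_ring_def by (auto simp flip: mpoly_eval_uminus intro!: imageI mpoly_ring_uminus[OF C])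
  show "c \<in> val_ring C l e" if "c \<in> C"
    unfolding val_ring_def using mpoly_ring_const[OF C that] by (intro image_eqI[of _ _ "single 0 c"]) simp_all
  show "e i \<in> val_ring C l e" if "i < l"
    unfolding val_ring_def using mpoly_ring_var[OF C that, of 1]
    by (intro image_eqI[of _ _ "single (single i 1) 1"]) simp_all
qed


section \<open>Extending points of a locus by one coordinate\<close>

text \<open>\<open>e'\<close> lies on the locus of \<open>e\<close>; only the first \<open>l\<close> coordinates matter.\<close>

definition specializes :: "'a::field set \<Rightarrow> nat \<Rightarrow> (nat \<Rightarrow> 'a) \<Rightarrow> (nat \<Rightarrow> 'a) \<Rightarrow> bool" where
  "specializes C l e e' \<longleftrightarrow> (\<forall>f\<in>mpoly_ring C l. mpoly_eval f e = 0 \<longrightarrow> mpoly_eval f e' = 0)"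

text \<open>Both polynomials come from one polynomial with coefficients in \<open>C[X]\<close>,
  evaluated at \<open>e\<close> and at \<open>e'\<close>. This is a relation and not a map, because
  \<open>h'\<close> is determined by \<open>h\<close> only once \<open>e'\<close> is known to lie on
  the locus.\<close>

definition spec_poly :: "'a::field set \<Rightarrow> nat \<Rightarrow> (nat \<Rightarrow> 'a) \<Rightarrow> (nat \<Rightarrow> 'a) \<Rightarrow> 'a poly \<Rightarrow> 'a poly \<Rightarrow> bool" where
  "spec_poly C l e e' h h' \<longleftrightarrow>
     (\<forall>k. \<exists>f\<in>mpoly_ring C l. coeff h k = mpoly_eval f e \<and> coeff h' k = mpoly_eval f e')"

lemma spec_poly_upoly:
  assumes "is_subfield C" "f \<in> mpoly_ring C (Suc l)"
  shows "spec_poly C l e e' (upoly l e f) (upoly l e' f)"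
  unfolding spec_poly_def coeff_upoly using mpoly_coeff_in[OF assms] by blast

text \<open>One step of pseudo-division, carried out by the same formula at \<open>e\<close> and at
  \<open>e'\<close>.\<close>

lemma spec_poly_reduce:
  assumes C: "is_subfield C" and h: "spec_poly C l e e' h h'" and g: "spec_poly C l e e' g g'"
  shows "spec_poly C l e e'
    (smult (coeff g m) h - monom (coeff h n) r * g)
    (smult (coeff g' m) h' - monom (coeff h' n) r * g')"
  unfolding spec_poly_def
proof
  fix k
  obtain fh where fh: "fh \<in> mpoly_ring C l" "coeff h k = mpoly_eval fh e" "coeff h' k = mpoly_eval fh e'"
    using h unfolding spec_poly_def by blast
  obtain fn where fn: "fn \<in> mpoly_ring C l" "coeff h n = mpoly_eval fn e" "coeff h' n = mpoly_eval fn e'"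
    using h unfolding spec_poly_def by blast
  obtain fm where fm: "fm \<in> mpoly_ring C l" "coeff g m = mpoly_eval fm e" "coeff g' m = mpoly_eval fm e'"
    using g unfolding spec_poly_def by blast
  obtain fg where fg: "fg \<in> mpoly_ring C l" "coeff g (k - r) = mpoly_eval fg e" "coeff g' (k - r) = mpoly_eval fg e'"
    using g unfolding spec_poly_def by blast
  let ?f = "fm * fh - (if k < r then 0 else fn * fg)"
  have "?f \<in> mpoly_ring C l"
    using fh(1) fn(1) fm(1) fg(1) by (auto intro!: mpoly_ring_diff[OF C] mpoly_ring_mult[OF C] mpoly_ring_0[OF C])
  moreover have "mpoly_eval ?f x = mpoly_eval fm x * mpoly_eval fh x - (if k < r then 0 else mpoly_eval fn x * mpoly_eval fg x)" for x
    by (simp add: mpoly_eval_diff mpoly_eval_mult)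
  ultimately show "\<exists>f\<in>mpoly_ring C l.
      coeff (smult (coeff g m) h - monom (coeff h n) r * g) k = mpoly_eval f e \<and>
      coeff (smult (coeff g' m) h' - monom (coeff h' n) r * g') k = mpoly_eval f e'"
    by (intro bexI[of _ ?f]) (simp_all add: coeff_monom_mult fh fn fm fg)
qed

definition val_poly :: "'a::field set \<Rightarrow> nat \<Rightarrow> (nat \<Rightarrow> 'a) \<Rightarrow> 'a poly \<Rightarrow> bool" where
  "val_poly C l e h \<longleftrightarrow> (\<forall>k. coeff h k \<in> val_ring C l e)"

lemma spec_poly_imp_val_poly: "spec_poly C l e e' h h' \<Longrightarrow> val_poly C l e h"
  unfolding spec_poly_def val_poly_def val_ring_def by blast

lemma spec_poly_self: "val_poly C l e h \<Longrightarrow> spec_poly C l e e h h"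
  unfolding spec_poly_def val_poly_def val_ring_def by blast

text \<open>In particular the degree cannot rise under specialization.\<close>

lemma specializes_coeff_0:
  assumes "specializes C l e e'" "spec_poly C l e e' h h'" "coeff h k = 0"
  shows "coeff h' k = 0"
  using assms unfolding specializes_def spec_poly_def by metis

text \<open>
  Division by \<open>g\<close> up to powers of its leading coefficient. The identities that it produces hold along
  the whole locus, so only the leading coefficient has to stay nonzero at \<open>e'\<close>.
\<close>

lemma spec_poly_pseudo_division:
  assumes C: "is_subfield C" and spec: "specializes C l e e'"
    and g: "spec_poly C l e e' g g'" "poly g d = 0"
    and min: "\<And>h. val_poly C l e h \<Longrightarrow> h \<noteq> 0 \<Longrightarrow> poly h d = 0 \<Longrightarrow> degree g \<le> degree h"
    and h: "spec_poly C l e e' h h'" "poly h d = 0"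
  defines "D \<equiv> degree g"
  shows "\<exists>k q q'. smult (coeff g D ^ k) h = q * g \<and>
    smult (coeff g' D ^ k) h' = q' * g'"
proof -
  \<comment> \<open>Induction on a bound for the degree of \<open>h\<close>, which on the locus is a
    bound for \<open>h'\<close> as well, whereas the two degrees may differ.\<close>
  have main: "\<exists>k q q'. smult (coeff g D ^ k) h = q * g \<and>
      smult (coeff g' D ^ k) h' = q' * g'"
    if "spec_poly C l e e' h h'" "\<forall>k\<ge>n. coeff h k = 0" "poly h d = 0" for n h h'
    using that
  proof (induction n arbitrary: h h')
    case 0
    then have "coeff h' k = 0" for k using specializes_coeff_0[OF spec 0(1)] by blast
    then have "h = 0" "h' = 0" using 0(2) by (simp_all add: poly_eq_iff)
    then show ?case by (intro exI[of _ 0]) simp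
  next
    case (Suc n)
    show ?case
    proof (cases "coeff h n = 0")
      case True
      have "\<forall>k\<ge>n. coeff h k = 0"
        using True Suc.prems(2) by (metis le_antisym not_less_eq_eq)
      then show ?thesis using Suc.IH[OF Suc.prems(1) _ Suc.prems(3)] by blast
    next
      case False
      then have "h \<noteq> 0" by auto
      have "degree h \<le> n"
        using Suc.prems(2) by (intro degree_le) auto
      \<comment> \<open>Minimality of \<open>g\<close>: a nonzero \<open>h\<close> vanishing at
        \<open>d\<close> cannot have degree below \<open>D\<close>, so the division leaves no
        remainder.\<close>
      then have Dn: "D \<le> n"
        using min[OF spec_poly_imp_val_poly[OF Suc.prems(1)] \<open>h \<noteq> 0\<close> Suc.prems(3)] by (simp add: D_def)
      define r where "r = monom (coeff h n) (n - D)"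
      define r' where "r' = monom (coeff h' n) (n - D)"
      let ?h = "smult (coeff g D) h - r * g"
      let ?h' = "smult (coeff g' D) h' - r' * g'"
      have "coeff ?h k = 0" if "n \<le> k" for k
      proof (cases "k = n")
        case True
        then show ?thesis using Dn by (simp add: r_def coeff_monom_mult)
      next
        case False
        then have "coeff h k = 0" "coeff g (k - (n - D)) = 0"
          using Suc.prems(2) that Dn by (auto intro!: coeff_eq_0 simp: D_def)
        then show ?thesis by (simp add: r_def coeff_monom_mult)
      qed
      moreover have "spec_poly C l e e' ?h ?h'"
        unfolding r_def r'_def by (rule spec_poly_reduce[OF C Suc.prems(1) g(1)])
      moreover have "poly ?h d = 0" using Suc.prems(3) g(2) by simp
      ultimately obtain k q q' where q: "smult (coeff g D ^ k) ?h = q * g"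
          "smult (coeff g' D ^ k) ?h' = q' * g'"
        using Suc.IH[of ?h ?h'] by blast
      have "smult (x ^ Suc k) u = (v + smult (x ^ k) w) * f"
        if "smult (x ^ k) (smult x u - w * f) = v * f" for x and u v w f :: "'a poly"
        using that by (simp add: smult_diff_right ring_distribs mult.commute[of x] diff_eq_eq)
      from this[OF q(1)] this[OF q(2)] show ?thesis by blast
    qed
  qed
  show ?thesis
    by (rule main[OF h(1) _ h(2), of "Suc (degree h)"]) (auto intro: coeff_eq_0)
qed

text \<open>If \<open>f\<close> vanishes at \<open>(e, d)\<close>, a power of the leading
  coefficient of \<open>g\<close> times \<open>f\<close> is divisible by \<open>g\<close>, and
  likewise at \<open>e'\<close>. There \<open>g'\<close> vanishes at \<open>d'\<close> while the
  factor in front of \<open>f\<close> is nonzero.\<close>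

lemma specializes_extend_algebraic:
  assumes C: "is_subfield C" and spec: "specializes C l e e'"
    and g: "spec_poly C l e e' g g'" "poly g d = 0" "poly g' d' = 0"
      "coeff g' (degree g) \<noteq> 0"
    and min: "\<And>h. val_poly C l e h \<Longrightarrow> h \<noteq> 0 \<Longrightarrow> poly h d = 0 \<Longrightarrow> degree g \<le> degree h"
  shows "specializes C (Suc l) (e(l := d)) (e'(l := d'))"
  unfolding specializes_def
proof (intro ballI impI)
  fix f assume f: "f \<in> mpoly_ring C (Suc l)" "mpoly_eval f (e(l := d)) = 0"
  have "poly (upoly l e f) d = 0" unfolding poly_upoly by (rule f(2))
  from spec_poly_pseudo_division[OF C spec g(1,2) min spec_poly_upoly[OF C f(1)] this]
  obtain k q' where "smult (coeff g' (degree g) ^ k) (upoly l e' f) = q' * g'" by blast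
  from arg_cong[OF this, of "\<lambda>h. poly h d'"] show "mpoly_eval f (e'(l := d')) = 0"
    using g(3,4) by (simp add: poly_upoly)
qed

text \<open>If \<open>f\<close> vanishes at \<open>(e, d)\<close>, its coefficients with respect to
  the new variable vanish at \<open>e\<close>, hence at \<open>e'\<close>; so any \<open>d'\<close>
  is allowed.\<close>

lemma specializes_extend_transcendental:
  assumes C: "is_subfield C" and spec: "specializes C l e e'"
    and trans: "\<And>h. val_poly C l e h \<Longrightarrow> poly h d = 0 \<Longrightarrow> h = 0"
  shows "specializes C (Suc l) (e(l := d)) (e'(l := d'))"
  unfolding specializes_def
proof (intro ballI impI)
  fix f assume f: "f \<in> mpoly_ring C (Suc l)" "mpoly_eval f (e(l := d)) = 0"
  have sp: "spec_poly C l e e' (upoly l e f) (upoly l e' f)" by (rule spec_poly_upoly[OF C f(1)])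
  have "upoly l e f = 0"
    using trans[OF spec_poly_imp_val_poly[OF sp]] f(2) by (simp add: poly_upoly)
  then have "coeff (upoly l e' f) k = 0" for k
    using specializes_coeff_0[OF spec sp, of k] by simp
  then have "upoly l e' f = 0" by (simp add: poly_eq_iff)
  then have "poly (upoly l e' f) d' = 0" by simp
  then show "mpoly_eval f (e'(l := d')) = 0" by (simp add: poly_upoly)
qed

definition simple_root_over :: "'a::field set \<Rightarrow> nat \<Rightarrow> (nat \<Rightarrow> 'a) \<Rightarrow> 'a \<Rightarrow> bool" where
  "simple_root_over C l e d \<longleftrightarrow> (\<exists>h. val_poly C l e h \<and> poly h d = 0 \<and> poly (pderiv h) d \<noteq> 0)"

text \<open>Pseudo-division needs a polynomial of minimal degree and the implicit function theorem a
  simple root. One polynomial has both: if \<open>d\<close> were a multiple root of the minimal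
  \<open>g\<close>, it would be a multiple root of \<open>h0\<close>, a multiple of which is
  divisible by \<open>g\<close>.\<close>

lemma simple_root_minimal:
  assumes C: "is_subfield C" and d: "simple_root_over C l e d"
  obtains g where "val_poly C l e g" "g \<noteq> 0" "poly g d = 0" "poly (pderiv g) d \<noteq> 0"
    "\<And>h. val_poly C l e h \<Longrightarrow> h \<noteq> 0 \<Longrightarrow> poly h d = 0 \<Longrightarrow> degree g \<le> degree h"
proof -
  obtain h0 where h0: "val_poly C l e h0" "poly h0 d = 0" "poly (pderiv h0) d \<noteq> 0"
    using d unfolding simple_root_over_def by blast
  then have "h0 \<noteq> 0" by auto
  define P where "P h \<longleftrightarrow> val_poly C l e h \<and> h \<noteq> 0 \<and> poly h d = 0" for h
  have "P h0" unfolding P_def using h0 \<open>h0 \<noteq> 0\<close> by blast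
  then obtain g where g: "P g" "\<forall>h. P h \<longrightarrow> degree g \<le> degree h"
    using ex_has_least_nat[of P h0 degree] by blast
  have "poly (pderiv g) d \<noteq> 0"
  proof
    assume g': "poly (pderiv g) d = 0"
    have gv: "val_poly C l e g" "poly g d = 0" "g \<noteq> 0" using g(1) unfolding P_def by auto
    have "specializes C l e e" unfolding specializes_def by blast
    from spec_poly_pseudo_division[OF C this spec_poly_self[OF gv(1)] gv(2) _ spec_poly_self[OF h0(1)] h0(2)]
    obtain k q where "smult (Polynomial.lead_coeff g ^ k) h0 = q * g"
      using g(2) unfolding P_def by blast
    from arg_cong[OF this, of "\<lambda>h. poly (pderiv h) d"] show False
      using g' gv h0(3) by (simp add: pderiv_smult pderiv_mult)
  qed
  then show ?thesis using that[of g] g unfolding P_def by blast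
qed


section \<open>Local solvability\<close>

text \<open>The ball about \<open>x \<noteq> 0\<close> whose radius is the size of \<open>x\<close>
  misses 0. The size is taken at \<open>- x\<close> because this is the value of
  \<open>y - x\<close> at \<open>y = 0\<close>.\<close>

lemma V_topology_punctured_open:
  fixes \<tau> :: "'a::field topology"
  assumes "V_topology TYPE('g::linordered_ab_group_add) \<tau>"
  shows "topspace \<tau> = UNIV" "openin \<tau> {y. y \<noteq> 0}"
proof -
  have "openin \<tau> UNIV \<and> openin \<tau> {y. y \<noteq> 0}"
    using assms unfolding V_topology_def
  proof (elim disjE exE conjE)
    fix N assume N: "abs_value N" "induced_by_abs_value \<tau> N"
    have "\<exists>\<epsilon>>0. \<forall>y. N (y - x) < \<epsilon> \<longrightarrow> y \<in> {y. y \<noteq> 0}" if "x \<in> {y. y \<noteq> 0}" for x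
    proof (intro exI[of _ "N (- x)"] conjI allI impI)
      show "0 < N (- x)" using N(1) that unfolding abs_value_def by (metis less_eq_real_def mem_Collect_eq neg_equal_0_iff_equal)
      show "y \<in> {y. y \<noteq> 0}" if "N (y - x) < N (- x)" for y using that by auto
    qed
    then show ?thesis
      using N(2) unfolding induced_by_abs_value_def by (auto intro: exI[of _ 1])
  next
    fix v :: "'a \<Rightarrow> 'g" assume v: "induced_by_valuation \<tau> v"
    have "\<exists>\<gamma>. \<forall>y. y = x \<or> \<gamma> < v (y - x) \<longrightarrow> y \<in> {y. y \<noteq> 0}" if "x \<in> {y. y \<noteq> 0}" for x
      by (intro exI[of _ "v (- x)"]) (use that in auto)
    then show ?thesis
      using v unfolding induced_by_valuation_def by auto
  qed
  then show "topspace \<tau> = UNIV" "openin \<tau> {y. y \<noteq> 0}"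
    using openin_subset by fastforce+
qed

text \<open>The implicit function theorem comes with its own neighbourhood \<open>V\<close> of
  \<open>d\<close>; continuity of the implicit function, which maps \<open>e\<close> to
  \<open>d\<close>, confines the root to the prescribed \<open>W\<close>.\<close>

lemma polynomial_IFT_local_root:
  assumes T: "topspace \<tau> = UNIV" and ift: "polynomial_IFT \<tau>"
    and f: "f \<in> mpoly_ring UNIV (Suc m)" and e: "e \<in> tuples m"
    and d: "mpoly_eval f (e(m := d)) = 0" "mpoly_eval (mpoly_deriv m f) (e(m := d)) \<noteq> 0"
    and W: "openin \<tau> W" "d \<in> W"
  obtains P where "openin (power_topology \<tau> m) P" "e \<in> P"
    "\<And>x. x \<in> P \<Longrightarrow> \<exists>y\<in>W. mpoly_eval f (x(m := y)) = 0"
proof -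
  have "\<exists>U V g. openin (power_topology \<tau> m) U \<and> e \<in> U \<and> openin \<tau> V \<and> d \<in> V \<and>
      continuous_map (subtopology (power_topology \<tau> m) U) (subtopology \<tau> V) g \<and>
      {(x, y). x \<in> U \<and> y \<in> V \<and> mpoly_eval f (x(m := y)) = 0} = {(x, y). x \<in> U \<and> y = g x}"
    using ift f e d unfolding polynomial_IFT_def by blast
  then obtain U V g where UV: "openin (power_topology \<tau> m) U" "e \<in> U" "openin \<tau> V" "d \<in> V"
    and g: "continuous_map (subtopology (power_topology \<tau> m) U) (subtopology \<tau> V) g"
    and eq: "{(x, y). x \<in> U \<and> y \<in> V \<and> mpoly_eval f (x(m := y)) = 0} = {(x, y). x \<in> U \<and> y = g x}"
    by (elim exE conjE)
  have root: "mpoly_eval f (x(m := g x)) = 0" if "x \<in> U" for x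
  proof -
    have "(x, g x) \<in> {(x, y). x \<in> U \<and> y \<in> V \<and> mpoly_eval f (x(m := y)) = 0}"
      unfolding eq using that by simp
    then show ?thesis by simp
  qed
  have "(e, d) \<in> {(x, y). x \<in> U \<and> y = g x}"
    unfolding eq[symmetric] using UV(2,4) d(1) by simp
  then have ge: "g e = d" by simp
  let ?P = "{x \<in> topspace (subtopology (power_topology \<tau> m) U). g x \<in> V \<inter> W}"
  have "openin (subtopology \<tau> V) (V \<inter> W)"
    using openin_subtopology_Int2[OF W(1), of V] by simp
  then have "openin (subtopology (power_topology \<tau> m) U) ?P"
    by (rule openin_continuous_map_preimage[OF g])
  then have P: "openin (power_topology \<tau> m) ?P"
    using UV(1) by (rule openin_trans_full)
  show ?thesis
  proof (rule that[OF P])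
    show "e \<in> ?P" using UV(2,4) W(2) ge e by (simp add: T)
    show "\<exists>y\<in>W. mpoly_eval f (x(m := y)) = 0" if "x \<in> ?P" for x
      using that root[of x] by (intro bexI[of _ "g x"]) auto
  qed
qed

text \<open>Continuity of a polynomial \<open>f\<close> is the implicit function theorem for \<open>Y - f\<close>.\<close>

lemma mpoly_nonzero_open:
  assumes T: "topspace \<tau> = UNIV" "openin \<tau> {y. y \<noteq> 0}" and ift: "polynomial_IFT \<tau>"
    and f: "f \<in> mpoly_ring UNIV l"
  shows "openin (power_topology \<tau> l) {x \<in> tuples l. mpoly_eval f x \<noteq> 0}"
proof (subst openin_subopen, intro ballI)
  fix e assume e: "e \<in> {x \<in> tuples l. mpoly_eval f x \<noteq> 0}"
  let ?F = "single (single l 1) 1 - f"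
  have F: "?F \<in> mpoly_ring UNIV (Suc l)"
    using f mpoly_ring_mono[of l "Suc l" UNIV] mpoly_ring_var[OF subfield_UNIV, of l "Suc l" 1]
    by (intro mpoly_ring_diff) auto
  have ev: "mpoly_eval ?F (x(l := y)) = y - mpoly_eval f x" for x y
    using mpoly_eval_cong[OF f, of "x(l := y)" x] by (simp add: mpoly_eval_diff)
  have up: "upoly l x ?F = monom 1 1 - [:mpoly_eval f x:]" for x
  proof -
    have "upoly l x (single (single l 1) 1) = monom 1 1"
      by (simp add: upoly_single)
    moreover have "upoly l x f = [:mpoly_eval f x:]"
      using upoly_mult_var[OF f, of x 0] by (simp add: monom_0)
    moreover have "upoly l x ?F + upoly l x f = upoly l x (single (single l 1) 1)"
      unfolding upoly_add[symmetric] by simp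
    ultimately show ?thesis by (simp add: eq_diff_eq)
  qed
  have "mpoly_eval (mpoly_deriv l ?F) (e(l := mpoly_eval f e)) = 1"
    unfolding poly_pderiv_upoly[symmetric] up by (simp add: pderiv_diff pderiv_monom poly_monom pderiv_pCons)
  then have deriv: "mpoly_eval (mpoly_deriv l ?F) (e(l := mpoly_eval f e)) \<noteq> 0" by (simp only: one_neq_zero not_False_eq_True)
  have root: "mpoly_eval ?F (e(l := mpoly_eval f e)) = 0" by (simp only: ev diff_self)
  have e': "e \<in> tuples l" "mpoly_eval f e \<in> {y. y \<noteq> 0}" using e by auto
  obtain P where P: "openin (power_topology \<tau> l) P" "e \<in> P"
    "\<And>x. x \<in> P \<Longrightarrow> \<exists>y\<in>{y. y \<noteq> 0}. mpoly_eval ?F (x(l := y)) = 0"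
    using polynomial_IFT_local_root[OF T(1) ift F e'(1) root deriv T(2) e'(2)] by blast
  have "mpoly_eval f x \<noteq> 0" if "x \<in> P" for x
    using P(3)[OF that] unfolding ev by auto
  moreover have "P \<subseteq> tuples l"
    using openin_subset[OF P(1)] by (simp add: T(1))
  ultimately show "\<exists>W. openin (power_topology \<tau> l) W \<and> e \<in> W \<and> W \<subseteq> {x \<in> tuples l. mpoly_eval f x \<noteq> 0}"
    using P(1,2) by blast
qed

text \<open>Points are functions on all naturals, so that a coordinate is appended by an update;
  \<open>restrict\<close> cuts them down only where the topology is concerned.\<close>

lemma power_topology_box:
  assumes T: "topspace \<tau> = UNIV" and V: "openin (power_topology \<tau> (Suc l)) V" "restrict (e(l := d)) {..<Suc l} \<in> V"
  obtains U W where "openin (power_topology \<tau> l) U" "restrict e {..<l} \<in> U" "openin \<tau> W" "d \<in> W"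
    "\<And>e' d'. restrict e' {..<l} \<in> U \<Longrightarrow> d' \<in> W \<Longrightarrow> restrict (e'(l := d')) {..<Suc l} \<in> V"
proof -
  have "\<exists>B. finite {i \<in> {..<Suc l}. B i \<noteq> topspace \<tau>} \<and> (\<forall>i\<in>{..<Suc l}. openin \<tau> (B i)) \<and>
      restrict (e(l := d)) {..<Suc l} \<in> Pi\<^sub>E {..<Suc l} B \<and> Pi\<^sub>E {..<Suc l} B \<subseteq> V"
    using bspec[OF V(1)[unfolded openin_product_topology_alt] V(2)] .
  then obtain B where B_open: "\<forall>i\<in>{..<Suc l}. openin \<tau> (B i)"
    and B: "restrict (e(l := d)) {..<Suc l} \<in> Pi\<^sub>E {..<Suc l} B" "Pi\<^sub>E {..<Suc l} B \<subseteq> V"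
    by (elim exE conjE)
  have fin: "openin \<tau> (B i)" if "i < Suc l" for i using B_open that by simp
  show ?thesis
  proof (rule that)
    show "openin (power_topology \<tau> l) (Pi\<^sub>E {..<l} B)"
      unfolding openin_PiE_gen using fin by auto
    show "restrict e {..<l} \<in> Pi\<^sub>E {..<l} B"
    proof (rule restrict_PiE_iff[THEN iffD2], intro ballI)
      fix i assume "i \<in> {..<l}"
      then show "e i \<in> B i" using PiE_mem[OF B(1), of i] by simp
    qed
    show "openin \<tau> (B l)" "d \<in> B l" using fin PiE_mem[OF B(1), of l] by simp_all
    fix e' d' assume e': "restrict e' {..<l} \<in> Pi\<^sub>E {..<l} B" "d' \<in> B l"
    have "(e'(l := d')) i \<in> B i" if "i \<in> {..<Suc l}" for i
      using e' PiE_mem[OF e'(1), of i] that by (cases "i = l") auto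
    then have "restrict (e'(l := d')) {..<Suc l} \<in> Pi\<^sub>E {..<Suc l} B"
      by (rule restrict_PiE_iff[THEN iffD2, OF ballI])
    then show "restrict (e'(l := d')) {..<Suc l} \<in> V" using B(2) by blast
  qed
qed

text \<open>Either \<open>d\<close> is transcendental over \<open>C[e]\<close>, or it is separably
  algebraic over the fraction field of \<open>C[e]\<close>.\<close>

definition extendable :: "'a::field set \<Rightarrow> nat \<Rightarrow> (nat \<Rightarrow> 'a) \<Rightarrow> 'a \<Rightarrow> bool" where
  "extendable C l e d \<longleftrightarrow> (\<forall>h. val_poly C l e h \<longrightarrow> poly h d = 0 \<longrightarrow> h = 0) \<or> simple_root_over C l e d"

lemma locus_extension_step:
  assumes T: "topspace \<tau> = UNIV" "openin \<tau> {y. y \<noteq> 0}" and ift: "polynomial_IFT \<tau>"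
    and C: "is_subfield C" and d: "extendable C l e d"
    and V: "openin (power_topology \<tau> (Suc l)) V" "restrict (e(l := d)) {..<Suc l} \<in> V"
  shows "\<exists>U. openin (power_topology \<tau> l) U \<and> restrict e {..<l} \<in> U \<and>
    (\<forall>e'. restrict e' {..<l} \<in> U \<and> specializes C l e e' \<longrightarrow>
      (\<exists>d'. restrict (e'(l := d')) {..<Suc l} \<in> V \<and> specializes C (Suc l) (e(l := d)) (e'(l := d'))))"
proof -
  obtain U1 W where U1: "openin (power_topology \<tau> l) U1" "restrict e {..<l} \<in> U1" and W: "openin \<tau> W" "d \<in> W"
    and UW: "\<And>e' d'. restrict e' {..<l} \<in> U1 \<Longrightarrow> d' \<in> W \<Longrightarrow> restrict (e'(l := d')) {..<Suc l} \<in> V"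
    by (rule power_topology_box[OF T(1) V]) blast
  show ?thesis
  proof (cases "simple_root_over C l e d")
    case False
    then have trans: "h = 0" if "val_poly C l e h" "poly h d = 0" for h
      using d that unfolding extendable_def by blast
    show ?thesis
    proof (intro exI[of _ U1] conjI U1 allI impI)
      fix e' assume e': "restrict e' {..<l} \<in> U1 \<and> specializes C l e e'"
      then show "\<exists>d'. restrict (e'(l := d')) {..<Suc l} \<in> V \<and> specializes C (Suc l) (e(l := d)) (e'(l := d'))"
        using specializes_extend_transcendental[OF C _ trans] UW[of e' d] W(2) by blast
    qed
  next
    case True
    obtain g where g: "val_poly C l e g" "g \<noteq> 0" "poly g d = 0" "poly (pderiv g) d \<noteq> 0"
      "\<And>h. val_poly C l e h \<Longrightarrow> h \<noteq> 0 \<Longrightarrow> poly h d = 0 \<Longrightarrow> degree g \<le> degree h"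
      by (rule simple_root_minimal[OF C True]) blast
    let ?D = "degree g"
    have "\<forall>k. \<exists>f\<in>mpoly_ring C l. coeff g k = mpoly_eval f e"
      using g(1) unfolding val_poly_def val_ring_def by blast
    \<comment> \<open>Lifts of the coefficients of \<open>g\<close> to polynomials over
      \<open>C\<close>. Only those up to the degree of \<open>g\<close> enter \<open>f\<close>, so
      the degree in the new variable is bounded at every point.\<close>
    then obtain G where G: "\<And>k. G k \<in> mpoly_ring C l" "\<And>k. coeff g k = mpoly_eval (G k) e"
      by metis
    define f where "f = (\<Sum>k\<le>?D. G k * single (single l k) 1)"
    have fC: "f \<in> mpoly_ring C (Suc l)"
      unfolding f_def using G(1) mpoly_ring_mono[of l "Suc l" C]
      by (intro mpoly_ring_sum[OF C] mpoly_ring_mult[OF C] mpoly_ring_var[OF C]) auto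
    have up: "upoly l x f = (\<Sum>k\<le>?D. monom (mpoly_eval (G k) x) k)" for x
      unfolding f_def upoly_sum upoly_mult_var[OF G(1)] ..
    have upg: "upoly l e f = g"
      unfolding up G(2)[symmetric] by (rule poly_as_sum_of_monoms)
    have coeff_up: "coeff (upoly l x f) k = (if k \<le> ?D then mpoly_eval (G k) x else 0)" for x k
      unfolding up by (simp add: coeff_sum)
    have cong: "mpoly_eval h (restrict x {..<l}) = mpoly_eval h x" if "h \<in> mpoly_ring D l" for h x D
      by (rule mpoly_eval_cong[OF that]) simp
    have cong': "mpoly_eval f ((restrict x {..<l})(l := y)) = mpoly_eval f (x(l := y))" for x y
      by (rule mpoly_eval_cong[OF fC]) auto
    have up_cong: "upoly l (restrict x {..<l}) f = upoly l x f" for x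
      unfolding up by (intro sum.cong refl) (simp add: cong[OF G(1)])
    let ?e = "restrict e {..<l}"
    have root: "mpoly_eval f (?e(l := d)) = 0" unfolding cong' unfolding poly_upoly[symmetric] upg using g(3) .
    have deriv: "mpoly_eval (mpoly_deriv l f) (?e(l := d)) \<noteq> 0"
      unfolding poly_pderiv_upoly[symmetric] up_cong upg using g(4) .
    have fU: "f \<in> mpoly_ring UNIV (Suc l)" using fC mpoly_ring_mono_coeffs[of C UNIV "Suc l"] by blast
    have eT: "?e \<in> tuples l" by simp
    obtain P where P: "openin (power_topology \<tau> l) P" "?e \<in> P"
      "\<And>x. x \<in> P \<Longrightarrow> \<exists>y\<in>W. mpoly_eval f (x(l := y)) = 0"
      using polynomial_IFT_local_root[OF T(1) ift fU eT root deriv W] by blast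
    \<comment> \<open>On this set the lifted leading coefficient stays nonzero, as the transfer of
      the pseudo-division to \<open>e'\<close> demands.\<close>
    let ?N = "{x \<in> tuples l. mpoly_eval (G ?D) x \<noteq> 0}"
    have N: "openin (power_topology \<tau> l) ?N"
      by (rule mpoly_nonzero_open[OF T ift]) (use G(1)[of ?D] mpoly_ring_mono_coeffs[of C UNIV l] in blast)
    have eN: "?e \<in> ?N" using g(2) G(2)[of ?D] by (simp add: cong[OF G(1)] flip: G(2))
    show ?thesis
    proof (intro exI[of _ "U1 \<inter> P \<inter> ?N"] conjI allI impI)
      show "openin (power_topology \<tau> l) (U1 \<inter> P \<inter> ?N)" by (intro openin_Int U1(1) P(1) N)
      show "?e \<in> U1 \<inter> P \<inter> ?N" using U1(2) P(2) eN by blast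
      fix e' assume "restrict e' {..<l} \<in> U1 \<inter> P \<inter> ?N \<and> specializes C l e e'"
      then have e': "restrict e' {..<l} \<in> U1" "restrict e' {..<l} \<in> P" "restrict e' {..<l} \<in> ?N"
        and spec: "specializes C l e e'" by blast+
      obtain d' where d': "d' \<in> W" "mpoly_eval f (e'(l := d')) = 0"
        using P(3)[OF e'(2)] unfolding cong' by blast
      have "specializes C (Suc l) (e(l := d)) (e'(l := d'))"
      proof (rule specializes_extend_algebraic[OF C spec _ g(3) _ _ g(5)])
        show "spec_poly C l e e' g (upoly l e' f)"
          using spec_poly_upoly[OF C fC, of e e'] unfolding upg .
        show "poly (upoly l e' f) d' = 0"
          using d'(2) unfolding poly_upoly .
        show "coeff (upoly l e' f) ?D \<noteq> 0"
          using e'(3) cong[OF G(1), of ?D e'] unfolding coeff_up by simp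
      qed
      then show "\<exists>d'. restrict (e'(l := d')) {..<Suc l} \<in> V \<and> specializes C (Suc l) (e(l := d)) (e'(l := d'))"
        using UW[OF e'(1) d'(1)] by blast
    qed
  qed
qed

section \<open>Appending several coordinates\<close>

fun append_coords :: "nat \<Rightarrow> (nat \<Rightarrow> 'a) \<Rightarrow> 'a list \<Rightarrow> nat \<Rightarrow> 'a" where
  "append_coords l e [] = e"
| "append_coords l e (d # ds) = append_coords (Suc l) (e(l := d)) ds"

fun extendable_list :: "'a::field set \<Rightarrow> nat \<Rightarrow> (nat \<Rightarrow> 'a) \<Rightarrow> 'a list \<Rightarrow> bool" where
  "extendable_list C l e [] = True"
| "extendable_list C l e (d # ds) \<longleftrightarrow> extendable C l e d \<and> extendable_list C (Suc l) (e(l := d)) ds"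

lemma append_coords_nth:
  "append_coords l e ds i = (if l \<le> i \<and> i < l + length ds then ds ! (i - l) else e i)"
proof (induction ds arbitrary: l e)
  case (Cons d ds)
  show ?case
    unfolding append_coords.simps Cons.IH by (auto simp: nth_Cons')
qed auto

text \<open>Neighbourhoods are pulled back from the last coordinate to the first, as each single
  step has to know its target neighbourhood in advance.\<close>

lemma locus_extension:
  assumes T: "topspace \<tau> = UNIV" "openin \<tau> {y. y \<noteq> 0}" and ift: "polynomial_IFT \<tau>"
    and C: "is_subfield C"
  shows "extendable_list C l e ds \<Longrightarrow> openin (power_topology \<tau> (l + length ds)) V \<Longrightarrow>
    restrict (append_coords l e ds) {..<l + length ds} \<in> V \<Longrightarrow>
    \<exists>U. openin (power_topology \<tau> l) U \<and> restrict e {..<l} \<in> U \<and>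
    (\<forall>e'. restrict e' {..<l} \<in> U \<and> specializes C l e e' \<longrightarrow>
      (\<exists>ds'. length ds' = length ds \<and> restrict (append_coords l e' ds') {..<l + length ds} \<in> V \<and>
        specializes C (l + length ds) (append_coords l e ds) (append_coords l e' ds')))"
proof (induction ds arbitrary: l e)
  case Nil
  then show ?case by (intro exI[of _ V] conjI allI impI exI[of _ "[]"]) simp_all
next
  case (Cons d ds)
  have "extendable_list C (Suc l) (e(l := d)) ds" using Cons.prems(1) by simp
  moreover have "openin (power_topology \<tau> (Suc l + length ds)) V" using Cons.prems(2) by simp
  moreover have "restrict (append_coords (Suc l) (e(l := d)) ds) {..<Suc l + length ds} \<in> V"
    using Cons.prems(3) by (simp only: append_coords.simps list.size add_Suc add_Suc_right add_0_right One_nat_def)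
  ultimately obtain U where U: "openin (power_topology \<tau> (Suc l)) U" "restrict (e(l := d)) {..<Suc l} \<in> U"
    "\<forall>e'. restrict e' {..<Suc l} \<in> U \<and> specializes C (Suc l) (e(l := d)) e' \<longrightarrow>
      (\<exists>ds'. length ds' = length ds \<and> restrict (append_coords (Suc l) e' ds') {..<Suc l + length ds} \<in> V \<and>
        specializes C (Suc l + length ds) (append_coords (Suc l) (e(l := d)) ds) (append_coords (Suc l) e' ds'))"
    using Cons.IH[of "Suc l" "e(l := d)"] by blast
  have "extendable C l e d" using Cons.prems(1) by simp
  from locus_extension_step[OF T ift C this U(1,2)]
  obtain U' where U': "openin (power_topology \<tau> l) U'" "restrict e {..<l} \<in> U'"
    "\<forall>e'. restrict e' {..<l} \<in> U' \<and> specializes C l e e' \<longrightarrow>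
      (\<exists>d'. restrict (e'(l := d')) {..<Suc l} \<in> U \<and> specializes C (Suc l) (e(l := d)) (e'(l := d')))"
    by blast
  show ?case
  proof (intro exI[of _ U'] conjI U'(1,2) allI impI)
    fix e' assume "restrict e' {..<l} \<in> U' \<and> specializes C l e e'"
    then obtain d' where d': "restrict (e'(l := d')) {..<Suc l} \<in> U" "specializes C (Suc l) (e(l := d)) (e'(l := d'))"
      using U'(3) by blast
    then obtain ds' where "length ds' = length ds" "restrict (append_coords (Suc l) (e'(l := d')) ds') {..<Suc l + length ds} \<in> V"
        "specializes C (Suc l + length ds) (append_coords (Suc l) (e(l := d)) ds) (append_coords (Suc l) (e'(l := d')) ds')"
      using U(3) by blast
    then show "\<exists>ds'. length ds' = length (d # ds) \<and> restrict (append_coords l e' ds') {..<l + length (d # ds)} \<in> V \<and>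
        specializes C (l + length (d # ds)) (append_coords l e (d # ds)) (append_coords l e' ds')"
      by (intro exI[of _ "d' # ds'"]) (simp only: append_coords.simps list.size add_Suc add_Suc_right add_0_right One_nat_def)
  qed
qed


section \<open>Separating orderings of generators\<close>

text \<open>Closure under negation comes from \<open>-1 \<in> H\<close>, since the sets
  \<open>H\<close> in use contain a subfield.\<close>

inductive_set ring_gen :: "'a::field set \<Rightarrow> 'a set" for H where
  base: "x \<in> H \<Longrightarrow> x \<in> ring_gen H"
| add: "x \<in> ring_gen H \<Longrightarrow> y \<in> ring_gen H \<Longrightarrow> x + y \<in> ring_gen H"
| mult: "x \<in> ring_gen H \<Longrightarrow> y \<in> ring_gen H \<Longrightarrow> x * y \<in> ring_gen H"

lemma ring_gen_least:
  assumes "H \<subseteq> R" "\<And>x y. x \<in> R \<Longrightarrow> y \<in> R \<Longrightarrow> x + y \<in> R" "\<And>x y. x \<in> R \<Longrightarrow> y \<in> R \<Longrightarrow> x * y \<in> R"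
  shows "ring_gen H \<subseteq> R"
proof
  fix x assume "x \<in> ring_gen H"
  then show "x \<in> R" by induction (use assms in auto)
qed

lemma ring_gen_sum: "0 \<in> H \<Longrightarrow> (\<And>i. i \<in> S \<Longrightarrow> f i \<in> ring_gen H) \<Longrightarrow> sum f S \<in> ring_gen H"
  by (induction S rule: infinite_finite_induct) (auto intro: ring_gen.intros)

lemma ring_gen_power: "1 \<in> H \<Longrightarrow> x \<in> ring_gen H \<Longrightarrow> x ^ n \<in> ring_gen H"
  by (induction n) (auto intro: ring_gen.intros)

lemma ring_gen_prod: "1 \<in> H \<Longrightarrow> (\<And>i. i \<in> S \<Longrightarrow> f i \<in> ring_gen H) \<Longrightarrow> prod f S \<in> ring_gen H"
  by (induction S rule: infinite_finite_induct) (auto intro: ring_gen.intros)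

text \<open>The ring of values depends on the coordinates only as a set, which frees the ordering
  argument from the positions at which they are stored.\<close>

lemma val_ring_eq_ring_gen:
  assumes C: "is_subfield C"
  shows "val_ring C l e = ring_gen (C \<union> e ` {..<l})"
proof
  let ?H = "C \<union> e ` {..<l}"
  show "ring_gen ?H \<subseteq> val_ring C l e"
    by (rule ring_gen_least) (auto intro: val_ring_const[OF C] val_ring_var[OF C] val_ring_add[OF C] val_ring_mult[OF C])
  have H: "0 \<in> ?H" "1 \<in> ?H" using subfield_0[OF C] subfield_1[OF C] by auto
  show "val_ring C l e \<subseteq> ring_gen ?H"
  proof
    fix x assume "x \<in> val_ring C l e"
    then obtain f where f: "f \<in> mpoly_ring C l" "x = mpoly_eval f e" unfolding val_ring_def by blast
    have "lookup f u * (\<Prod>i\<in>keys u. e i ^ lookup u i) \<in> ring_gen ?H"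
      if "u \<in> keys f" for u
    proof (intro ring_gen.mult ring_gen_prod ring_gen_power H)
      show "lookup f u \<in> ring_gen ?H"
        using f(1) unfolding mpoly_ring_def by (intro ring_gen.base) blast
      show "e i \<in> ring_gen ?H" if "i \<in> keys u" for i
        using f(1) that \<open>u \<in> keys f\<close> unfolding mpoly_ring_def by (intro ring_gen.base) blast
    qed
    then show "x \<in> ring_gen ?H" unfolding f(2) mpoly_eval_def by (intro ring_gen_sum H)
  qed
qed

lemma append_coords_image: "append_coords l e ds ` {..<l + length ds} = e ` {..<l} \<union> set ds"
proof
  show "append_coords l e ds ` {..<l + length ds} \<subseteq> e ` {..<l} \<union> set ds"
    by (auto simp: append_coords_nth)
  show "e ` {..<l} \<union> set ds \<subseteq> append_coords l e ds ` {..<l + length ds}"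
  proof
    fix x assume "x \<in> e ` {..<l} \<union> set ds"
    then consider i where "i < l" "x = e i" | k where "k < length ds" "x = ds ! k"
      by (auto simp: in_set_conv_nth)
    then show "x \<in> append_coords l e ds ` {..<l + length ds}"
    proof cases
      case 1
      then show ?thesis by (intro image_eqI[of _ _ i]) (auto simp: append_coords_nth)
    next
      case 2
      then show ?thesis by (intro image_eqI[of _ _ "l + k"]) (auto simp: append_coords_nth)
    qed
  qed
qed

lemma extendable_list_snoc:
  "extendable_list C l e (ds @ [d]) \<longleftrightarrow>
     extendable_list C l e ds \<and> extendable C (l + length ds) (append_coords l e ds) d"
  by (induction ds arbitrary: l e) auto

section \<open>Ordinary monomials and algebraic independence\<close>

lemma pmon_add: "pmon (I + J) = pmon I * pmon (J :: 'a::field \<Rightarrow>\<^sub>0 nat)"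
proof -
  let ?A = "keys I \<union> keys J"
  have "pmon (I + J) = (\<Prod>y\<in>?A. y ^ lookup (I + J) y)"
    by (rule pmon_superset) (use Poly_Mapping.keys_add[of I J] in auto)
  also have "\<dots> = (\<Prod>y\<in>?A. y ^ lookup I y) * (\<Prod>y\<in>?A. y ^ lookup J y)"
    by (simp add: lookup_add power_add prod.distrib)
  also have "\<dots> = pmon I * pmon J"
    by (simp add: pmon_superset[of ?A I] pmon_superset[of ?A J])
  finally show ?thesis .
qed

lemma pmon_single: "pmon (single y k) = y ^ k"
  by (simp add: pmon_def)

definition monomials :: "'a set \<Rightarrow> ('a \<Rightarrow>\<^sub>0 nat) set" where
  "monomials B = {\<alpha>. keys \<alpha> \<subseteq> B}"

lemma monomials_add: "\<alpha> \<in> monomials B \<Longrightarrow> \<beta> \<in> monomials B \<Longrightarrow> \<alpha> + \<beta> \<in> monomials B"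
  using Poly_Mapping.keys_add[of \<alpha> \<beta>] unfolding monomials_def by blast

lemma ring_gen_subset_monomial_span:
  assumes E: "is_subfield E"
  shows "ring_gen (E \<union> B) \<subseteq> lin_span E (monomials B) pmon"
proof (rule ring_gen_least)
  let ?T = "lin_span E (monomials B) pmon"
  show "E \<union> B \<subseteq> ?T"
  proof
    fix x assume "x \<in> E \<union> B"
    then consider "x \<in> E" | "x \<in> B" by blast
    then show "x \<in> ?T"
    proof cases
      case 1
      have "pmon 0 \<in> ?T" by (rule lin_span_base[OF E]) (simp add: monomials_def)
      from lin_span_scale[OF E this 1] show ?thesis by simp
    next
      case 2
      then have "pmon (single x 1) \<in> ?T"
        by (intro lin_span_base[OF E]) (simp add: monomials_def)
      then show ?thesis by (simp add: pmon_single)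
    qed
  qed
  show "x + y \<in> ?T" if "x \<in> ?T" "y \<in> ?T" for x y using that by (rule lin_span_add[OF E])
  show "x * y \<in> ?T" if "x \<in> ?T" "y \<in> ?T" for x y
  proof (rule lin_span_mult[OF E _ that])
    show "pmon \<alpha> * pmon \<beta> \<in> ?T" if "\<alpha> \<in> monomials B" "\<beta> \<in> monomials B" for \<alpha> \<beta>
      unfolding pmon_add[symmetric] by (rule lin_span_base[OF E monomials_add[OF that]])
  qed
qed

text \<open>Algebraic independence of \<open>B\<close> is expressed by linear independence of its
  monomials. If the coefficients of \<open>h\<close> are expanded in monomials free of
  \<open>b\<close>, then \<open>poly h b\<close> becomes a combination of pairwise distinct
  monomials in \<open>B\<close>.\<close>

lemma monomials_transcendental:
  assumes E: "is_subfield E" and ind: "lin_indep E (monomials B) pmon"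
    and b: "b \<in> B" "B' \<subseteq> B - {b}" and h: "\<And>k. coeff h k \<in> ring_gen (E \<union> B')" "poly h b = 0"
  shows "h = 0"
proof -
  let ?N = "degree h"
  have "coeff h k \<in> lin_span E (monomials B') pmon" for k
    using h(1) ring_gen_subset_monomial_span[OF E] by blast
  then obtain T d where T: "finite T" "T \<subseteq> monomials B'"
    and d: "\<forall>k\<in>{..?N}. \<forall>\<alpha>\<in>T. d k \<alpha> \<in> E" "\<forall>k\<in>{..?N}. coeff h k = (\<Sum>\<alpha>\<in>T. d k \<alpha> * pmon \<alpha>)"
    using lin_span_common_support[OF finite_atMost subfield_0[OF E], of ?N "coeff h" "monomials B'" pmon] by blast
  define F where "F = (\<lambda>(k, \<alpha>). \<alpha> + single b (k::nat))"
  have lF: "lookup (F (k, \<alpha>)) y = lookup \<alpha> y + (if y = b then k else 0)" for k \<alpha> y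
    by (simp add: F_def lookup_add lookup_single when_def)
  have Tb: "lookup \<alpha> b = 0" if "\<alpha> \<in> T" for \<alpha>
  proof -
    have "keys \<alpha> \<subseteq> B'" using that T(2) unfolding monomials_def by blast
    then have "b \<notin> keys \<alpha>" using b(2) by blast
    then show ?thesis by (simp add: in_keys_iff)
  qed
  \<comment> \<open>The exponent of \<open>b\<close> recovers \<open>k\<close>, because
    \<open>b\<close> does not occur in the monomials of \<open>T\<close>.\<close>
  have inj: "inj_on F ({..?N} \<times> T)"
  proof (rule inj_onI, clarify)
    fix k \<alpha> k' \<alpha>' assume a: "\<alpha> \<in> T" "\<alpha>' \<in> T" and eq: "F (k, \<alpha>) = F (k', \<alpha>')"
    have l: "lookup \<alpha> y + (if y = b then k else 0) = lookup \<alpha>' y + (if y = b then k' else 0)" for y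
      unfolding lF[symmetric] eq ..
    have "k = k'" using l[of b] Tb a by simp
    moreover have "\<alpha> = \<alpha>'"
      by (rule poly_mapping_eqI) (use l Tb a \<open>k = k'\<close> in \<open>auto split: if_splits\<close>)
    ultimately show "k = k' \<and> \<alpha> = \<alpha>'" ..
  qed
  have "F ` ({..?N} \<times> T) \<subseteq> monomials B"
  proof
    fix \<beta> assume "\<beta> \<in> F ` ({..?N} \<times> T)"
    then obtain k \<alpha> where "\<alpha> \<in> T" "\<beta> = F (k, \<alpha>)" by auto
    then show "\<beta> \<in> monomials B"
      using T(2) b Poly_Mapping.keys_add[of \<alpha> "single b k"]
      unfolding F_def monomials_def by (auto split: if_splits)
  qed
  then have ind': "lin_indep E ({..?N} \<times> T) (\<lambda>i. pmon (F i))"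
    using lin_indep_subset[OF ind] lin_indep_reindex[OF inj, of E pmon] by blast
  have "(\<Sum>(k, \<alpha>)\<in>{..?N} \<times> T. d k \<alpha> * pmon (F (k, \<alpha>))) = 0"
  proof -
    have "(\<Sum>(k, \<alpha>)\<in>{..?N} \<times> T. d k \<alpha> * pmon (F (k, \<alpha>))) = (\<Sum>k\<le>?N. \<Sum>\<alpha>\<in>T. d k \<alpha> * pmon (F (k, \<alpha>)))"
      by (simp add: sum.cartesian_product)
    also have "\<dots> = (\<Sum>k\<le>?N. coeff h k * b ^ k)"
    proof (rule sum.cong[OF refl])
      fix k assume "k \<in> {..?N}"
      then have "coeff h k = (\<Sum>\<alpha>\<in>T. d k \<alpha> * pmon \<alpha>)" using d(2) by blast
      then show "(\<Sum>\<alpha>\<in>T. d k \<alpha> * pmon (F (k, \<alpha>))) = coeff h k * b ^ k"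
        by (simp add: F_def pmon_add pmon_single sum_distrib_right mult.assoc)
    qed
    also have "\<dots> = poly h b" by (simp add: poly_altdef)
    finally show ?thesis using h(2) by simp
  qed
  then have 0: "(\<Sum>i\<in>{..?N} \<times> T. (\<lambda>(k, \<alpha>). d k \<alpha>) i * pmon (F i)) = 0"
    by (simp add: case_prod_beta)
  have "(\<lambda>(k, \<alpha>). d k \<alpha>) (k, \<alpha>) = 0" if "k \<in> {..?N}" "\<alpha> \<in> T" for k \<alpha>
    by (rule lin_indepD[OF ind' _ subset_refl _ 0]) (use T(1) d(1) that in auto)
  then have "d k \<alpha> = 0" if "k \<in> {..?N}" "\<alpha> \<in> T" for k \<alpha> using that by simp
  then have "coeff h k = 0" if "k \<in> {..?N}" for k using d(2) that by simp
  then have "Polynomial.lead_coeff h = 0" by simp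
  then show ?thesis by simp
qed

definition total_deg :: "('a \<Rightarrow>\<^sub>0 nat) \<Rightarrow> nat" where
  "total_deg \<alpha> = (\<Sum>y\<in>keys \<alpha>. lookup \<alpha> y)"

lemma total_deg_superset:
  "finite A \<Longrightarrow> keys \<alpha> \<subseteq> A \<Longrightarrow> total_deg \<alpha> = (\<Sum>y\<in>A. lookup \<alpha> y)"
  unfolding total_deg_def by (rule sum.mono_neutral_left) (auto simp: in_keys_iff)

text \<open>
  MacLane's argument: in an algebraic relation of minimal total degree all partial derivatives vanish,
  so that all its monomials are \<open>p\<close>-th powers; by separability their \<open>p\<close>-th roots are linearly
  dependent as well, which is a relation of smaller degree.
\<close>

lemma monomials_lin_indep:
  fixes E :: "'a::field set"
  assumes E: "is_subfield E" and B: "finite B" and sep: "frob_separable (gen_field (E \<union> B)) E"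
    and no_root: "\<And>b h. b \<in> B \<Longrightarrow> (\<And>k. coeff h k \<in> gen_field (E \<union> (B - {b}))) \<Longrightarrow> poly h b = 0 \<Longrightarrow>
      poly (pderiv h) b = 0"
  shows "lin_indep E (monomials B) pmon"
proof (rule ccontr)
  let ?l = "lookup"
  define M where "M n = {\<alpha> \<in> monomials B. total_deg \<alpha> \<le> n}" for n
  assume "\<not> lin_indep E (monomials B) pmon"
  then obtain T where T: "finite T" "T \<subseteq> monomials B" "\<not> lin_indep E T pmon"
    unfolding lin_indep_finitely[of _ "monomials B"] by blast
  have "T \<subseteq> M (Max (insert 0 (total_deg ` T)))"
    unfolding M_def using T(1,2) by (auto intro!: Max_ge)
  then have ex: "\<not> lin_indep E (M (Max (insert 0 (total_deg ` T)))) pmon"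
    using T(3) lin_indep_subset by blast
  define n where "n = (LEAST n. \<not> lin_indep E (M n) pmon)"
  have n: "\<not> lin_indep E (M n) pmon" unfolding n_def by (rule LeastI[of "\<lambda>n. \<not> lin_indep E (M n) pmon", OF ex])
  have less_n: "lin_indep E (M m) pmon" if "m < n" for m
    using not_less_Least[of m "\<lambda>n. \<not> lin_indep E (M n) pmon"] that unfolding n_def by blast
  obtain S0 c where S0: "finite S0" "S0 \<subseteq> M n" "\<forall>\<alpha>\<in>S0. c \<alpha> \<in> E" "(\<Sum>\<alpha>\<in>S0. c \<alpha> * pmon \<alpha>) = 0" "\<exists>\<alpha>\<in>S0. c \<alpha> \<noteq> 0"
    using n unfolding lin_indep_def by blast
  define S where "S = {\<alpha>\<in>S0. c \<alpha> \<noteq> 0}"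
  have S: "finite S" "S \<subseteq> M n" "\<And>\<alpha>. \<alpha> \<in> S \<Longrightarrow> c \<alpha> \<in> E" "\<And>\<alpha>. \<alpha> \<in> S \<Longrightarrow> c \<alpha> \<noteq> 0" "S \<noteq> {}"
    using S0 unfolding S_def by auto
  have "(\<Sum>\<alpha>\<in>S. c \<alpha> * pmon \<alpha>) = (\<Sum>\<alpha>\<in>S0. c \<alpha> * pmon \<alpha>)"
    unfolding S_def by (rule sum.mono_neutral_left) (use S0(1) in auto)
  then have S_sum: "(\<Sum>\<alpha>\<in>S. c \<alpha> * pmon \<alpha>) = 0" using S0(4) by simp
  have S_keys: "keys \<alpha> \<subseteq> B" "total_deg \<alpha> \<le> n" if "\<alpha> \<in> S" for \<alpha>
    using that S(2) unfolding M_def monomials_def by auto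
  have split: "pmon \<alpha> = (\<Prod>y\<in>B - {b}. y ^ ?l \<alpha> y) * b ^ ?l \<alpha> b" if "\<alpha> \<in> S" "b \<in> B" for \<alpha> b
    using pmon_superset[OF B S_keys(1)[OF that(1)]] prod.remove[OF B that(2), of "\<lambda>y. y ^ ?l \<alpha> y"] by simp
  \<comment> \<open>Read as a polynomial in \<open>b\<close>, the relation has \<open>b\<close> as a
    root, so by \<open>no_root\<close> its derivative vanishes there too. This is a relation among
    monomials of degree at most \<open>n - 1\<close>, all of whose coefficients are therefore
    zero.\<close>
  have vanish: "(of_nat (?l \<alpha> b) :: 'a) = 0" if \<alpha>: "\<alpha> \<in> S" and b: "b \<in> B" for \<alpha> b
  proof (cases "?l \<alpha> b = 0")
    case False
    define h where "h = (\<Sum>\<alpha>\<in>S. monom (c \<alpha> * (\<Prod>y\<in>B - {b}. y ^ ?l \<alpha> y)) (?l \<alpha> b))"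
    have "poly h b = 0"
      unfolding h_def poly_sum poly_monom using S_sum split[OF _ b] by (simp add: mult.assoc)
    moreover have "coeff h k \<in> gen_field (E \<union> (B - {b}))" for k
    proof -
      have "coeff h k = (\<Sum>\<alpha>\<in>S. if ?l \<alpha> b = k then c \<alpha> * (\<Prod>y\<in>B - {b}. y ^ ?l \<alpha> y) else 0)"
        unfolding h_def coeff_sum by (intro sum.cong) auto
      also have "\<dots> \<in> gen_field (E \<union> (B - {b}))"
      proof (rule subfield_sum[OF gen_field_subfield])
        fix \<alpha> assume "\<alpha> \<in> S"
        have "c \<alpha> * (\<Prod>y\<in>B - {b}. y ^ ?l \<alpha> y) \<in> gen_field (E \<union> (B - {b}))"
          using gen_field_incl[of "E \<union> (B - {b})"] S(3)[OF \<open>\<alpha> \<in> S\<close>]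
          by (intro subfield_mult[OF gen_field_subfield] subfield_prod[OF gen_field_subfield] subfield_power[OF gen_field_subfield]) auto
        then show "(if ?l \<alpha> b = k then c \<alpha> * (\<Prod>y\<in>B - {b}. y ^ ?l \<alpha> y) else 0) \<in> gen_field (E \<union> (B - {b}))"
          using subfield_0[OF gen_field_subfield[of "E \<union> (B - {b})"]] by simp
      qed
      finally show ?thesis .
    qed
    ultimately have "poly (pderiv h) b = 0" using no_root[OF b] by blast
    moreover have pd: "pderiv (sum g A) = (\<Sum>u\<in>A. pderiv (g u))" for g :: "('a \<Rightarrow>\<^sub>0 nat) \<Rightarrow> 'a poly" and A
      by (induction A rule: infinite_finite_induct) (simp_all add: pderiv_add)
    ultimately have 0: "(\<Sum>\<alpha>\<in>S. of_nat (?l \<alpha> b) * (c \<alpha> * (\<Prod>y\<in>B - {b}. y ^ ?l \<alpha> y)) * b ^ (?l \<alpha> b - 1)) = 0"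
      unfolding h_def pd pderiv_monom poly_sum poly_monom by simp
    \<comment> \<open>Terms free of \<open>b\<close> drop out of the derivative. On the remaining
      ones the subtraction in \<open>?d\<close> is not truncated, so it is injective and lowers the
      degree by exactly one.\<close>
    let ?S = "{\<alpha>\<in>S. ?l \<alpha> b \<noteq> 0}"
    let ?d = "\<lambda>\<alpha>. \<alpha> - single b (1::nat)"
    have ld: "?l (?d \<alpha>) y = ?l \<alpha> y - (if y = b then 1 else 0)" for \<alpha> y
      by (simp add: lookup_minus lookup_single when_def)
    have pd': "pmon (?d \<alpha>) = (\<Prod>y\<in>B - {b}. y ^ ?l \<alpha> y) * b ^ (?l \<alpha> b - 1)" if "\<alpha> \<in> S" for \<alpha>
    proof -
      have "keys (?d \<alpha>) \<subseteq> B"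
      proof
        fix y assume "y \<in> keys (?d \<alpha>)"
        then have "?l \<alpha> y \<noteq> 0" unfolding in_keys_iff ld by auto
        then show "y \<in> B" using S_keys(1)[OF that] by (auto simp: in_keys_iff)
      qed
      then have "pmon (?d \<alpha>) = (\<Prod>y\<in>B. y ^ ?l (?d \<alpha>) y)" by (rule pmon_superset[OF B])
      also have "\<dots> = b ^ ?l (?d \<alpha>) b * (\<Prod>y\<in>B - {b}. y ^ ?l (?d \<alpha>) y)" by (rule prod.remove[OF B b])
      also have "(\<Prod>y\<in>B - {b}. y ^ ?l (?d \<alpha>) y) = (\<Prod>y\<in>B - {b}. y ^ ?l \<alpha> y)"
        by (rule prod.cong[OF refl], unfold ld) auto
      finally show ?thesis unfolding ld by simp
    qed
    have dM: "?d \<alpha> \<in> M (n - 1)" if "\<alpha> \<in> ?S" for \<alpha>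
    proof -
      have "keys (?d \<alpha>) \<subseteq> B"
      proof
        fix y assume "y \<in> keys (?d \<alpha>)"
        then have "?l \<alpha> y \<noteq> 0" unfolding in_keys_iff ld by auto
        then show "y \<in> B" using S_keys(1)[of \<alpha>] that by (auto simp: in_keys_iff)
      qed
      moreover have "total_deg \<alpha> = Suc (total_deg (?d \<alpha>))"
      proof -
        have "total_deg \<alpha> = ?l \<alpha> b + (\<Sum>y\<in>B - {b}. ?l \<alpha> y)"
          using total_deg_superset[OF B, of \<alpha>] S_keys(1)[of \<alpha>] that sum.remove[OF B b, of "?l \<alpha>"] by simp
        moreover have "total_deg (?d \<alpha>) = ?l (?d \<alpha>) b + (\<Sum>y\<in>B - {b}. ?l (?d \<alpha>) y)"
          using total_deg_superset[OF B \<open>keys (?d \<alpha>) \<subseteq> B\<close>] sum.remove[OF B b, of "?l (?d \<alpha>)"] by simp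
        moreover have "(\<Sum>y\<in>B - {b}. ?l (?d \<alpha>) y) = (\<Sum>y\<in>B - {b}. ?l \<alpha> y)"
          by (rule sum.cong[OF refl], unfold ld) auto
        moreover have "?l \<alpha> b = Suc (?l (?d \<alpha>) b)" unfolding ld using that by simp
        ultimately show ?thesis by simp
      qed
      ultimately show ?thesis using S_keys(2)[of \<alpha>] that unfolding M_def monomials_def by simp
    qed
    have inj: "inj_on ?d ?S"
    proof (rule inj_onI, rule poly_mapping_eqI)
      fix \<alpha> \<beta> y assume ab: "\<alpha> \<in> ?S" "\<beta> \<in> ?S" "?d \<alpha> = ?d \<beta>"
      have "?l (?d \<alpha>) y = ?l (?d \<beta>) y" unfolding ab(3) ..
      then show "?l \<alpha> y = ?l \<beta> y" using ab(1,2) unfolding ld by (cases "y = b") auto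
    qed
    have "\<alpha> \<in> ?S" using \<alpha> False by simp
    then have "n \<noteq> 0"
      using S_keys(2)[OF \<alpha>] total_deg_superset[OF B S_keys(1)[OF \<alpha>]] member_le_sum[OF b, of "?l \<alpha>"] B False by simp
    then have "lin_indep E (M (n - 1)) pmon" using less_n by simp
    moreover have "?d ` ?S \<subseteq> M (n - 1)" using dM by blast
    ultimately have "lin_indep E (?d ` ?S) pmon" by (rule lin_indep_subset)
    then have ind: "lin_indep E ?S (\<lambda>\<alpha>. pmon (?d \<alpha>))" unfolding lin_indep_reindex[OF inj] .
    have "(\<Sum>\<alpha>\<in>?S. of_nat (?l \<alpha> b) * c \<alpha> * pmon (?d \<alpha>)) =
        (\<Sum>\<alpha>\<in>S. of_nat (?l \<alpha> b) * (c \<alpha> * (\<Prod>y\<in>B - {b}. y ^ ?l \<alpha> y)) * b ^ (?l \<alpha> b - 1))"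
      by (rule sum.mono_neutral_cong_left) (use S(1) in \<open>auto simp: pd'[unfolded One_nat_def] mult_ac\<close>)
    then have 0: "(\<Sum>\<alpha>\<in>?S. of_nat (?l \<alpha> b) * c \<alpha> * pmon (?d \<alpha>)) = 0" using 0 by simp
    have "of_nat (?l \<alpha> b) * c \<alpha> = 0"
      by (rule lin_indepD[OF ind _ subset_refl _ 0 \<open>\<alpha> \<in> ?S\<close>])
        (use S(1,3) in \<open>auto intro!: subfield_mult[OF E] subfield_of_nat[OF E]\<close>)
    then show ?thesis using S(4)[OF \<alpha>] by simp
  qed simp
  show False
  proof (cases rule: char_exp_cases[where ?'a = 'a])
    \<comment> \<open>In characteristic 0 all exponents vanish, and the relation reduces to a
      nonzero constant.\<close>
    case 1
    have "\<alpha> = 0" if "\<alpha> \<in> S" for \<alpha>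
    proof (rule poly_mapping_eqI)
      fix y
      show "?l \<alpha> y = ?l 0 y"
      proof (cases "y \<in> B")
        case True
        then show ?thesis using vanish[OF that True] 1(2) by (simp add: of_nat_eq_0_iff_char_dvd)
      next
        case False
        then show ?thesis using S_keys(1)[OF that] by (auto simp: in_keys_iff)
      qed
    qed
    then have "S = {0}" using S(5) by blast
    then have "c 0 = 0" using S_sum by simp
    then show False using S(4)[of 0] \<open>S = {0}\<close> by simp
  next
    case 2
    let ?p = "char_exp TYPE('a)"
    have dvd: "?p dvd ?l \<alpha> y" if "\<alpha> \<in> S" for \<alpha> y
    proof (cases "y \<in> B")
      case True
      then show ?thesis using vanish[OF that True] 2(2) by (simp add: of_nat_eq_0_iff_char_dvd)
    next
      case False
      then have "y \<notin> keys \<alpha>" using S_keys(1)[OF that] by blast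
      then show ?thesis by (simp add: in_keys_iff)
    qed
    \<comment> \<open>The p-th root of a monomial: on \<open>S\<close> all exponents are divisible
      by \<open>p\<close>.\<close>
    define r where "r \<alpha> = Abs_poly_mapping (\<lambda>y. ?l \<alpha> y div ?p)" for \<alpha> :: "'a \<Rightarrow>\<^sub>0 nat"
    have div_keys: "y \<in> keys \<alpha>" if "?l \<alpha> y div ?p \<noteq> 0" for \<alpha> :: "'a \<Rightarrow>\<^sub>0 nat" and y
      using that by (cases "?l \<alpha> y = 0") (simp_all add: in_keys_iff)
    have lr: "?l (r \<alpha>) y = ?l \<alpha> y div ?p" for \<alpha> y
    proof -
      have "finite {y. ?l \<alpha> y div ?p \<noteq> 0}"
        by (rule finite_subset[OF _ finite_keys[of \<alpha>]]) (use div_keys in blast)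
      then show ?thesis by (simp add: r_def)
    qed
    have r_keys: "keys (r \<alpha>) \<subseteq> B" if "\<alpha> \<in> S" for \<alpha>
    proof
      fix y assume "y \<in> keys (r \<alpha>)"
      then have "y \<in> keys \<alpha>" unfolding in_keys_iff[of y "r \<alpha>"] lr by (rule div_keys)
      then show "y \<in> B" using S_keys(1)[OF that] by blast
    qed
    have frob_r: "frob (pmon (r \<alpha>)) = pmon \<alpha>" if "\<alpha> \<in> S" for \<alpha>
    proof -
      have "frob (pmon (r \<alpha>)) = (\<Prod>y\<in>B. y ^ (?l \<alpha> y div ?p * ?p))"
        unfolding pmon_superset[OF B r_keys[OF that]] frob_prod lr by (simp add: frob_def power_mult[symmetric])
      also have "\<dots> = pmon \<alpha>"
        unfolding pmon_superset[OF B S_keys(1)[OF that]] using dvd[OF that] by simp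
      finally show ?thesis .
    qed
    have inj: "inj_on r S"
    proof (rule inj_onI, rule poly_mapping_eqI)
      fix \<alpha> \<beta> y assume ab: "\<alpha> \<in> S" "\<beta> \<in> S" "r \<alpha> = r \<beta>"
      have "?l \<alpha> y div ?p * ?p = ?l \<beta> y div ?p * ?p" unfolding lr[symmetric] ab(3) ..
      then show "?l \<alpha> y = ?l \<beta> y" using dvd[OF ab(1)] dvd[OF ab(2)] by simp
    qed
    \<comment> \<open>This makes \<open>n div p\<close> a strictly smaller degree bound, so the p-th
      roots are independent by minimality of \<open>n\<close>.\<close>
    have "n \<noteq> 0"
    proof
      assume "n = 0"
      have "\<alpha> = 0" if "\<alpha> \<in> S" for \<alpha>
      proof (rule poly_mapping_eqI)
        fix y
        have "(\<Sum>y\<in>B. ?l \<alpha> y) = 0"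
          using S_keys[OF that] \<open>n = 0\<close> total_deg_superset[OF B] by simp
        then show "?l \<alpha> y = ?l 0 y"
          using B S_keys(1)[OF that] by (cases "y \<in> B") (auto simp: in_keys_iff)
      qed
      then have "S = {0}" using S(5) by blast
      then have "c 0 = 0" using S_sum by simp
      then show False using S(4)[of 0] \<open>S = {0}\<close> by simp
    qed
    have "r ` S \<subseteq> M (n div ?p)"
    proof
      fix \<beta> assume "\<beta> \<in> r ` S"
      then obtain \<alpha> where \<alpha>: "\<alpha> \<in> S" "\<beta> = r \<alpha>" by blast
      have "total_deg (r \<alpha>) * ?p = (\<Sum>y\<in>B. ?l \<alpha> y div ?p * ?p)"
        unfolding total_deg_superset[OF B r_keys[OF \<alpha>(1)]] lr by (simp add: sum_distrib_right)
      also have "\<dots> = total_deg \<alpha>"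
        unfolding total_deg_superset[OF B S_keys(1)[OF \<alpha>(1)]] using dvd[OF \<alpha>(1)] by simp
      finally have "total_deg (r \<alpha>) * ?p \<le> n" using S_keys(2)[OF \<alpha>(1)] by simp
      then have "total_deg (r \<alpha>) \<le> n div ?p" by (simp add: less_eq_div_iff_mult_less_eq)
      then show "\<beta> \<in> M (n div ?p)" unfolding \<alpha>(2) M_def monomials_def using r_keys[OF \<alpha>(1)] by simp
    qed
    moreover have "n div ?p < n"
      using \<open>n \<noteq> 0\<close> prime_gt_1_nat[OF 2(1)] by (intro div_less_dividend) auto
    ultimately have "lin_indep E (r ` S) pmon" using less_n lin_indep_subset by blast
    then have "lin_indep E S (\<lambda>\<alpha>. pmon (r \<alpha>))" unfolding lin_indep_reindex[OF inj] .
    moreover have "(\<lambda>\<alpha>. pmon (r \<alpha>)) ` S \<subseteq> gen_field (E \<union> B)"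
    proof
      fix x assume "x \<in> (\<lambda>\<alpha>. pmon (r \<alpha>)) ` S"
      then obtain \<alpha> where \<alpha>: "\<alpha> \<in> S" "x = pmon (r \<alpha>)" by blast
      show "x \<in> gen_field (E \<union> B)"
        unfolding \<alpha>(2) pmon_superset[OF B r_keys[OF \<alpha>(1)]] using gen_field_incl[of "E \<union> B"]
        by (intro subfield_prod[OF gen_field_subfield] subfield_power[OF gen_field_subfield]) auto
    qed
    ultimately have ind: "lin_indep E S (\<lambda>\<alpha>. frob (pmon (r \<alpha>)))"
      by (intro frob_separableD[OF sep])
    have 0: "(\<Sum>\<alpha>\<in>S. c \<alpha> * frob (pmon (r \<alpha>))) = 0" using S_sum by (simp add: frob_r)
    obtain \<alpha> where "\<alpha> \<in> S" using S(5) by blast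
    then have "c \<alpha> = 0" using lin_indepD[OF ind S(1) subset_refl S(3) 0] by blast
    then show False using S(4) \<open>\<alpha> \<in> S\<close> by blast
  qed
qed

text \<open>An element that is a simple root over the field generated by all the others can be put
  last, and separability passes to the field without it. If there is no such element, the argument
  of MacLane shows that \<open>B\<close> is algebraically independent, and any order works. The
  result is a separating transcendence basis followed by separably algebraic elements.\<close>

lemma separating_order:
  fixes C :: "'a::field set"
  assumes C: "is_subfield C" and "finite B"
    and "frob_separable (gen_field (C \<union> e ` {..<l} \<union> B)) (gen_field (C \<union> e ` {..<l}))"
  shows "\<exists>bs. set bs = B \<and> extendable_list C l e bs"
  using assms(2,3)
proof (induction "card B" arbitrary: B)
  case 0
  then show ?case by (intro exI[of _ "[]"]) simp
next
  case (Suc n)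
  let ?H = "C \<union> e ` {..<l}"
  let ?E = "gen_field ?H"
  have val: "val_poly C (l + length ds) (append_coords l e ds) h \<longleftrightarrow> (\<forall>k. coeff h k \<in> ring_gen (?H \<union> set ds))" for h ds
    unfolding val_poly_def val_ring_eq_ring_gen[OF C] append_coords_image Un_assoc ..
  show ?case
  proof (cases "\<exists>b\<in>B. \<exists>h. (\<forall>k. coeff h k \<in> gen_field (?H \<union> (B - {b}))) \<and> poly h b = 0 \<and> poly (pderiv h) b \<noteq> 0")
    case True
    then obtain b h where b: "b \<in> B" and h: "\<And>k. coeff h k \<in> gen_field (?H \<union> (B - {b}))" "poly h b = 0" "poly (pderiv h) b \<noteq> 0"
      by blast
    have "frob_separable (gen_field (?H \<union> (B - {b}))) ?E"
      by (rule frob_separable_subset[OF Suc.prems(2)]) (rule gen_field_mono, blast)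
    moreover have "n = card (B - {b})" using Suc.hyps(2) b Suc.prems(1) by simp
    ultimately obtain bs where bs: "set bs = B - {b}" "extendable_list C l e bs"
      using Suc.hyps(1)[of "B - {b}"] Suc.prems(1) by blast
    let ?R = "ring_gen (?H \<union> (B - {b}))"
    have RH: "1 \<in> ?R" "-1 \<in> ?R"
      using subfield_1[OF C] subfield_uminus[OF C subfield_1[OF C]] by (auto intro: ring_gen.base)
    have neg: "- x \<in> ?R" if "x \<in> ?R" for x using ring_gen.mult[OF RH(2) that] by simp
    \<comment> \<open>The coefficients of \<open>h\<close> lie in the field only; a common
      denominator \<open>s\<close> moves them into the ring, and \<open>smult s h\<close> still has
      a simple root at \<open>b\<close>.\<close>
    have frac: "\<exists>x\<in>?R. \<exists>y\<in>?R. y \<noteq> 0 \<and> coeff h k = x / y" for k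
      by (rule gen_field_fractions[OF RH(1) ring_gen.add ring_gen.mult neg _ h(1)]) (auto intro: ring_gen.base)
    have "\<exists>s\<in>?R. s \<noteq> 0 \<and> (\<forall>k\<in>{..Polynomial.degree h}. s * coeff h k \<in> ?R)"
      by (rule common_denominator[OF RH(1) ring_gen.mult finite_atMost frac])
    then obtain s where s: "s \<noteq> 0" "\<forall>k\<in>{..Polynomial.degree h}. s * coeff h k \<in> ?R" by blast
    have "0 \<in> ?R" using subfield_0[OF C] by (auto intro: ring_gen.base)
    then have "coeff (smult s h) k \<in> ?R" for k
      using s(2) by (cases "k \<le> degree h") (auto simp: coeff_eq_0)
    then have "val_poly C (l + length bs) (append_coords l e bs) (smult s h)"
      unfolding val bs(1) by blast
    then have "simple_root_over C (l + length bs) (append_coords l e bs) b"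
      unfolding simple_root_over_def using h(2,3) s(1) by (intro exI[of _ "smult s h"]) (simp add: pderiv_smult)
    then have "extendable_list C l e (bs @ [b])"
      unfolding extendable_list_snoc extendable_def using bs(2) by blast
    moreover have "set (bs @ [b]) = B" using bs(1) b by auto
    ultimately show ?thesis by blast
  next
    case False
    have EB: "gen_field (?E \<union> B') = gen_field (?H \<union> B')" for B' by (rule gen_field_Un_gen_field)
    have ind: "lin_indep ?E (monomials B) pmon"
      by (rule monomials_lin_indep[OF gen_field_subfield Suc.prems(1)])
        (use Suc.prems(2) False in \<open>unfold EB, blast+\<close>)
    have ext: "extendable_list C l e bs" if "distinct bs" "set bs \<subseteq> B" for bs
      using that
    proof (induction bs rule: rev_induct)
      case (snoc b bs)
      have "h = 0" if h: "val_poly C (l + length bs) (append_coords l e bs) h" "poly h b = 0" for h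
      proof (rule monomials_transcendental[OF gen_field_subfield ind _ _ _ h(2)])
        show "b \<in> B" "set bs \<subseteq> B - {b}" using snoc.prems by auto
        have "ring_gen (?H \<union> set bs) \<subseteq> ring_gen (?E \<union> set bs)"
          by (rule ring_gen_least) (use gen_field_incl[of ?H] in \<open>auto intro: ring_gen.intros\<close>)
        then show "coeff h k \<in> ring_gen (?E \<union> set bs)" for k
          using h(1) unfolding val by blast
      qed
      then show ?case
        unfolding extendable_list_snoc extendable_def using snoc by auto
    qed simp
    obtain bs where "set bs = B" "distinct bs" using finite_distinct_list[OF Suc.prems(1)] by blast
    then show ?thesis using ext by blast
  qed
qed


section \<open>Existential formulas near a point of a locus\<close>

text \<open>The renaming \<open>\<sigma>\<close> sends variables to coordinates; variables with
  equal values may share a coordinate.\<close>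

lemma rterm_mpoly:
  assumes C: "is_subfield C"
  shows "set_rterm t \<subseteq> C \<Longrightarrow> \<sigma> ` rterm_vars t \<subseteq> {..<M} \<Longrightarrow>
    \<exists>f\<in>mpoly_ring C M. \<forall>y. mpoly_eval f y = rterm_val (\<lambda>j. y (\<sigma> j)) t"
proof (induction t)
  case (RVar i)
  then show ?case
    using mpoly_ring_var[OF C, of "\<sigma> i" M 1]
    by (intro bexI[of _ "single (single (\<sigma> i) 1) 1"]) auto
next
  case (RParam d)
  then show ?case
    using mpoly_ring_const[OF C, of d M] by (intro bexI[of _ "single 0 d"]) auto
next
  case RZero
  show ?case using mpoly_ring_0[OF C] by (intro bexI[of _ 0]) auto
next
  case ROne
  show ?case
    using mpoly_ring_const[OF C subfield_1[OF C], of M]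
    by (intro bexI[of _ "single 0 1"]) (simp_all add: mpoly_eval_mmon)
next
  case (RNeg s)
  then obtain f where "f \<in> mpoly_ring C M" "\<forall>y. mpoly_eval f y = rterm_val (\<lambda>j. y (\<sigma> j)) s" by auto
  then show ?case using mpoly_ring_uminus[OF C] by (intro bexI[of _ "- f"]) (auto simp: mpoly_eval_uminus)
next
  case (RAdd s t)
  then obtain f g where "f \<in> mpoly_ring C M" "\<forall>y. mpoly_eval f y = rterm_val (\<lambda>j. y (\<sigma> j)) s"
    "g \<in> mpoly_ring C M" "\<forall>y. mpoly_eval g y = rterm_val (\<lambda>j. y (\<sigma> j)) t"
    by (auto simp: image_Un)
  then show ?case using mpoly_ring_add[OF C] by (intro bexI[of _ "f + g"]) (auto simp: mpoly_eval_add)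
next
  case (RMult s t)
  then obtain f g where "f \<in> mpoly_ring C M" "\<forall>y. mpoly_eval f y = rterm_val (\<lambda>j. y (\<sigma> j)) s"
    "g \<in> mpoly_ring C M" "\<forall>y. mpoly_eval g y = rterm_val (\<lambda>j. y (\<sigma> j)) t"
    by (auto simp: image_Un)
  then show ?case using mpoly_ring_mult[OF C] by (intro bexI[of _ "f * g"]) (auto simp: mpoly_eval_mult)
qed

section \<open>Assignments, prenex form and truth near a point\<close>

lemma rterm_val_cong: "(\<And>j. j \<in> rterm_vars t \<Longrightarrow> x j = y j) \<Longrightarrow> rterm_val x t = rterm_val y t"
  by (induction t) auto

lemma holds_cong: "(\<And>j. j \<in> free_vars \<phi> \<Longrightarrow> x j = y j) \<Longrightarrow> holds \<phi> x \<longleftrightarrow> holds \<phi> y"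
proof (induction \<phi> arbitrary: x y)
  case (FEq s t)
  then show ?case using rterm_val_cong[of s x y] rterm_val_cong[of t x y] by simp
next
  case (FNot \<phi>)
  have "holds \<phi> x = holds \<phi> y" by (rule FNot.IH) (simp add: FNot.prems)
  then show ?case by simp
next
  case (FAnd \<phi> \<psi>)
  have "holds \<phi> x = holds \<phi> y" by (rule FAnd.IH(1)) (simp add: FAnd.prems)
  moreover have "holds \<psi> x = holds \<psi> y" by (rule FAnd.IH(2)) (simp add: FAnd.prems)
  ultimately show ?case by simp
next
  case (FOr \<phi> \<psi>)
  have "holds \<phi> x = holds \<phi> y" by (rule FOr.IH(1)) (simp add: FOr.prems)
  moreover have "holds \<psi> x = holds \<psi> y" by (rule FOr.IH(2)) (simp add: FOr.prems)
  ultimately show ?case by simp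
next
  case (FEx i \<phi>)
  have "holds \<phi> (x(i := d)) = holds \<phi> (y(i := d))" for d
    by (rule FEx.IH) (use FEx.prems in auto)
  then show ?case by simp
qed

text \<open>Existential quantifiers commute, so only the set \<open>J\<close> of quantified
  variables is recorded. A variable may be quantified twice, or bear the index of a free variable of
  the formula in question.\<close>

lemma existential_prenex:
  assumes "existential \<phi>"
  shows "\<exists>J \<psi>. finite J \<and> quantifier_free \<psi> \<and> set_rformula \<psi> \<subseteq> set_rformula \<phi> \<and>
    free_vars \<psi> \<subseteq> free_vars \<phi> \<union> J \<and> (\<forall>x. holds \<phi> x \<longleftrightarrow> (\<exists>z. (\<forall>j. j \<notin> J \<longrightarrow> z j = x j) \<and> holds \<psi> z))"
  using assms
proof induction
  case (1 \<phi>)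
  have eq: "holds \<phi> x \<longleftrightarrow> (\<exists>z. (\<forall>j. j \<notin> {} \<longrightarrow> z j = x j) \<and> holds \<phi> z)" for x
    by (auto simp flip: fun_eq_iff)
  show ?case by (intro exI[of _ "{}"] exI[of _ \<phi>] conjI allI eq) (use 1 in auto)
next
  case (2 \<phi> i)
  then obtain J \<psi> where J: "finite J" "quantifier_free \<psi>" "set_rformula \<psi> \<subseteq> set_rformula \<phi>"
    "free_vars \<psi> \<subseteq> free_vars \<phi> \<union> J"
    "\<And>x. holds \<phi> x \<longleftrightarrow> (\<exists>z. (\<forall>j. j \<notin> J \<longrightarrow> z j = x j) \<and> holds \<psi> z)"
    by blast
  have eq: "holds (FEx i \<phi>) x \<longleftrightarrow> (\<exists>z. (\<forall>j. j \<notin> insert i J \<longrightarrow> z j = x j) \<and> holds \<psi> z)" for x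
  proof
    assume "holds (FEx i \<phi>) x"
    then obtain d where "holds \<phi> (x(i := d))" by auto
    then obtain z where "\<forall>j. j \<notin> J \<longrightarrow> z j = (x(i := d)) j" "holds \<psi> z" unfolding J(5) by blast
    then show "\<exists>z. (\<forall>j. j \<notin> insert i J \<longrightarrow> z j = x j) \<and> holds \<psi> z"
      by (intro exI[of _ z]) auto
  next
    assume "\<exists>z. (\<forall>j. j \<notin> insert i J \<longrightarrow> z j = x j) \<and> holds \<psi> z"
    then obtain z where z: "\<forall>j. j \<notin> insert i J \<longrightarrow> z j = x j" "holds \<psi> z" by blast
    then have "\<forall>j. j \<notin> J \<longrightarrow> z j = (x(i := z i)) j" by auto
    then have "holds \<phi> (x(i := z i))" unfolding J(5) using z(2) by blast
    then show "holds (FEx i \<phi>) x" by auto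
  qed
  show ?case
    by (intro exI[of _ "insert i J"] exI[of _ \<psi>] conjI allI eq) (use J(1-4) in auto)
qed

text \<open>An equation true at \<open>z\<close> holds on the whole locus, and an inequation is an
  open condition, so either truth value of an atom persists. Stating an equivalence lets the
  induction pass through negation.\<close>

lemma quantifier_free_locally_constant:
  assumes T: "topspace \<tau> = UNIV" "openin \<tau> {y. y \<noteq> 0}" and ift: "polynomial_IFT \<tau>"
    and C: "is_subfield C"
  shows "quantifier_free \<psi> \<Longrightarrow> set_rformula \<psi> \<subseteq> C \<Longrightarrow> \<sigma> ` free_vars \<psi> \<subseteq> {..<M} \<Longrightarrow>
    \<exists>V. openin (power_topology \<tau> M) V \<and> restrict z {..<M} \<in> V \<and>
      (\<forall>z'. restrict z' {..<M} \<in> V \<and> specializes C M z z' \<longrightarrow>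
        (holds \<psi> (\<lambda>j. z' (\<sigma> j)) \<longleftrightarrow> holds \<psi> (\<lambda>j. z (\<sigma> j))))"
proof (induction \<psi>)
  case (FEq s t)
  have "set_rterm s \<subseteq> C" "\<sigma> ` rterm_vars s \<subseteq> {..<M}" "set_rterm t \<subseteq> C" "\<sigma> ` rterm_vars t \<subseteq> {..<M}"
    using FEq.prems by (auto simp: image_Un)
  then obtain f g where f: "f \<in> mpoly_ring C M" "\<And>y. mpoly_eval f y = rterm_val (\<lambda>j. y (\<sigma> j)) s"
    and g: "g \<in> mpoly_ring C M" "\<And>y. mpoly_eval g y = rterm_val (\<lambda>j. y (\<sigma> j)) t"
    using rterm_mpoly[OF C, of s \<sigma> M] rterm_mpoly[OF C, of t \<sigma> M] by blast
  define h where "h = f - g"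
  have h: "h \<in> mpoly_ring C M" unfolding h_def by (rule mpoly_ring_diff[OF C f(1) g(1)])
  have holds_h: "holds (FEq s t) (\<lambda>j. y (\<sigma> j)) \<longleftrightarrow> mpoly_eval h y = 0" for y
    by (simp add: h_def mpoly_eval_diff f(2) g(2))
  have cong: "mpoly_eval h (restrict y {..<M}) = mpoly_eval h y" for y
    by (rule mpoly_eval_cong[OF h]) simp
  show ?case
  proof (cases "mpoly_eval h z = 0")
    case True
    then have "mpoly_eval h z' = 0" if "specializes C M z z'" for z'
      using that h unfolding specializes_def by blast
    moreover have "openin (power_topology \<tau> M) (tuples M)"
      using openin_topspace[of "power_topology \<tau> M"] by (simp add: T(1))
    moreover have "restrict z {..<M} \<in> tuples M" by simp
    ultimately show ?thesis unfolding holds_h using True by blast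
  next
    case False
    have "openin (power_topology \<tau> M) {x \<in> tuples M. mpoly_eval h x \<noteq> 0}"
      by (rule mpoly_nonzero_open[OF T ift]) (use h mpoly_ring_mono_coeffs[of C UNIV M] in blast)
    moreover have "restrict y {..<M} \<in> {x \<in> tuples M. mpoly_eval h x \<noteq> 0} \<longleftrightarrow> mpoly_eval h y \<noteq> 0" for y
      unfolding mem_Collect_eq cong by simp
    ultimately show ?thesis unfolding holds_h using False by blast
  qed
next
  case (FNot \<psi>)
  have "quantifier_free \<psi>" "set_rformula \<psi> \<subseteq> C" "\<sigma> ` free_vars \<psi> \<subseteq> {..<M}" using FNot.prems by auto
  from FNot.IH[OF this] show ?case unfolding holds.simps by blast
next
  case (FAnd \<phi> \<psi>)
  have 1: "quantifier_free \<phi>" "set_rformula \<phi> \<subseteq> C" "\<sigma> ` free_vars \<phi> \<subseteq> {..<M}"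
    and 2: "quantifier_free \<psi>" "set_rformula \<psi> \<subseteq> C" "\<sigma> ` free_vars \<psi> \<subseteq> {..<M}"
    using FAnd.prems by (auto simp: image_Un)
  from FAnd.IH(1)[OF 1] obtain V where V: "openin (power_topology \<tau> M) V" "restrict z {..<M} \<in> V"
    "\<And>z'. restrict z' {..<M} \<in> V \<Longrightarrow> specializes C M z z' \<Longrightarrow> (holds \<phi> (\<lambda>j. z' (\<sigma> j)) \<longleftrightarrow> holds \<phi> (\<lambda>j. z (\<sigma> j)))"
    by blast
  from FAnd.IH(2)[OF 2] obtain V' where V': "openin (power_topology \<tau> M) V'" "restrict z {..<M} \<in> V'"
    "\<And>z'. restrict z' {..<M} \<in> V' \<Longrightarrow> specializes C M z z' \<Longrightarrow> (holds \<psi> (\<lambda>j. z' (\<sigma> j)) \<longleftrightarrow> holds \<psi> (\<lambda>j. z (\<sigma> j)))"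
    by blast
  have "openin (power_topology \<tau> M) (V \<inter> V')" using V(1) V'(1) by (rule openin_Int)
  then show ?case
    unfolding holds.simps using V(2,3) V'(2,3) by blast
next
  case (FOr \<phi> \<psi>)
  have 1: "quantifier_free \<phi>" "set_rformula \<phi> \<subseteq> C" "\<sigma> ` free_vars \<phi> \<subseteq> {..<M}"
    and 2: "quantifier_free \<psi>" "set_rformula \<psi> \<subseteq> C" "\<sigma> ` free_vars \<psi> \<subseteq> {..<M}"
    using FOr.prems by (auto simp: image_Un)
  from FOr.IH(1)[OF 1] obtain V where V: "openin (power_topology \<tau> M) V" "restrict z {..<M} \<in> V"
    "\<And>z'. restrict z' {..<M} \<in> V \<Longrightarrow> specializes C M z z' \<Longrightarrow> (holds \<phi> (\<lambda>j. z' (\<sigma> j)) \<longleftrightarrow> holds \<phi> (\<lambda>j. z (\<sigma> j)))"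
    by blast
  from FOr.IH(2)[OF 2] obtain V' where V': "openin (power_topology \<tau> M) V'" "restrict z {..<M} \<in> V'"
    "\<And>z'. restrict z' {..<M} \<in> V' \<Longrightarrow> specializes C M z z' \<Longrightarrow> (holds \<psi> (\<lambda>j. z' (\<sigma> j)) \<longleftrightarrow> holds \<psi> (\<lambda>j. z (\<sigma> j)))"
    by blast
  have "openin (power_topology \<tau> M) (V \<inter> V')" using V(1) V'(1) by (rule openin_Int)
  then show ?case
    unfolding holds.simps using V(2,3) V'(2,3) by blast
qed simp

theorem theorem1p2:
  fixes C :: "'a::field set" and c :: "'a rel" and \<tau> :: "'a topology"
    and m :: nat and S :: "(nat \<Rightarrow> 'a) set" and a :: "nat \<Rightarrow> 'a"
  assumes "separable_ext UNIV C"
    and "henselian_topology TYPE('g::linordered_ab_group_add) \<tau>"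
    and "Well_order c" and "p_basis C prime_field (Field c)"
    and "existentially_definable C m S"
    and "a \<in> S"
  shows "\<exists>n. \<exists>b \<in> tuples n.
    let l = lambda_length UNIV C c n b m a; e = lambda_tuple UNIV C c n b m a
    in \<exists>U. neighbourhood (power_topology \<tau> l) e U \<and>
           coord_proj l e m a ` (locus_points C l e \<inter> U) \<subseteq> S"
proof -
  have C: "is_subfield C" using assms(1) unfolding separable_ext_def by blast
  have top: "V_topology TYPE('g) \<tau>" and ift: "polynomial_IFT \<tau>"
    using assms(2) unfolding henselian_topology_def by blast+
  note T = V_topology_punctured_open[OF top]
  obtain \<phi> where \<phi>: "existential \<phi>" "set_rformula \<phi> \<subseteq> C" "free_vars \<phi> \<subseteq> {..<m}" "S = {x \<in> tuples m. holds \<phi> x}"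
    using assms(5) unfolding existentially_definable_def by blast
  obtain J \<psi> where J: "finite J" "quantifier_free \<psi>" "set_rformula \<psi> \<subseteq> set_rformula \<phi>" "free_vars \<psi> \<subseteq> free_vars \<phi> \<union> J"
    and \<phi>_iff: "\<And>x. holds \<phi> x \<longleftrightarrow> (\<exists>z. (\<forall>j. j \<notin> J \<longrightarrow> z j = x j) \<and> holds \<psi> z)"
    using existential_prenex[OF \<phi>(1)] by blast
  have "holds \<phi> a" using assms(6) \<phi>(4) by blast
  then obtain z where z: "\<forall>j. j \<notin> J \<longrightarrow> z j = a j" "holds \<psi> z" unfolding \<phi>_iff by blast
  \<comment> \<open>The tuple \<open>b\<close> lists all values of the satisfying assignment below a
    bound for \<open>J\<close>, so every witness is among its entries.\<close>
  obtain n where n: "J \<subseteq> {..<n}" using finite_nat_iff_bounded[of J] J(1) by blast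
  define b where "b = restrict z {..<n}"
  have b: "b \<in> tuples n" "entries n b = z ` {..<n}" unfolding b_def entries_def by auto
  define r where "r = lambda_sep_order UNIV C c n b m a"
  note r = lambda_sep_order_props[OF assms(1,3,4), where n = n and b = b and m = m and a = a, folded r_def]
  define l where "l = card (Field r)"
  define e where "e = enum_tuple r"
  have e: "e \<in> tuples l" "inj_on e {..<l}" "e ` {..<l} = Field r"
    using enum_tuple_props[OF r(1,2)] unfolding e_def l_def by (auto simp: bij_betw_def)
  obtain bs where bs: "set bs = entries n b" "extendable_list C l e bs"
    using separating_order[OF C finite_entries[of n b], of e l] r(4) e(3) by auto
  let ?M = "l + length bs"
  let ?y = "append_coords l e bs"
  \<comment> \<open>A quantified variable may have an index below \<open>m\<close>; its value is
    then the witness \<open>z j\<close> and not \<open>a j\<close>, so membership in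
    \<open>J\<close> is decided first. Positions of witnesses are searched by value, because the
    separating order \<open>bs\<close> need not be that of \<open>b\<close>.\<close>
  define \<sigma> where "\<sigma> j = (if j \<in> J then l + (SOME k. k < length bs \<and> bs ! k = z j) else (THE i. i < l \<and> e i = a j))" for j
  have \<sigma>_J: "\<sigma> j < ?M \<and> ?y (\<sigma> j) = z j" if "j \<in> J" for j
  proof -
    have "z j \<in> set bs" using that n unfolding bs(1) b(2) by blast
    then have "\<exists>k. k < length bs \<and> bs ! k = z j" by (simp add: in_set_conv_nth)
    then have "(SOME k. k < length bs \<and> bs ! k = z j) < length bs \<and> bs ! (SOME k. k < length bs \<and> bs ! k = z j) = z j"
      by (rule someI_ex)
    then show ?thesis using that by (simp add: \<sigma>_def append_coords_nth)
  qed
  have \<sigma>_m: "\<sigma> j < l \<and> e (\<sigma> j) = a j" if "j \<notin> J" "j < m" for j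
  proof -
    have "a j \<in> e ` {..<l}" using r(3) that(2) unfolding e(3) entries_def by blast
    then have "\<exists>!i. i < l \<and> e i = a j" using e(2) unfolding inj_on_def by auto
    then have "(THE i. i < l \<and> e i = a j) < l \<and> e (THE i. i < l \<and> e i = a j) = a j" by (rule theI')
    then show ?thesis using that(1) by (simp add: \<sigma>_def)
  qed
  have fv: "j \<in> J \<or> j \<notin> J \<and> j < m" if "j \<in> free_vars \<psi>" for j
    using that J(4) \<phi>(3) by blast
  have y_z: "?y (\<sigma> j) = z j" if "j \<in> free_vars \<psi>" for j
    using fv[OF that]
  proof
    assume j: "j \<notin> J \<and> j < m"
    then show ?thesis using \<sigma>_m[of j] z(1) by (simp add: append_coords_nth)
  qed (use \<sigma>_J in blast)
  have \<sigma>_less: "\<sigma> ` free_vars \<psi> \<subseteq> {..<?M}"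
    using fv \<sigma>_J \<sigma>_m by fastforce
  have \<psi>C: "set_rformula \<psi> \<subseteq> C" using J(3) \<phi>(2) by (rule subset_trans)
  from quantifier_free_locally_constant[OF T ift C J(2) \<psi>C \<sigma>_less, of ?y]
  obtain V where V: "openin (power_topology \<tau> ?M) V" "restrict ?y {..<?M} \<in> V"
    "\<And>z'. restrict z' {..<?M} \<in> V \<Longrightarrow> specializes C ?M ?y z' \<Longrightarrow>
      (holds \<psi> (\<lambda>j. z' (\<sigma> j)) \<longleftrightarrow> holds \<psi> (\<lambda>j. ?y (\<sigma> j)))"
    by blast
  from locus_extension[OF T ift C bs(2) V(1,2)]
  obtain U where U: "openin (power_topology \<tau> l) U" "restrict e {..<l} \<in> U"
    "\<And>e'. restrict e' {..<l} \<in> U \<Longrightarrow> specializes C l e e' \<Longrightarrow>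
      (\<exists>ds'. length ds' = length bs \<and> restrict (append_coords l e' ds') {..<?M} \<in> V \<and>
        specializes C ?M ?y (append_coords l e' ds'))"
    by blast
  have restrict_id: "restrict x {..<l} = x" if "x \<in> tuples l" for x :: "nat \<Rightarrow> 'a"
    using that by (intro extensional_restrict) (simp add: PiE_def)
  have nbhd: "neighbourhood (power_topology \<tau> l) e U"
    unfolding neighbourhood_def using openin_subset[OF U(1)] U(1,2) restrict_id[OF e(1)] by auto
  have "coord_proj l e m a x \<in> S" if x: "x \<in> locus_points C l e" "x \<in> U" for x
  proof -
    have xt: "x \<in> tuples l" and spec: "specializes C l e x"
      using x(1) unfolding locus_points_def specializes_def by blast+
    obtain ds' where ds': "length ds' = length bs" "restrict (append_coords l x ds') {..<?M} \<in> V"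
      "specializes C ?M ?y (append_coords l x ds')"
      using U(3)[of x, unfolded restrict_id[OF xt], OF x(2) spec] by blast
    let ?y' = "append_coords l x ds'"
    let ?w = "coord_proj l e m a x"
    \<comment> \<open>The quantified variables are read off the appended coordinates of the extended
      point, all others off the projected point.\<close>
    define z' where "z' j = (if j \<in> J then ?y' (\<sigma> j) else ?w j)" for j
    have "holds \<psi> (\<lambda>j. ?y (\<sigma> j))" using z(2) holds_cong[of \<psi> "\<lambda>j. ?y (\<sigma> j)" z] y_z by blast
    then have "holds \<psi> (\<lambda>j. ?y' (\<sigma> j))" using V(3)[OF ds'(2,3)] by blast
    \<comment> \<open>Outside \<open>J\<close>, \<open>\<sigma>\<close> picks the same position of
      \<open>a j\<close> in \<open>e\<close> as \<open>coord_proj\<close>, and appending coordinates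
      leaves it unchanged.\<close>
    moreover have "?y' (\<sigma> j) = z' j" if "j \<in> free_vars \<psi>" for j
    proof (cases "j \<in> J")
      case False
      then have "j < m" using fv[OF that] by blast
      then have "?w j = x (\<sigma> j)" using False by (simp add: coord_proj_def \<sigma>_def)
      then show ?thesis using False \<sigma>_m[OF False \<open>j < m\<close>] by (simp add: z'_def append_coords_nth)
    qed (simp add: z'_def)
    ultimately have "holds \<psi> z'" using holds_cong[of \<psi> "\<lambda>j. ?y' (\<sigma> j)" z'] by blast
    moreover have "\<forall>j. j \<notin> J \<longrightarrow> z' j = ?w j" by (simp add: z'_def)
    ultimately have "holds \<phi> ?w" unfolding \<phi>_iff by blast
    moreover have "?w \<in> tuples m" unfolding coord_proj_def by simp
    ultimately show ?thesis unfolding \<phi>(4) by blast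
  qed
  then have "\<exists>U. neighbourhood (power_topology \<tau> l) e U \<and> coord_proj l e m a ` (locus_points C l e \<inter> U) \<subseteq> S"
    using nbhd by blast
  then have "let l = lambda_length UNIV C c n b m a; e = lambda_tuple UNIV C c n b m a
    in \<exists>U. neighbourhood (power_topology \<tau> l) e U \<and> coord_proj l e m a ` (locus_points C l e \<inter> U) \<subseteq> S"
    unfolding Let_def lambda_length_def lambda_tuple_def r_def[symmetric] l_def[symmetric] e_def[symmetric] .
  then show ?thesis using b(1) by blast
qed

end
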